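(* Let $\mathfrak g$ be an augmented symmetrizable Kac-Moody algebra with distinguished element $d$, simple roots $\alpha_1,\dots,\alpha_n$, coroots $\alpha_1^\vee,\dots,\alpha_n^\vee$ and fundamental weights $\Lambda_1,\dots,\Lambda_n$. Let $V$ be an integrable, $d$-finite and orthogonal $\mathfrak g$-representation, and let $m_\beta$ be the multiplicity of a weight $\beta$ of $V$, so that the character of $V$ can be written as $$\mathrm{Char}\,V=\sum_{\beta(d)>0}m_\beta(e^\beta+e^{-\beta})+m_0 .$$ Then the $\mathfrak g$-representation $\mathrm{Spin}_0(V)$ has the character $$\mathrm{Char}\,\mathrm{Spin}_0(V)=e^{\Lambda}\prod_{\beta(d)>0}(1+e^{-\beta})^{m_\beta}.$$ Here $\Lambda:=\sum_{i=1}^n c_i\Lambda_i$, with $$c_i:=\sum\tfrac12 m_\beta\,\beta(\alpha_i^\vee),$$ where the sum is over all weights $\beta$ of $V$ such that $\beta(d)>0$ and $s_i(\beta)(d)<0$, and $s_i$ denotes the reflection in the plane perpendicular to the simple root $\alpha_i$, i.e. $s_i(\beta)=\beta-\beta(\alpha_i^\vee)\alpha_i$. Because of the $d$-finiteness of $V$, the sum defining $c_i$ has finitely many nonzero terms.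
   Context: All algebras are over $\mathbb C$. A symmetrizable Kac-Moody algebra is the Lie algebra attached to a realization $(\mathfrak h,\Pi=\{\alpha_i\},\Pi^\vee=\{\alpha_i^\vee\})$, $\dim\mathfrak h=2n-\mathrm{rank}\,A$, of an $n\times n$ symmetrizable generalized Cartan matrix $A=(a_{ij})$, with generators $X_{\pm i}$ and all $H\in\mathfrak h$ subject to $[H_1,H_2]=0$, $[H,X_{\pm i}]=\pm\alpha_i(H)X_{\pm i}$, $[X_i,X_{-j}]=\delta_{ij}\alpha_i^\vee$ and the Serre relations. Augmented symmetrizable Kac-Moody algebra: a Lie algebra $\mathfrak g$ with a distinguished element $d$ of its Cartan subalgebra $\mathfrak h$ such that either $\mathfrak g$ is a symmetrizable Kac-Moody algebra with $\alpha_i(d)\in\mathbb Z_{>0}$ for all simple roots $\alpha_i$; or $\mathfrak g=\mathfrak g_1\oplus\mathbb C d$ with $\mathfrak g_1$ a symmetrizable Kac-Moody algebra with Cartan subalgebra $\mathfrak h_1$, $\mathfrak h=\mathfrak h_1\oplus\mathbb C d$, and $[d,X_{\pm\alpha}]=\pm c_\alpha X_{\pm\alpha}$ with $c_\alpha$ a positive integer for each root vector $X_{\pm\alpha}$ of $\mathfrak g_1$ (one sets $\alpha(d):=c_\alpha$). For a representation $V$, $V^{(\Lambda)}$ denotes the weight space of weight $\Lambda$. $V$ is $d$-finite if $\Lambda(d)\in\mathbb Z\setminus\{0\}$ for all nonzero weights $\Lambda$ of $V$ and $\bigoplus_{\Lambda(d)=k}V^{(\Lambda)}$ is finite-dimensional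 for each $k\in\mathbb Z$. $V$ is orthogonal if it has a non-degenerate symmetric bilinear form $Q$ with $Q(Xu,v)+Q(u,Xv)=0$ for all $X\in\mathfrak g$, $u,v\in V$. $V$ is integrable if simple root vectors act locally nilpotently. Spin. Let $V$ be a $d$-finite orthogonal $\mathfrak g$-representation. Take a basis $\{e_i\}_{i\in I}$ of weight vectors with $Q(e_i,e_j)=\delta_{i,-j}$, where $I$ is $\{m,\dots,1,-1,\dots,-m\}$, $\{m,\dots,1,0,-1,\dots,-m\}$, $\mathbb Z$ or $\mathbb Z\setminus\{0\}$; without loss of generality the weight $\beta_i$ of $e_i$ satisfies $\beta_i(d)\ge 0$ for $i>0$. Let $I^+=\{i\in I:i>0\}$, $V^+=\mathrm{span}\{e_i:i\in I^+\}$, and $\mathrm{Spin}(V):=\wedge^\bullet V^+$ (finite linear combinations of finite wedges), with basis $e_J=e_{j_1}\wedge\cdots\wedge e_{j_k}$, $J=\{j_1>\cdots>j_k\}\subset I^+$, $e_\emptyset=1$. For $i\in I^+$, $e_i$ acts by $e_J\mapsto e_i\wedge e_J$; $e_{-i}$ acts by $e_J\mapsto 2(-1)^{|\{j\in J:j>i\}|}e_{J\setminus\{i\}}$ if $i\in J$ and $e_J\mapsto0$ otherwise; $e_0$ (if $0\in I$) acts by $e_J\mapsto(-1)^{|J|}e_J$ (Clifford relations $e_{-i}e_j+e_je_{-i}=2\delta_{ij}$). Let $\mathfrak{so}(V)$ be the Lie algebra of matrices $A=(a_{i,j})_{i,j\in I}$ with $a_{i,j}=-a_{-j,-i}$, finitely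 many nonzero entries in each column, and such that the blocks $(a_{i,-j})_{i,j>0}$, $(a_{-i,j})_{i,j>0}$ have finitely many nonzero entries. With $Z_{i,j}=E_{i,j}-E_{-j,-i}$ ($i>-j$, $E_{i,j}$ the coordinate matrices), put $\phi(Z_{i,j})=-\tfrac12 e_je_{-i}$, extended linearly (also to infinite sums) to $\mathfrak{so}(V)$. Then $\widetilde{\mathfrak{so}}(V)=\phi(\mathfrak{so}(V))\oplus\mathbb C1$ is a Lie algebra acting on $\mathrm{Spin}(V)$, a central extension $\pi:\widetilde{\mathfrak{so}}(V)\to\mathfrak{so}(V)$, $\phi(A)\mapsto A$, $1\mapsto 0$. The action on $V$ gives $\sigma:\mathfrak g\to\mathfrak{so}(V)$. Let $\mathfrak h'=\bigoplus\mathbb C\alpha_i^\vee$, fix a complement $\mathfrak h''$ of $\mathfrak h'$ in $\mathfrak h$, let $\mathfrak g_R$ be the span of all root vectors, and fix a linear functional $\psi$ on $\mathfrak h''\oplus\mathfrak g_R$ with $\psi(\mathfrak g_R)=0$. There is a unique Lie algebra map $\tilde\sigma:\mathfrak g\to\widetilde{\mathfrak{so}}(V)$ with $\pi\tilde\sigma=\sigma$ and $\tilde\sigma=\phi\sigma+\psi$ on $\mathfrak h''\oplus\mathfrak g_R$; it makes $\mathrm{Spin}(V)$ a $\mathfrak g$-representation. If $V$ is integrable and $m_0=\dim V^{(0)}$, then $\mathrm{Spin}(V)$ is isomorphic to a direct sum of $2^{\lfloor m_0/2\rfloor}$ copies of a $\mathfrak g$-representation called $\mathrm{Spin}_0(V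)$.
   Formalization: The formal theorem assumes in addition that Λ agrees with ψ on h'' (e.g. both zero there); the values of the fundamental weights on h'' are otherwise unspecified, and the formula for Char Spin_0(V) fails when Λ and ψ differ on h''. *)

theory Defs
  imports
    "HOL-Analysis.Analysis"
    "HOL-Library.Function_Algebras"
    "HOL-Library.Poly_Mapping"
begin

section \<open>Linear algebra conventions\<close>

text \<open>
  Vector spaces over the complex numbers are given by a scalar multiplication \<open>sc\<close> satisfying
  \<^locale>\<open>vector_space\<close>.  A linear functional on a subspace \<open>S\<close> is represented by
  the function that vanishes outside \<open>S\<close>, so that equality of functionals is equality of
  functions; sums and negatives are those of \<^theory>\<open>HOL-Library.Function_Algebras\<close>.
\<close>

definition linear_functional_on ::
    "(complex \<Rightarrow> 'a::ab_group_add \<Rightarrow> 'a) \<Rightarrow> 'a set \<Rightarrow> ('a \<Rightarrow> complex) \<Rightarrow> bool" where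
  "linear_functional_on sc S f \<longleftrightarrow>
     (\<forall>x\<in>S. \<forall>y\<in>S. f (x + y) = f x + f y) \<and> (\<forall>c. \<forall>x\<in>S. f (sc c x) = c * f x)"

definition dual_space ::
    "(complex \<Rightarrow> 'a::ab_group_add \<Rightarrow> 'a) \<Rightarrow> 'a set \<Rightarrow> ('a \<Rightarrow> complex) set" where
  "dual_space sc S = {f. linear_functional_on sc S f \<and> (\<forall>x. x \<notin> S \<longrightarrow> f x = 0)}"

definition fin_dim :: "(complex \<Rightarrow> 'a::ab_group_add \<Rightarrow> 'a) \<Rightarrow> 'a set \<Rightarrow> bool" where
  "fin_dim sc S \<longleftrightarrow> (\<exists>B. finite B \<and> S \<subseteq> module.span sc B)"

definition complement_in ::
    "(complex \<Rightarrow> 'a::ab_group_add \<Rightarrow> 'a) \<Rightarrow> 'a set \<Rightarrow> 'a set \<Rightarrow> 'a set \<Rightarrow> bool" where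
  "complement_in sc S T T' \<longleftrightarrow>
     module.subspace sc T' \<and> T \<inter> T' = {0} \<and> S = {x + y |x y. x \<in> T \<and> y \<in> T'}"


section \<open>Lie algebras and presentations\<close>

record 'g lie_alg =
  lscale :: "complex \<Rightarrow> 'g \<Rightarrow> 'g"
  lbracket :: "'g \<Rightarrow> 'g \<Rightarrow> 'g"

definition lie_algebra :: "('g::ab_group_add, 'more) lie_alg_scheme \<Rightarrow> bool" where
  "lie_algebra L \<longleftrightarrow>
     vector_space (lscale L) \<and>
     (\<forall>x y z. lbracket L (x + y) z = lbracket L x z + lbracket L y z) \<and>
     (\<forall>x y z. lbracket L x (y + z) = lbracket L x y + lbracket L x z) \<and>
     (\<forall>c x y. lbracket L (lscale L c x) y = lscale L c (lbracket L x y)) \<and>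
     (\<forall>c x y. lbracket L x (lscale L c y) = lscale L c (lbracket L x y)) \<and>
     (\<forall>x. lbracket L x x = 0) \<and>
     (\<forall>x y z. lbracket L x (lbracket L y z) + lbracket L y (lbracket L z x)
                + lbracket L z (lbracket L x y) = 0)"

datatype 'x lie_term =
    Gen 'x
  | ZeroT
  | AddT "'x lie_term" "'x lie_term"
  | ScaleT complex "'x lie_term"
  | BrT "'x lie_term" "'x lie_term"

text \<open>
  The congruence on Lie terms generated by the axioms of complex Lie algebras and the relations
  \<open>R\<close>.  The term algebra modulo this congruence is the Lie algebra presented by the
  generators and \<open>R\<close>.
\<close>

inductive lie_cong :: "('x lie_term \<Rightarrow> 'x lie_term \<Rightarrow> bool) \<Rightarrow> 'x lie_term \<Rightarrow> 'x lie_term \<Rightarrow> bool"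
  for R where
  rel: "R s t \<Longrightarrow> lie_cong R s t"
| refl: "lie_cong R s s"
| sym: "lie_cong R s t \<Longrightarrow> lie_cong R t s"
| trans: "lie_cong R s t \<Longrightarrow> lie_cong R t u \<Longrightarrow> lie_cong R s u"
| cong_add: "lie_cong R s s' \<Longrightarrow> lie_cong R t t' \<Longrightarrow> lie_cong R (AddT s t) (AddT s' t')"
| cong_scale: "lie_cong R s s' \<Longrightarrow> lie_cong R (ScaleT c s) (ScaleT c s')"
| cong_br: "lie_cong R s s' \<Longrightarrow> lie_cong R t t' \<Longrightarrow> lie_cong R (BrT s t) (BrT s' t')"
| add_assoc: "lie_cong R (AddT (AddT s t) u) (AddT s (AddT t u))"
| add_comm: "lie_cong R (AddT s t) (AddT t s)"
| add_zero: "lie_cong R (AddT ZeroT s) s"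
| add_neg: "lie_cong R (AddT s (ScaleT (-1) s)) ZeroT"
| scale_add: "lie_cong R (ScaleT c (AddT s t)) (AddT (ScaleT c s) (ScaleT c t))"
| add_scale: "lie_cong R (ScaleT (a + b) s) (AddT (ScaleT a s) (ScaleT b s))"
| scale_scale: "lie_cong R (ScaleT a (ScaleT b s)) (ScaleT (a * b) s)"
| scale_one: "lie_cong R (ScaleT 1 s) s"
| br_add_left: "lie_cong R (BrT (AddT s t) u) (AddT (BrT s u) (BrT t u))"
| br_add_right: "lie_cong R (BrT s (AddT t u)) (AddT (BrT s t) (BrT s u))"
| br_scale_left: "lie_cong R (BrT (ScaleT c s) t) (ScaleT c (BrT s t))"
| br_scale_right: "lie_cong R (BrT s (ScaleT c t)) (ScaleT c (BrT s t))"
| br_alt: "lie_cong R (BrT s s) ZeroT"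
| br_jacobi: "lie_cong R (AddT (AddT (BrT s (BrT t u)) (BrT t (BrT u s))) (BrT u (BrT s t))) ZeroT"

primrec lie_eval ::
    "('g::ab_group_add, 'more) lie_alg_scheme \<Rightarrow> ('x \<Rightarrow> 'g) \<Rightarrow> 'x lie_term \<Rightarrow> 'g" where
  "lie_eval L \<gamma> (Gen x) = \<gamma> x"
| "lie_eval L \<gamma> ZeroT = 0"
| "lie_eval L \<gamma> (AddT s t) = lie_eval L \<gamma> s + lie_eval L \<gamma> t"
| "lie_eval L \<gamma> (ScaleT c t) = lscale L c (lie_eval L \<gamma> t)"
| "lie_eval L \<gamma> (BrT s t) = lbracket L (lie_eval L \<gamma> s) (lie_eval L \<gamma> t)"

text \<open>
  The Lie subalgebra \<open>S\<close> of \<open>L\<close> is presented by the generators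
  \<open>\<gamma> x\<close>, \<open>x \<in> X\<close>, and the relations \<open>R\<close>: evaluation
  induces an isomorphism from the terms over \<open>X\<close> modulo the congruence onto \<open>S\<close>.
\<close>

definition presented_by ::
    "('g::ab_group_add, 'more) lie_alg_scheme \<Rightarrow> 'g set \<Rightarrow> 'x set \<Rightarrow> ('x \<Rightarrow> 'g) \<Rightarrow>
     ('x lie_term \<Rightarrow> 'x lie_term \<Rightarrow> bool) \<Rightarrow> bool" where
  "presented_by L S X \<gamma> R \<longleftrightarrow>
     S = lie_eval L \<gamma> ` {t. set_lie_term t \<subseteq> X} \<and>
     (\<forall>s t. set_lie_term s \<subseteq> X \<longrightarrow> set_lie_term t \<subseteq> X \<longrightarrow>
        (lie_eval L \<gamma> s = lie_eval L \<gamma> t \<longleftrightarrow> lie_cong R s t))"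


section \<open>Augmented symmetrizable Kac-Moody algebras\<close>

text \<open>
  The simple roots are indexed by a finite type \<open>'n\<close>, so \<open>n = CARD('n)\<close>.
  The Lie algebra is the whole type \<open>'g\<close>; \<^term>\<open>cartan\<close> is the Cartan subalgebra
  \<open>\<hh>\<close>, and \<open>xpos i\<close>, \<open>xneg i\<close> are the Chevalley generators
  \<open>X\<^sub>i\<close> and \<open>X\<^sub>-\<^sub>i\<close>.
\<close>

record ('g, 'n) km_data = "'g lie_alg" +
  gcm :: "int ^ 'n ^ 'n"
  cartan :: "'g set"
  sroot :: "'n \<Rightarrow> 'g \<Rightarrow> complex"
  coroot :: "'n \<Rightarrow> 'g"
  xpos :: "'n \<Rightarrow> 'g"
  xneg :: "'n \<Rightarrow> 'g"

definition generalized_cartan_matrix :: "int ^ 'n ^ 'n \<Rightarrow> bool" where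
  "generalized_cartan_matrix A \<longleftrightarrow>
     (\<forall>i. A $ i $ i = 2) \<and>
     (\<forall>i j. i \<noteq> j \<longrightarrow> A $ i $ j \<le> 0) \<and>
     (\<forall>i j. A $ i $ j = 0 \<longrightarrow> A $ j $ i = 0)"

definition complex_matrix :: "int ^ 'n ^ 'n \<Rightarrow> complex ^ 'n ^ 'n" where
  "complex_matrix A = (\<chi> i j. of_int (A $ i $ j))"

definition symmetrizable :: "int ^ 'n ^ 'n \<Rightarrow> bool" where
  "symmetrizable A \<longleftrightarrow>
     (\<exists>D B. (\<forall>i j. i \<noteq> j \<longrightarrow> D $ i $ j = 0) \<and> invertible D \<and> transpose B = B \<and>
            complex_matrix A = D ** B)"

text \<open>
  In the next definitions the Cartan subalgebra \<open>H\<close> is a separate argument, because they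
  are also applied to a proper ideal of \<open>K\<close> and its Cartan subalgebra.
\<close>

definition realization :: "('g::ab_group_add, 'n::finite) km_data \<Rightarrow> 'g set \<Rightarrow> bool" where
  "realization K H \<longleftrightarrow>
     module.subspace (lscale K) H \<and> fin_dim (lscale K) H \<and>
     vector_space.dim (lscale K) H + rank (complex_matrix (gcm K)) = 2 * CARD('n) \<and>
     (\<forall>i. linear_functional_on (lscale K) H (sroot K i)) \<and>
     (\<forall>a. (\<forall>x\<in>H. (\<Sum>i\<in>UNIV. a i * sroot K i x) = 0) \<longrightarrow> (\<forall>i. a i = 0)) \<and>
     (\<forall>i. coroot K i \<in> H) \<and> inj (coroot K) \<and>
     \<not> module.dependent (lscale K) (range (coroot K)) \<and>
     (\<forall>i j. sroot K j (coroot K i) = of_int (gcm K $ i $ j))"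

datatype ('g, 'n) km_gen = XPos 'n | XNeg 'n | Cart 'g

primrec km_gen_val :: "('g, 'n::finite) km_data \<Rightarrow> ('g, 'n) km_gen \<Rightarrow> 'g" where
  "km_gen_val K (XPos i) = xpos K i"
| "km_gen_val K (XNeg i) = xneg K i"
| "km_gen_val K (Cart x) = x"

text \<open>
  The rules \<open>cart_add\<close> and \<open>cart_scale\<close> express that the linear structure of
  \<open>H\<close> is retained.
\<close>

inductive km_rel ::
    "('g::ab_group_add, 'n::finite) km_data \<Rightarrow> 'g set \<Rightarrow>
     ('g, 'n) km_gen lie_term \<Rightarrow> ('g, 'n) km_gen lie_term \<Rightarrow> bool"
  for K H where
  cart_add: "x \<in> H \<Longrightarrow> y \<in> H \<Longrightarrow>
    km_rel K H (Gen (Cart (x + y))) (AddT (Gen (Cart x)) (Gen (Cart y)))"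
| cart_scale: "x \<in> H \<Longrightarrow> km_rel K H (Gen (Cart (lscale K c x))) (ScaleT c (Gen (Cart x)))"
| cart_comm: "x \<in> H \<Longrightarrow> y \<in> H \<Longrightarrow> km_rel K H (BrT (Gen (Cart x)) (Gen (Cart y))) ZeroT"
| cart_pos: "x \<in> H \<Longrightarrow>
    km_rel K H (BrT (Gen (Cart x)) (Gen (XPos i))) (ScaleT (sroot K i x) (Gen (XPos i)))"
| cart_neg: "x \<in> H \<Longrightarrow>
    km_rel K H (BrT (Gen (Cart x)) (Gen (XNeg i))) (ScaleT (- sroot K i x) (Gen (XNeg i)))"
| pos_neg: "km_rel K H (BrT (Gen (XPos i)) (Gen (XNeg j)))
    (if i = j then Gen (Cart (coroot K i)) else ZeroT)"
| serre_pos: "i \<noteq> j \<Longrightarrow>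
    km_rel K H ((BrT (Gen (XPos i)) ^^ nat (1 - gcm K $ i $ j)) (Gen (XPos j))) ZeroT"
| serre_neg: "i \<noteq> j \<Longrightarrow>
    km_rel K H ((BrT (Gen (XNeg i)) ^^ nat (1 - gcm K $ i $ j)) (Gen (XNeg j))) ZeroT"

definition kac_moody_on ::
    "('g::ab_group_add, 'n::finite) km_data \<Rightarrow> 'g set \<Rightarrow> 'g set \<Rightarrow> bool" where
  "kac_moody_on K S H \<longleftrightarrow>
     generalized_cartan_matrix (gcm K) \<and> symmetrizable (gcm K) \<and> realization K H \<and>
     presented_by K S (range XPos \<union> range XNeg \<union> Cart ` H) (km_gen_val K) (km_rel K H)"

definition root_space ::
    "('g::ab_group_add, 'n::finite) km_data \<Rightarrow> 'g set \<Rightarrow> 'g set \<Rightarrow> ('g \<Rightarrow> complex) \<Rightarrow> 'g set" where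
  "root_space K S H \<alpha> = {x\<in>S. \<forall>y\<in>H. lbracket K y x = lscale K (\<alpha> y) x}"

definition root_comb :: "('g, 'n::finite) km_data \<Rightarrow> ('n \<Rightarrow> nat) \<Rightarrow> 'g \<Rightarrow> complex" where
  "root_comb K k = (\<lambda>x. \<Sum>i\<in>UNIV. of_nat (k i) * sroot K i x)"

definition positive_integer :: "complex \<Rightarrow> bool" where
  "positive_integer z \<longleftrightarrow> (\<exists>k::nat. 0 < k \<and> z = of_nat k)"

text \<open>
  The second alternative is \<open>\<gg> = \<gg>\<^sub>1 \<oplus> \<complex>d\<close>,
  \<open>\<hh> = \<hh>\<^sub>1 \<oplus> \<complex>d\<close>.  Every positive root \<open>\<alpha>\<close> of
  \<open>\<gg>\<^sub>1\<close> is a \<^const>\<open>root_comb\<close>, and since \<open>\<alpha>(d)\<close> is by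
  convention \<open>c\<^sub>\<alpha>\<close>, the constant \<open>c\<^sub>\<alpha>\<close> appears as
  \<open>root_comb K k d\<close>.
\<close>

definition augmented_km :: "('g::ab_group_add, 'n::finite) km_data \<Rightarrow> 'g \<Rightarrow> bool" where
  "augmented_km K d \<longleftrightarrow>
     lie_algebra K \<and> (\<forall>i. sroot K i \<in> dual_space (lscale K) (cartan K)) \<and>
     ((kac_moody_on K UNIV (cartan K) \<and> d \<in> cartan K \<and> (\<forall>i. positive_integer (sroot K i d))) \<or>
      (\<exists>S H. kac_moody_on K S H \<and>
         d \<notin> S \<and> UNIV = {x + lscale K c d |x c. x \<in> S} \<and>
         cartan K = {x + lscale K c d |x c. x \<in> H} \<and>
         (\<forall>x\<in>H. lbracket K d x = 0) \<and>
         (\<forall>k. (\<exists>i. k i \<noteq> 0) \<longrightarrow>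
            (\<forall>x\<in>root_space K S H (root_comb K k). x \<noteq> 0 \<longrightarrow>
               positive_integer (root_comb K k d) \<and>
               lbracket K d x = lscale K (root_comb K k d) x) \<and>
            (\<forall>x\<in>root_space K S H (- root_comb K k). x \<noteq> 0 \<longrightarrow>
               positive_integer (root_comb K k d) \<and>
               lbracket K d x = lscale K (- root_comb K k d) x))))"

definition coroot_span :: "('g::ab_group_add, 'n::finite) km_data \<Rightarrow> 'g set" where
  "coroot_span K = module.span (lscale K) (range (coroot K))"

definition root_part :: "('g::ab_group_add, 'n::finite) km_data \<Rightarrow> 'g set" where
  "root_part K = module.span (lscale K)
     (\<Union>\<alpha>\<in>dual_space (lscale K) (cartan K) - {0}. root_space K UNIV (cartan K) \<alpha>)"

definition fundamental_weights ::
    "('g::ab_group_add, 'n::finite) km_data \<Rightarrow> ('n \<Rightarrow> 'g \<Rightarrow> complex) \<Rightarrow> bool" where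
  "fundamental_weights K \<Lambda> \<longleftrightarrow>
     (\<forall>i. \<Lambda> i \<in> dual_space (lscale K) (cartan K)) \<and>
     (\<forall>i j. \<Lambda> i (coroot K j) = (if i = j then 1 else 0))"

definition simple_reflection ::
    "('g, 'n::finite) km_data \<Rightarrow> 'n \<Rightarrow> ('g \<Rightarrow> complex) \<Rightarrow> 'g \<Rightarrow> complex" where
  "simple_reflection K i \<beta> = (\<lambda>x. \<beta> x - \<beta> (coroot K i) * sroot K i x)"


section \<open>Representations, weights and characters\<close>

record ('g, 'v) rep =
  rcarrier :: "'v set"
  rscale :: "complex \<Rightarrow> 'v \<Rightarrow> 'v"
  act :: "'g \<Rightarrow> 'v \<Rightarrow> 'v"

definition representation_of ::
    "('g::ab_group_add, 'n::finite) km_data \<Rightarrow> ('g, 'v::ab_group_add) rep \<Rightarrow> bool" where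
  "representation_of K M \<longleftrightarrow>
     vector_space (rscale M) \<and> module.subspace (rscale M) (rcarrier M) \<and>
     (\<forall>x. \<forall>u\<in>rcarrier M. act M x u \<in> rcarrier M) \<and>
     (\<forall>x. \<forall>u\<in>rcarrier M. \<forall>v\<in>rcarrier M. act M x (u + v) = act M x u + act M x v) \<and>
     (\<forall>x c. \<forall>u\<in>rcarrier M. act M x (rscale M c u) = rscale M c (act M x u)) \<and>
     (\<forall>x y. \<forall>u\<in>rcarrier M. act M (x + y) u = act M x u + act M y u) \<and>
     (\<forall>c x. \<forall>u\<in>rcarrier M. act M (lscale K c x) u = rscale M c (act M x u)) \<and>
     (\<forall>x y. \<forall>u\<in>rcarrier M.
        act M (lbracket K x y) u = act M x (act M y u) - act M y (act M x u))"

definition weight_space ::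
    "('g, 'n::finite) km_data \<Rightarrow> ('g, 'v) rep \<Rightarrow> ('g \<Rightarrow> complex) \<Rightarrow> 'v set" where
  "weight_space K M \<mu> =
     {v\<in>rcarrier M. \<forall>x\<in>cartan K. act M x v = rscale M (\<mu> x) v}"

definition weights ::
    "('g::ab_group_add, 'n::finite) km_data \<Rightarrow> ('g, 'v::ab_group_add) rep \<Rightarrow> ('g \<Rightarrow> complex) set" where
  "weights K M = {\<mu>\<in>dual_space (lscale K) (cartan K). weight_space K M \<mu> \<noteq> {0}}"

definition weight_mult ::
    "('g, 'n::finite) km_data \<Rightarrow> ('g, 'v::ab_group_add) rep \<Rightarrow> ('g \<Rightarrow> complex) \<Rightarrow> nat" where
  "weight_mult K M \<mu> = vector_space.dim (rscale M) (weight_space K M \<mu>)"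

definition integrable_rep ::
    "('g, 'n::finite) km_data \<Rightarrow> ('g, 'v::zero) rep \<Rightarrow> bool" where
  "integrable_rep K M \<longleftrightarrow>
     (\<forall>i. \<forall>v\<in>rcarrier M.
        (\<exists>N. (act M (xpos K i) ^^ N) v = 0) \<and> (\<exists>N. (act M (xneg K i) ^^ N) v = 0))"

definition d_finite ::
    "('g::ab_group_add, 'n::finite) km_data \<Rightarrow> 'g \<Rightarrow> ('g, 'v::ab_group_add) rep \<Rightarrow> bool" where
  "d_finite K d M \<longleftrightarrow>
     (\<forall>\<mu>\<in>weights K M. \<mu> \<noteq> 0 \<longrightarrow> \<mu> d \<in> \<int> \<and> \<mu> d \<noteq> 0) \<and>
     (\<forall>k::int. fin_dim (rscale M)
        (module.span (rscale M) (\<Union>\<mu>\<in>{\<mu>\<in>weights K M. \<mu> d = of_int k}. weight_space K M \<mu>)))"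

definition invariant_form ::
    "('g, 'v::ab_group_add) rep \<Rightarrow> ('v \<Rightarrow> 'v \<Rightarrow> complex) \<Rightarrow> bool" where
  "invariant_form M Q \<longleftrightarrow>
     (\<forall>u\<in>rcarrier M. linear_functional_on (rscale M) (rcarrier M) (Q u)) \<and>
     (\<forall>u\<in>rcarrier M. \<forall>v\<in>rcarrier M. Q u v = Q v u) \<and>
     (\<forall>u\<in>rcarrier M. (\<forall>v\<in>rcarrier M. Q u v = 0) \<longrightarrow> u = 0) \<and>
     (\<forall>x. \<forall>u\<in>rcarrier M. \<forall>v\<in>rcarrier M. Q (act M x u) v + Q u (act M x v) = 0)"

definition direct_power :: "nat \<Rightarrow> ('g, 'w::zero) rep \<Rightarrow> ('g, nat \<Rightarrow> 'w) rep" where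
  "direct_power N W =
     \<lparr>rcarrier = {f. (\<forall>k<N. f k \<in> rcarrier W) \<and> (\<forall>k\<ge>N. f k = 0)},
      rscale = (\<lambda>c f k. rscale W c (f k)),
      act = (\<lambda>x f k. if k < N then act W x (f k) else 0)\<rparr>"

definition rep_isomorphic ::
    "('g, 'v::ab_group_add) rep \<Rightarrow> ('g, 'w::ab_group_add) rep \<Rightarrow> bool" where
  "rep_isomorphic M M' \<longleftrightarrow>
     (\<exists>T. bij_betw T (rcarrier M) (rcarrier M') \<and>
        (\<forall>u\<in>rcarrier M. \<forall>v\<in>rcarrier M. T (u + v) = T u + T v) \<and>
        (\<forall>c. \<forall>u\<in>rcarrier M. T (rscale M c u) = rscale M' c (T u)) \<and>
        (\<forall>x. \<forall>u\<in>rcarrier M. T (act M x u) = act M' x (T u)))"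

text \<open>
  Finite formal combinations of the symbols \<open>e\<^sup>\<mu>\<close> form the group ring, here
  finitely supported integer functions with the convolution product of
  \<^theory>\<open>HOL-Library.Poly_Mapping\<close>.  Infinite formal combinations are arbitrary
  coefficient functions; infinite sums and products converge when each coefficient of the finite
  partial sums or products is eventually constant.  In \<open>has_character\<close>, the weight spaces
  must be finite-dimensional and span the representation (their sum is automatically direct).
\<close>

definition fexp :: "('g \<Rightarrow> complex) \<Rightarrow> ('g \<Rightarrow> complex) \<Rightarrow>\<^sub>0 int" where
  "fexp \<mu> = Poly_Mapping.single \<mu> 1"

definition formal_has_sum ::
    "('i \<Rightarrow> ('g \<Rightarrow> complex) \<Rightarrow>\<^sub>0 int) \<Rightarrow> 'i set \<Rightarrow> (('g \<Rightarrow> complex) \<Rightarrow> int) \<Rightarrow> bool" where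
  "formal_has_sum f B S \<longleftrightarrow>
     (\<forall>\<mu>. \<forall>\<^sub>F F in finite_subsets_at_top B. Poly_Mapping.lookup (\<Sum>i\<in>F. f i) \<mu> = S \<mu>)"

definition formal_has_prod ::
    "('i \<Rightarrow> ('g \<Rightarrow> complex) \<Rightarrow>\<^sub>0 int) \<Rightarrow> 'i set \<Rightarrow> (('g \<Rightarrow> complex) \<Rightarrow> int) \<Rightarrow> bool" where
  "formal_has_prod f B P \<longleftrightarrow>
     (\<forall>\<mu>. \<forall>\<^sub>F F in finite_subsets_at_top B. Poly_Mapping.lookup (\<Prod>i\<in>F. f i) \<mu> = P \<mu>)"

text \<open>Multiplication of a formal combination by \<open>e\<^sup>\<Lambda>\<close>.\<close>

definition fexp_times ::
    "('g \<Rightarrow> complex) \<Rightarrow> (('g \<Rightarrow> complex) \<Rightarrow> int) \<Rightarrow> ('g \<Rightarrow> complex) \<Rightarrow> int" where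
  "fexp_times \<Lambda> P = (\<lambda>\<mu>. P (\<mu> - \<Lambda>))"

definition has_character ::
    "('g::ab_group_add, 'n::finite) km_data \<Rightarrow> ('g, 'v::ab_group_add) rep \<Rightarrow>
     (('g \<Rightarrow> complex) \<Rightarrow> int) \<Rightarrow> bool" where
  "has_character K M ch \<longleftrightarrow>
     rcarrier M \<subseteq>
       module.span (rscale M) (\<Union>\<mu>\<in>dual_space (lscale K) (cartan K). weight_space K M \<mu>) \<and>
     (\<forall>\<mu>\<in>dual_space (lscale K) (cartan K).
        fin_dim (rscale M) (weight_space K M \<mu>) \<and> ch \<mu> = int (weight_mult K M \<mu>)) \<and>
     (\<forall>\<mu>. \<mu> \<notin> dual_space (lscale K) (cartan K) \<longrightarrow> ch \<mu> = 0)"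


section \<open>The Spin representation\<close>

definition spin_index :: "int set \<Rightarrow> bool" where
  "spin_index I \<longleftrightarrow>
     (\<exists>m::nat. I = {- int m..int m} - {0} \<or> I = {- int m..int m}) \<or> I = UNIV \<or> I = UNIV - {0}"

definition adapted_basis ::
    "('g::ab_group_add, 'n::finite) km_data \<Rightarrow> 'g \<Rightarrow> ('g, 'v::ab_group_add) rep \<Rightarrow> ('v \<Rightarrow> 'v \<Rightarrow> complex) \<Rightarrow>
     int set \<Rightarrow> (int \<Rightarrow> 'v) \<Rightarrow> bool" where
  "adapted_basis K d M Q I e \<longleftrightarrow>
     spin_index I \<and> inj_on e I \<and> e ` I \<subseteq> rcarrier M \<and>
     \<not> module.dependent (rscale M) (e ` I) \<and> module.span (rscale M) (e ` I) = rcarrier M \<and>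
     (\<forall>i\<in>I. \<forall>j\<in>I. Q (e i) (e j) = (if i = - j then 1 else 0)) \<and>
     (\<forall>i\<in>I. \<exists>\<beta>\<in>dual_space (lscale K) (cartan K).
        e i \<in> weight_space K M \<beta> \<and> (0 < i \<longrightarrow> 0 \<le> Re (\<beta> d)))"

definition rep_matrix ::
    "('g, 'v::ab_group_add) rep \<Rightarrow> int set \<Rightarrow> (int \<Rightarrow> 'v) \<Rightarrow> 'g \<Rightarrow> int \<Rightarrow> int \<Rightarrow> complex" where
  "rep_matrix M I e x i j =
     (if i \<in> I \<and> j \<in> I then module.representation (rscale M) (e ` I) (act M x (e j)) (e i) else 0)"

definition so_matrices :: "int set \<Rightarrow> (int \<Rightarrow> int \<Rightarrow> complex) set" where
  "so_matrices I =
     {A. (\<forall>i j. i \<notin> I \<or> j \<notin> I \<longrightarrow> A i j = 0) \<and>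
         (\<forall>i j. A i j = - A (- j) (- i)) \<and>
         (\<forall>j. finite {i. A i j \<noteq> 0}) \<and>
         finite {(i, j). 0 < i \<and> 0 < j \<and> A i (- j) \<noteq> 0} \<and>
         finite {(i, j). 0 < i \<and> 0 < j \<and> A (- i) j \<noteq> 0}}"

text \<open>
  A spinor is a finite combination of the basis vectors
  \<open>e\<^sub>J = e\<^sub>j\<^sub>1 \<and> \<dots> \<and> e\<^sub>j\<^sub>k\<close>, where \<open>J\<close> is a finite set
  of positive indices \<open>j\<^sub>1 > \<dots> > j\<^sub>k\<close>.
\<close>

type_synonym spinor = "int set \<Rightarrow>\<^sub>0 complex"

definition spin_scale :: "complex \<Rightarrow> spinor \<Rightarrow> spinor" where
  "spin_scale c v = Poly_Mapping.map ((*) c) v"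

definition spin_space :: "int set \<Rightarrow> spinor set" where
  "spin_space I = {v. \<forall>J\<in>Poly_Mapping.keys v. finite J \<and> J \<subseteq> {i\<in>I. 0 < i}}"

definition clifford_basis :: "int \<Rightarrow> int set \<Rightarrow> spinor" where
  "clifford_basis i J =
     (if 0 < i then
        (if i \<in> J then 0 else Poly_Mapping.single (insert i J) ((-1) ^ card {j\<in>J. i < j}))
      else if i = 0 then Poly_Mapping.single J ((-1) ^ card J)
      else
        (if - i \<in> J then Poly_Mapping.single (J - {- i}) (2 * (-1) ^ card {j\<in>J. - i < j}) else 0))"

definition clifford :: "int \<Rightarrow> spinor \<Rightarrow> spinor" where
  "clifford i v =
     (\<Sum>J\<in>Poly_Mapping.keys v. spin_scale (Poly_Mapping.lookup v J) (clifford_basis i J))"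

text \<open>
  For \<open>A \<in> so_matrices I\<close> one has
  \<open>A = \<Sum> A\<^sub>i\<^sub>j Z\<^sub>i\<^sub>j\<close> over the pairs \<open>i > -j\<close>, and
  \<open>Z\<^sub>i\<^sub>j\<close> acts as \<open>- e\<^sub>j e\<^sub>-\<^sub>i / 2\<close>.  On each element of
  \<open>spin_space I\<close> only finitely many summands are nonzero; \<^const>\<open>Sum_any\<close> is
  the sum of the nonzero summands.
\<close>

definition spin_phi :: "(int \<Rightarrow> int \<Rightarrow> complex) \<Rightarrow> spinor \<Rightarrow> spinor" where
  "spin_phi A v =
     Sum_any (\<lambda>(i, j). if - j < i
       then spin_scale (- (1/2) * A i j) (clifford j (clifford (- i) v)) else 0)"

text \<open>
  The operator \<open>T\<close> represents an element of the central extension of \<open>so_matrices I\<close>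
  whose projection is \<open>A\<close>.
\<close>

definition spin_extension :: "int set \<Rightarrow> (spinor \<Rightarrow> spinor) \<Rightarrow> (int \<Rightarrow> int \<Rightarrow> complex) \<Rightarrow> bool" where
  "spin_extension I T A \<longleftrightarrow>
     A \<in> so_matrices I \<and> (\<exists>c. \<forall>v\<in>spin_space I. T v = spin_phi A v + spin_scale c v)"

definition spin_rep :: "int set \<Rightarrow> ('g \<Rightarrow> spinor \<Rightarrow> spinor) \<Rightarrow> ('g, spinor) rep" where
  "spin_rep I \<tau> = \<lparr>rcarrier = spin_space I, rscale = spin_scale, act = \<tau>\<rparr>"

text \<open>
  \<open>\<tau>\<close> is the lift of the action on \<open>M\<close> to the central extension that is determined by
  the complement \<open>H''\<close> of the span of the coroots and by the functional \<open>\<psi>\<close>.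
\<close>

definition spin_lift ::
    "('g::ab_group_add, 'n::finite) km_data \<Rightarrow> ('g, 'v::ab_group_add) rep \<Rightarrow> int set \<Rightarrow> (int \<Rightarrow> 'v) \<Rightarrow>
     'g set \<Rightarrow> ('g \<Rightarrow> complex) \<Rightarrow> ('g \<Rightarrow> spinor \<Rightarrow> spinor) \<Rightarrow> bool" where
  "spin_lift K M I e H'' \<psi> \<tau> \<longleftrightarrow>
     complement_in (lscale K) (cartan K) (coroot_span K) H'' \<and>
     linear_functional_on (lscale K) (module.span (lscale K) (H'' \<union> root_part K)) \<psi> \<and>
     (\<forall>x\<in>root_part K. \<psi> x = 0) \<and>
     representation_of K (spin_rep I \<tau>) \<and>
     (\<forall>x. spin_extension I (\<tau> x) (rep_matrix M I e x)) \<and>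
     (\<forall>x\<in>module.span (lscale K) (H'' \<union> root_part K). \<forall>v\<in>spin_space I.
        \<tau> x v = spin_phi (rep_matrix M I e x) v + spin_scale (\<psi> x) v)"

definition is_spin0 ::
    "('g::ab_group_add, 'n::finite) km_data \<Rightarrow> ('g, 'v::ab_group_add) rep \<Rightarrow> int set \<Rightarrow>
     ('g \<Rightarrow> spinor \<Rightarrow> spinor) \<Rightarrow> ('g, 'w::ab_group_add) rep \<Rightarrow> bool" where
  "is_spin0 K M I \<tau> W \<longleftrightarrow>
     representation_of K W \<and>
     rep_isomorphic (spin_rep I \<tau>) (direct_power (2 ^ (weight_mult K M 0 div 2)) W)"


section \<open>The highest weight\<close>

text \<open>
  The values at \<open>d\<close> of the weights of a \<^const>\<open>d_finite\<close> representation are integers;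
  signs are read off from the real part.
\<close>

definition positive_weights ::
    "('g::ab_group_add, 'n::finite) km_data \<Rightarrow> 'g \<Rightarrow> ('g, 'v::ab_group_add) rep \<Rightarrow> ('g \<Rightarrow> complex) set" where
  "positive_weights K d M = {\<beta>\<in>weights K M. 0 < Re (\<beta> d)}"

definition crossing_weights ::
    "('g::ab_group_add, 'n::finite) km_data \<Rightarrow> 'g \<Rightarrow> ('g, 'v::ab_group_add) rep \<Rightarrow> 'n \<Rightarrow>
     ('g \<Rightarrow> complex) set" where
  "crossing_weights K d M i = {\<beta>\<in>positive_weights K d M. Re (simple_reflection K i \<beta> d) < 0}"

definition spin_coeff ::
    "('g::ab_group_add, 'n::finite) km_data \<Rightarrow> 'g \<Rightarrow> ('g, 'v::ab_group_add) rep \<Rightarrow> 'n \<Rightarrow> complex" where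
  "spin_coeff K d M i =
     (\<Sum>\<beta>\<in>crossing_weights K d M i. 1/2 * of_nat (weight_mult K M \<beta>) * \<beta> (coroot K i))"

definition spin_weight ::
    "('g::ab_group_add, 'n::finite) km_data \<Rightarrow> 'g \<Rightarrow> ('g, 'v::ab_group_add) rep \<Rightarrow>
     ('n \<Rightarrow> 'g \<Rightarrow> complex) \<Rightarrow> 'g \<Rightarrow> complex" where
  "spin_weight K d M \<Lambda> = (\<lambda>x. \<Sum>i\<in>UNIV. spin_coeff K d M i * \<Lambda> i x)"

end

theory Submission
  imports Defs
begin

text \<open>\<open>V\<close> may be infinite-dimensional, so the trace of \<open>h\<close> over all
  positive indices need not exist and products of \<open>X\<close> and \<open>Y\<close> cannot be
  traced globally; every trace is therefore taken on a finite set of indices. A lift of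
  \<open>h\<close> to the central extension is fixed only up to a scalar, but \<open>X\<close> and
  \<open>Y\<close> lie in \<open>root_part K\<close>, where the lift is \<open>spin_phi\<close>
  without scalar, and this forces the scalar at \<open>[X, Y]\<close>. The factor one half appears
  because the entries at (i, j) and (-j, -i) are negatives of each other and \<open>spin_phi\<close>
  keeps only one of them. On the complement \<open>H''\<close> no commutator decides: there
  \<open>\<psi>\<close> is prescribed, and the fundamental weights are not determined by their
  values at coroots; the last hypothesis matches the two choices. No decomposition into irreducibles
  is available or needed for the three-dimensional algebra. Integrality, unbroken strings and
  reflection invariance of multiplicities all come from local nilpotency, through injectivity of
  powers of \<open>X\<close> and \<open>Y\<close> on weight spaces. \<open>Spin0\<close> is given
  only through an isomorphism of its multiple with the spin representation, so its multiplicities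
  result from dividing a count of index sets.\<close>

text \<open>
  In the basis \<open>e\<^sub>J\<close> the Cartan subalgebra acts diagonally on the spinors, \<open>e\<^sub>J\<close> having weight
  \<open>\<Lambda> - \<Sum>\<^bsub>j \<in> J\<^esub> \<beta>\<^sub>j\<close>, where \<open>\<Lambda>\<close> is the weight of the vacuum \<open>e\<^sub>\<emptyset>\<close>; expanding the product over the
  weights counts the sets \<open>J\<close>, and the positive indices of weight 0 account for the copies of \<open>Spin\<^sub>0\<close>.
  The point is the value of \<open>\<Lambda>\<close> at a coroot \<open>h = [X, Y]\<close>.  It is the vacuum expectation of the
  commutator of the lifts of \<open>X\<close> and \<open>Y\<close>, which equals half the sum of \<open>X\<^sub>j\<^sub>i Y\<^sub>i\<^sub>j\<close> over \<open>i \<le> 0 < j\<close>.  That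
  sum is the trace of \<open>[X, Y]\<close>, hence of \<open>h\<close>, on a finite set of positive indices closed under root
  strings.  In the trace of \<open>h\<close> all weights cancel against their reflections except those that the
  reflection moves to negative degree.
\<close>

section \<open>Bases of weight vectors\<close>

text \<open>Operators of a representation are linear only on the carrier or on one weight space,
  whereas linear maps of the library are linear on the whole type. The values of \<open>f\<close> on
  a basis of \<open>S\<close> extend to a total linear map, which agrees with \<open>f\<close> on
  \<open>S\<close> and sends the basis to independent vectors in the span of
  \<open>F\<close>.\<close>

lemma (in vector_space_pair) dim_le_of_injective:
  assumes S: "vs1.subspace S"
    and add: "\<And>x y. x \<in> S \<Longrightarrow> y \<in> S \<Longrightarrow> f (x + y) = f x + f y"
    and scale: "\<And>c x. x \<in> S \<Longrightarrow> f (s1 c x) = s2 c (f x)"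
    and inj: "\<And>x. x \<in> S \<Longrightarrow> f x = 0 \<Longrightarrow> x = 0"
    and T: "f ` S \<subseteq> T" "T \<subseteq> vs2.span F" "finite F"
  shows "vs1.dim S \<le> vs2.dim T" and "\<exists>B. finite B \<and> S \<subseteq> vs1.span B"
proof -
  obtain B where B: "B \<subseteq> S" "vs1.independent B" "S \<subseteq> vs1.span B" "card B = vs1.dim S"
    using vs1.basis_exists by blast
  obtain g where g: "Vector_Spaces.linear s1 s2 g" "\<And>x. x \<in> B \<Longrightarrow> g x = f x"
    using linear_independent_extend[OF B(2), of f] by blast
  interpret g: Vector_Spaces.linear s1 s2 g by fact
  have f0: "f 0 = 0"
    using scale[of 0 0] vs1.subspace_0[OF S] by simp
  have gf: "g x = f x" if "x \<in> vs1.span B" for x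
  proof -
    have "x \<in> S \<and> g x = f x"
      using that
    proof (induction rule: vs1.span_induct_alt)
      case base
      then show ?case using f0 vs1.subspace_0[OF S] by (simp add: g.zero)
    next
      case (step c x y)
      then have x: "x \<in> S" "s1 c x \<in> S" using B(1) vs1.subspace_scale[OF S] by auto
      then show ?case
        using step g(2) vs1.subspace_add[OF S] add[of "s1 c x" y] scale[of x c]
        by (simp add: g.add g.scale)
    qed
    then show ?thesis ..
  qed
  have span: "vs1.span B = S"
    using vs1.span_subspace[OF B(1,3) S] .
  have inj_g: "inj_on g (vs1.span B)"
    unfolding g.inj_on_iff_eq_0[OF vs1.subspace_span] using inj gf span by auto
  then have indep: "vs2.independent (g ` B)" and card: "card (g ` B) = card B"
    using g.independent_injective_image[OF B(2)]
    by (auto intro!: card_image inj_on_subset[OF inj_g] vs1.span_superset)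
  obtain C where C: "C \<subseteq> T" "vs2.independent C" "T \<subseteq> vs2.span C" "card C = vs2.dim T"
    using vs2.basis_exists by blast
  have "finite C"
    using vs2.independent_span_bound[OF T(3) C(2)] C(1) T(2) by blast
  moreover have "g ` B \<subseteq> vs2.span C"
    using C(3) T(1) B(1) g(2) by auto
  ultimately have "finite (g ` B)" "card (g ` B) \<le> card C"
    using vs2.independent_span_bound indep by blast+
  then show "vs1.dim S \<le> vs2.dim T" "\<exists>B. finite B \<and> S \<subseteq> vs1.span B"
    using card C(4) B(3,4) finite_imageD[OF _ inj_on_subset[OF inj_g vs1.span_superset]] by auto
qed

lemma sum_fun_apply: "sum f A x = (\<Sum>a\<in>A. f a x)"
  by (induction A rule: infinite_finite_induct) auto

lemma dual_space_0: "0 \<in> dual_space sc S"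
  by (auto simp: dual_space_def linear_functional_on_def)

lemma dual_space_add: "f \<in> dual_space sc S \<Longrightarrow> g \<in> dual_space sc S \<Longrightarrow> f + g \<in> dual_space sc S"
  by (auto simp: dual_space_def linear_functional_on_def algebra_simps)

lemma dual_space_uminus: "f \<in> dual_space sc S \<Longrightarrow> - f \<in> dual_space sc S"
  by (auto simp: dual_space_def linear_functional_on_def)

lemma dual_space_diff: "f \<in> dual_space sc S \<Longrightarrow> g \<in> dual_space sc S \<Longrightarrow> f - g \<in> dual_space sc S"
  by (auto simp: dual_space_def linear_functional_on_def algebra_simps)

lemma dual_space_scale: "f \<in> dual_space sc S \<Longrightarrow> (\<lambda>x. c * f x) \<in> dual_space sc S"
  by (auto simp: dual_space_def linear_functional_on_def algebra_simps)

lemma dual_space_sum: "(\<And>a. a \<in> A \<Longrightarrow> f a \<in> dual_space sc S) \<Longrightarrow> sum f A \<in> dual_space sc S"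
  by (induction A rule: infinite_finite_induct) (auto intro: dual_space_0 dual_space_add)

lemma dual_space_eqI:
  assumes "f \<in> dual_space sc S" "g \<in> dual_space sc S" "\<And>x. x \<in> S \<Longrightarrow> f x = g x"
  shows "f = g"
proof
  fix x show "f x = g x"
    using assms by (cases "x \<in> S") (auto simp: dual_space_def)
qed

text \<open>The index type stays open because two instances are needed: \<open>V\<close>, indexed by
  integers, and the spin representation, indexed by finite sets of integers.\<close>

locale weight_basis =
  fixes K :: "('g::ab_group_add, 'n::finite) km_data"
    and M :: "('g, 'v::ab_group_add) rep"
    and I :: "'i set" and e :: "'i \<Rightarrow> 'v" and b :: "'i \<Rightarrow> 'g \<Rightarrow> complex"
  assumes rep: "representation_of K M"
    and inj: "inj_on e I"
    and indep: "\<not> module.dependent (rscale M) (e ` I)"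
    and span_basis: "module.span (rscale M) (e ` I) = rcarrier M"
    and wt: "\<And>i. i \<in> I \<Longrightarrow> e i \<in> weight_space K M (b i)"
    and dual: "\<And>i. i \<in> I \<Longrightarrow> b i \<in> dual_space (lscale K) (cartan K)"
begin

sublocale vector_space "rscale M"
  using rep by (simp add: representation_of_def)

abbreviation sc where "sc \<equiv> rscale M"

lemma subspace_carrier: "subspace (rcarrier M)"
  using rep by (simp add: representation_of_def)

lemma act_closed: "u \<in> rcarrier M \<Longrightarrow> act M x u \<in> rcarrier M"
  and act_add: "u \<in> rcarrier M \<Longrightarrow> v \<in> rcarrier M \<Longrightarrow> act M x (u + v) = act M x u + act M x v"
  and act_scale: "u \<in> rcarrier M \<Longrightarrow> act M x (sc c u) = sc c (act M x u)"
  and act_scale_left: "u \<in> rcarrier M \<Longrightarrow> act M (lscale K c x) u = sc c (act M x u)"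
  and act_bracket: "u \<in> rcarrier M \<Longrightarrow>
    act M (lbracket K x y) u = act M x (act M y u) - act M y (act M x u)"
  using rep by (auto simp: representation_of_def)

lemma act_0: "act M x 0 = 0"
  using act_scale[of 0 x 0] subspace_0[OF subspace_carrier] by simp

lemma act_sum:
  "(\<And>a. a \<in> A \<Longrightarrow> f a \<in> rcarrier M) \<Longrightarrow> act M x (sum f A) = (\<Sum>a\<in>A. act M x (f a))"
  by (induction A rule: infinite_finite_induct)
    (auto simp: act_0 act_add subspace_sum[OF subspace_carrier])

lemma e_carrier: "i \<in> I \<Longrightarrow> e i \<in> rcarrier M"
  using wt by (auto simp: weight_space_def)

lemma e_nonzero: "i \<in> I \<Longrightarrow> e i \<noteq> 0"
  using indep dependent_zero by force

lemma subspace_weight_space: "subspace (weight_space K M \<mu>)"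
  using subspace_carrier
  by (auto simp: weight_space_def subspace_def act_0 act_add act_scale scale_right_distrib mult.commute)

definition coeff :: "'v \<Rightarrow> 'i \<Rightarrow> complex" where
  "coeff v i = representation (e ` I) v (e i)"

lemma coeff_add: "u \<in> rcarrier M \<Longrightarrow> v \<in> rcarrier M \<Longrightarrow> coeff (u + v) i = coeff u i + coeff v i"
  using representation_add[OF indep] span_basis by (simp add: coeff_def)

lemma coeff_diff: "u \<in> rcarrier M \<Longrightarrow> v \<in> rcarrier M \<Longrightarrow> coeff (u - v) i = coeff u i - coeff v i"
  using representation_diff[OF indep] span_basis by (simp add: coeff_def)

lemma coeff_scale: "u \<in> rcarrier M \<Longrightarrow> coeff (sc c u) i = c * coeff u i"
  using representation_scale[OF indep] span_basis by (simp add: coeff_def)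

lemma coeff_0 [simp]: "coeff 0 i = 0"
  by (simp add: coeff_def representation_zero)

lemma coeff_sum:
  "(\<And>a. a \<in> A \<Longrightarrow> f a \<in> rcarrier M) \<Longrightarrow> coeff (sum f A) i = (\<Sum>a\<in>A. coeff (f a) i)"
  by (induction A rule: infinite_finite_induct)
    (auto simp: coeff_add subspace_sum[OF subspace_carrier])

lemma coeff_e: "i \<in> I \<Longrightarrow> j \<in> I \<Longrightarrow> coeff (e j) i = (if i = j then 1 else 0)"
  using representation_basis[OF indep, of "e j"] inj by (auto simp: coeff_def inj_on_eq_iff)

lemma finite_coeff: "finite {i \<in> I. coeff v i \<noteq> 0}"
proof (rule finite_imageD)
  show "finite (e ` {i \<in> I. coeff v i \<noteq> 0})"
    by (rule finite_subset[OF _ finite_representation[of "e ` I" v]]) (auto simp: coeff_def)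
  show "inj_on e {i \<in> I. coeff v i \<noteq> 0}"
    using inj by (rule inj_on_subset) auto
qed

lemma expand:
  assumes v: "v \<in> rcarrier M" and F: "finite F" "F \<subseteq> I" "\<And>i. i \<in> I \<Longrightarrow> coeff v i \<noteq> 0 \<Longrightarrow> i \<in> F"
  shows "v = (\<Sum>i\<in>F. sc (coeff v i) (e i))"
proof -
  have "v = (\<Sum>u\<in>{u. representation (e ` I) v u \<noteq> 0}. sc (representation (e ` I) v u) u)"
    using sum_nonzero_representation_eq[OF indep] v span_basis by simp
  also have "\<dots> = (\<Sum>u\<in>e ` F. sc (representation (e ` I) v u) u)"
    using F representation_ne_zero[of "e ` I" v]
    by (intro sum.mono_neutral_left) (auto simp: coeff_def image_iff, metis)
  also have "\<dots> = (\<Sum>i\<in>F. sc (coeff v i) (e i))"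
    using inj_on_subset[OF inj F(2)] by (simp add: sum.reindex coeff_def)
  finally show ?thesis .
qed

lemma coeff_act_cartan:
  assumes "v \<in> rcarrier M" "x \<in> cartan K" "i \<in> I"
  shows "coeff (act M x v) i = b i x * coeff v i"
proof -
  let ?F = "{i \<in> I. coeff v i \<noteq> 0}"
  have v: "v = (\<Sum>i\<in>?F. sc (coeff v i) (e i))"
    using assms(1) finite_coeff by (intro expand) auto
  have "act M x v = (\<Sum>i\<in>?F. sc (coeff v i) (act M x (e i)))"
    by (subst v, subst act_sum) (auto simp: e_carrier act_scale subspace_scale[OF subspace_carrier])
  also have "\<dots> = (\<Sum>i\<in>?F. sc (coeff v i * b i x) (e i))"
    using wt assms(2) by (intro sum.cong) (auto simp: weight_space_def)
  finally have "coeff (act M x v) i = (\<Sum>j\<in>?F. coeff v j * b j x * (if i = j then 1 else 0))"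
    using assms(3)
    by (simp only:) (subst coeff_sum, auto simp: e_carrier coeff_scale coeff_e subspace_scale[OF subspace_carrier] intro!: sum.cong)
  also have "\<dots> = b i x * coeff v i"
    using finite_coeff[of v] assms(3) by (auto simp: if_distrib cong: if_cong)
  finally show ?thesis .
qed

text \<open>An element \<open>x\<close> of the Cartan subalgebra multiplies the coordinate at
  \<open>i\<close> by \<open>b i x\<close>, so a nonzero coordinate forces \<open>b i\<close> and
  \<open>\<mu>\<close> to agree on \<open>cartan K\<close>. They are then equal as functions, since
  members of \<open>dual_space\<close> vanish elsewhere.\<close>

lemma weight_space_iff:
  assumes \<mu>: "\<mu> \<in> dual_space (lscale K) (cartan K)"
  shows "v \<in> weight_space K M \<mu> \<longleftrightarrow> v \<in> rcarrier M \<and> (\<forall>i\<in>I. coeff v i \<noteq> 0 \<longrightarrow> b i = \<mu>)"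
proof (intro iffI conjI ballI impI)
  assume v: "v \<in> weight_space K M \<mu>"
  then show vc: "v \<in> rcarrier M"
    by (simp add: weight_space_def)
  fix i assume i: "i \<in> I" "coeff v i \<noteq> 0"
  show "b i = \<mu>"
  proof (rule dual_space_eqI[OF dual[OF i(1)] \<mu>])
    fix x assume "x \<in> cartan K"
    then show "b i x = \<mu> x"
      using coeff_act_cartan[OF vc _ i(1)] v i coeff_scale[OF vc] by (auto simp: weight_space_def)
  qed
next
  assume v: "v \<in> rcarrier M \<and> (\<forall>i\<in>I. coeff v i \<noteq> 0 \<longrightarrow> b i = \<mu>)"
  have "v = (\<Sum>i\<in>{i \<in> I. coeff v i \<noteq> 0}. sc (coeff v i) (e i))"
    using v finite_coeff by (intro expand) auto
  also have "\<dots> \<in> weight_space K M \<mu>"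
    using v wt by (auto intro!: subspace_sum subspace_scale subspace_weight_space)
  finally show "v \<in> weight_space K M \<mu>" .
qed

lemma weight_space_eq_span:
  assumes "\<mu> \<in> dual_space (lscale K) (cartan K)"
  shows "weight_space K M \<mu> = span (e ` {i \<in> I. b i = \<mu>})"
proof
  show "span (e ` {i \<in> I. b i = \<mu>}) \<subseteq> weight_space K M \<mu>"
    using wt by (intro span_minimal subspace_weight_space) auto
  show "weight_space K M \<mu> \<subseteq> span (e ` {i \<in> I. b i = \<mu>})"
  proof
    fix v assume "v \<in> weight_space K M \<mu>"
    then have v: "v \<in> rcarrier M" "\<forall>i\<in>I. coeff v i \<noteq> 0 \<longrightarrow> b i = \<mu>"
      using weight_space_iff[OF assms] by auto
    have "v = (\<Sum>i\<in>{i \<in> I. coeff v i \<noteq> 0}. sc (coeff v i) (e i))"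
      using v finite_coeff by (intro expand) auto
    also have "\<dots> \<in> span (e ` {i \<in> I. b i = \<mu>})"
      using v(2) by (intro span_sum span_scale span_base) auto
    finally show "v \<in> span (e ` {i \<in> I. b i = \<mu>})" .
  qed
qed

lemma inj_on_level: "inj_on e {i \<in> I. P i}"
  using inj by (rule inj_on_subset) auto

lemma independent_level: "independent (e ` {i \<in> I. P i})"
  using indep by (rule independent_mono) auto

text \<open>This turns every statement on multiplicities into counting indices. For an infinite set
  of indices both sides are 0 by convention.\<close>

lemma weight_mult_eq:
  assumes "\<mu> \<in> dual_space (lscale K) (cartan K)"
  shows "weight_mult K M \<mu> = card {i \<in> I. b i = \<mu>}"
  using dim_span_eq_card_independent[OF independent_level] inj_on_level
  by (simp add: weight_mult_def weight_space_eq_span[OF assms] card_image)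

lemma weights_eq: "weights K M = b ` I"
proof (intro set_eqI iffI)
  fix \<mu> assume "\<mu> \<in> weights K M"
  then have \<mu>: "\<mu> \<in> dual_space (lscale K) (cartan K)" "weight_space K M \<mu> \<noteq> {0}"
    by (auto simp: weights_def)
  have "span (e ` {i \<in> I. b i = \<mu>}) \<noteq> {0}"
    using \<mu> weight_space_eq_span by simp
  then have "{i \<in> I. b i = \<mu>} \<noteq> {}"
    by (metis image_empty span_empty)
  then show "\<mu> \<in> b ` I" by blast
next
  fix \<mu> assume "\<mu> \<in> b ` I"
  then show "\<mu> \<in> weights K M"
    using dual wt e_nonzero by (auto simp: weights_def)
qed

lemma fin_dim_weight_space:
  assumes "\<mu> \<in> dual_space (lscale K) (cartan K)" "finite {i \<in> I. b i = \<mu>}"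
  shows "fin_dim sc (weight_space K M \<mu>)"
  using assms by (auto simp: fin_dim_def weight_space_eq_span)

lemma carrier_subset_span_weight_spaces:
  "rcarrier M \<subseteq> span (\<Union>\<mu>\<in>dual_space (lscale K) (cartan K). weight_space K M \<mu>)"
  unfolding span_basis[symmetric] using wt dual by (intro span_mono) auto

end

section \<open>Integrable representations of the three-dimensional simple algebra\<close>

lemma funpow_last_nonzero:
  assumes "v \<noteq> 0" "(f ^^ N) v = 0"
  obtains k where "(f ^^ k) v \<noteq> 0" "f ((f ^^ k) v) = 0"
proof -
  have "\<exists>k<N. (\<forall>i\<le>k. (f ^^ i) v \<noteq> 0) \<and> (f ^^ Suc k) v = 0"
    using assms by (intro ex_least_nat_less) auto
  then show ?thesis using that by auto
qed

text \<open>\<open>W m\<close> plays the role of the eigenspace of \<open>[A, B]\<close> for the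
  eigenvalue \<open>m\<close>. Linearity is asked only inside one \<open>W m\<close>, as operators
  on a carrier set provide it; dimensions may be infinite, and the nilpotency exponents may depend
  on the vector.\<close>

locale sl2_graded = vector_space sc for sc :: "complex \<Rightarrow> 'v::ab_group_add \<Rightarrow> 'v" +
  fixes W :: "complex \<Rightarrow> 'v set" and A B :: "'v \<Rightarrow> 'v"
  assumes subspace_W: "subspace (W m)"
    and A_W: "v \<in> W m \<Longrightarrow> A v \<in> W (m + 2)"
    and B_W: "v \<in> W m \<Longrightarrow> B v \<in> W (m - 2)"
    and A_add: "u \<in> W m \<Longrightarrow> v \<in> W m \<Longrightarrow> A (u + v) = A u + A v"
    and B_add: "u \<in> W m \<Longrightarrow> v \<in> W m \<Longrightarrow> B (u + v) = B u + B v"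
    and A_scale: "v \<in> W m \<Longrightarrow> A (sc c v) = sc c (A v)"
    and B_scale: "v \<in> W m \<Longrightarrow> B (sc c v) = sc c (B v)"
    and comm: "v \<in> W m \<Longrightarrow> A (B v) - B (A v) = sc m v"
    and A_nil: "v \<in> W m \<Longrightarrow> \<exists>N. (A ^^ N) v = 0"
    and B_nil: "v \<in> W m \<Longrightarrow> \<exists>N. (B ^^ N) v = 0"
begin

text \<open>The symmetry that exchanges raising and lowering; each result on powers of
  \<open>B\<close> thereby holds for powers of \<open>A\<close>.\<close>

lemma opposite: "sl2_graded sc (\<lambda>m. W (- m)) B A"
proof unfold_locales
  fix v m assume v: "v \<in> W (- m)"
  then show "B v \<in> W (- (m + 2))" "A v \<in> W (- (m - 2))"
    using A_W[OF v] B_W[OF v] by (simp_all add: add.commute)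
  show "B (A v) - A (B v) = sc m v"
    using comm[OF v] by (simp add: algebra_simps)
qed (use subspace_W A_add B_add A_scale B_scale A_nil B_nil in auto)

lemma B_pow_W: "v \<in> W m \<Longrightarrow> (B ^^ k) v \<in> W (m - 2 * of_nat k)"
proof (induction k)
  case (Suc k)
  then show ?case using B_W[OF Suc.IH[OF Suc.prems]] by (simp add: algebra_simps)
qed simp

lemma B_0: "B 0 = 0"
  using B_scale[of 0 0 0] subspace_0[OF subspace_W, of 0] by simp

lemma B_pow_0: "(B ^^ k) 0 = 0"
  by (induction k) (simp_all add: B_0)

lemma B_pow_add: "u \<in> W m \<Longrightarrow> v \<in> W m \<Longrightarrow> (B ^^ k) (u + v) = (B ^^ k) u + (B ^^ k) v"
  by (induction k) (auto simp: B_add[OF B_pow_W B_pow_W])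

lemma B_pow_scale: "v \<in> W m \<Longrightarrow> (B ^^ k) (sc c v) = sc c ((B ^^ k) v)"
  by (induction k) (auto simp: B_scale[OF B_pow_W])

text \<open>Moving \<open>A\<close> to the left past \<open>k + 1\<close> factors \<open>B\<close>
  collects the eigenvalues \<open>m - 2l\<close> for \<open>l = 0, ..., k\<close>, whose sum is
  \<open>(k + 1) (m - k)\<close>.\<close>

lemma B_pow_A:
  assumes v: "v \<in> W m"
  shows "(B ^^ Suc k) (A v) =
    A ((B ^^ Suc k) v) - sc (of_nat (Suc k) * (m - of_nat k)) ((B ^^ k) v)"
proof (induction k)
  case 0
  show ?case using comm[OF v] by (simp add: algebra_simps)
next
  case (Suc k)
  have combine: "a - sc p x + sc (- q) x = a - sc (p + q) x" for a p q x
    by (simp add: scale_left_distrib)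
  let ?c = "of_nat (Suc k) * (m - of_nat k)"
  let ?m = "m - 2 * of_nat (Suc k)"
  have B: "(B ^^ Suc k) v \<in> W ?m" "(B ^^ k) v \<in> W (?m + 2)"
    using B_pow_W[OF v, of "Suc k"] B_pow_W[OF v, of k] by (simp_all add: algebra_simps)
  have "(B ^^ Suc (Suc k)) (A v) =
      B (A ((B ^^ Suc k) v) + sc (- ?c) ((B ^^ k) v))"
    using Suc by simp
  also have "\<dots> = B (A ((B ^^ Suc k) v)) + sc (- ?c) (B ((B ^^ k) v))"
    using A_W[OF B(1)] B(2) B_scale[OF B(2), of "- ?c"]
    by (subst B_add[of _ "?m + 2"]) (simp_all only: subspace_scale[OF subspace_W])
  also have "B (A ((B ^^ Suc k) v)) = A ((B ^^ Suc (Suc k)) v) - sc ?m ((B ^^ Suc k) v)"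
    using comm[OF B(1)] by (simp add: algebra_simps)
  also have "A ((B ^^ Suc (Suc k)) v) - sc ?m ((B ^^ Suc k) v) + sc (- ?c) (B ((B ^^ k) v)) =
      A ((B ^^ Suc (Suc k)) v) - sc (?m + ?c) ((B ^^ Suc k) v)"
    by (simp only: combine funpow.simps o_apply)
  also have "?m + ?c = of_nat (Suc (Suc k)) * (m - of_nat (Suc k))"
    by (simp add: algebra_simps)
  finally show ?case .
qed

text \<open>The eigenvalue only becomes more negative along \<open>A ^^ n\<close>, so that \<open>A ^^ n\<close> never kills \<open>v\<close>.\<close>

lemma negative_eigenvector_eq_0:
  assumes "v \<in> W (of_nat m)" "B (A v) = sc (- of_real r) v" "0 < r" "(A ^^ N) v = 0"
  shows "v = 0"
  using assms
proof (induction N arbitrary: v m r)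
  case (Suc N)
  have Av: "A v \<in> W (of_nat (m + 2))"
    using A_W[OF Suc.prems(1)] by (simp add: add.commute)
  have "A (B (A v)) = sc (- of_real r) (A v)"
    using A_scale[OF Suc.prems(1), of "- of_real r"] Suc.prems(2) by simp
  then have "B (A (A v)) = sc (- of_real r) (A v) - sc (of_nat (m + 2)) (A v)"
    using comm[OF Av] by (simp add: algebra_simps)
  also have "\<dots> = sc (- of_real (r + real (m + 2))) (A v)"
    by (simp add: scale_left_distrib scale_left_diff_distrib algebra_simps)
  finally have "A v = 0"
    using Suc.prems by (intro Suc.IH[OF Av, of "r + real (m + 2)"]) (simp_all add: funpow_swap1)
  then show ?case
    using Suc.prems B_0 by auto
qed simp

text \<open>If \<open>B ^^ Suc k\<close> kills \<open>v\<close>, then by \<open>B_pow_A\<close> the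
  power \<open>B ^^ k\<close> kills \<open>B (A v) + r v\<close> with
  \<open>r = (k + 1) (m - k)\<close>. By induction this vector is 0, so \<open>v\<close> is an
  eigenvector of \<open>B A\<close> for \<open>- r\<close>. Here \<open>r > 0\<close> because
  \<open>k < m\<close>, and local nilpotency of \<open>A\<close> excludes that unless
  \<open>v = 0\<close>.\<close>

lemma B_pow_injective:
  assumes "v \<in> W (of_nat m)" "k \<le> m" "(B ^^ k) v = 0"
  shows "v = 0"
  using assms
proof (induction k arbitrary: v)
  case (Suc k)
  let ?r = "real (Suc k) * (real m - real k)"
  have BA: "B (A v) \<in> W (of_nat m)"
    using B_W[OF A_W[OF Suc.prems(1)]] by simp
  have "(B ^^ k) (B (A v) + sc (of_real ?r) v) = (B ^^ Suc k) (A v) + sc (of_real ?r) ((B ^^ k) v)"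
    using BA Suc.prems(1)
    by (subst B_pow_add) (auto simp: funpow_swap1 B_pow_scale intro: subspace_scale[OF subspace_W])
  also have "\<dots> = 0"
    using B_pow_A[OF Suc.prems(1), of k] Suc.prems(3) opposite
    by (simp add: sl2_graded.B_0[OF opposite])
  finally have "B (A v) + sc (of_real ?r) v = 0"
    using Suc.IH[of "B (A v) + sc (of_real ?r) v"] Suc.prems(1,2) BA
    by (auto intro!: subspace_add[OF subspace_W] subspace_scale[OF subspace_W])
  then have "B (A v) = sc (- of_real ?r) v"
    by (simp add: eq_neg_iff_add_eq_0)
  moreover have "0 < ?r"
    using Suc.prems(2) by auto
  moreover obtain N where "(A ^^ N) v = 0"
    using A_nil[OF Suc.prems(1)] by blast
  ultimately show ?case
    by (rule negative_eigenvector_eq_0[OF Suc.prems(1)])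
qed simp

text \<open>Lowering \<open>v\<close> as far as possible, \<open>k\<close> times, gives
  \<open>w\<close> with \<open>B w = 0\<close>; raising \<open>w\<close> as far as possible takes
  some \<open>j\<close> steps. The chain from \<open>w\<close> is symmetric about eigenvalue 0, so
  \<open>w\<close> has eigenvalue \<open>- j\<close> and \<open>v\<close> has
  \<open>2k - j\<close>.\<close>

lemma weight_integer:
  assumes v: "v \<in> W m" "v \<noteq> 0"
  shows "m \<in> \<int>"
proof -
  interpret op: sl2_graded sc "\<lambda>m. W (- m)" B A
    by (rule opposite)
  obtain k where k: "(B ^^ k) v \<noteq> 0" "B ((B ^^ k) v) = 0"
    using B_nil[OF v(1)] funpow_last_nonzero[OF v(2)] by metis
  define w where "w = (B ^^ k) v"
  define n where "n = m - 2 * of_nat k"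
  have w: "w \<in> W n" "w \<noteq> 0" "B w = 0"
    using B_pow_W[OF v(1)] k by (auto simp: w_def n_def)
  obtain j where j: "(A ^^ j) w \<noteq> 0" "A ((A ^^ j) w) = 0"
    using A_nil[OF w(1)] funpow_last_nonzero[OF w(2)] by metis
  \<comment> \<open>The commutator identity with the roles of \<open>A\<close> and \<open>B\<close>
    exchanged: the other two terms vanish because \<open>B w = 0\<close> and
    \<open>A ^^ Suc j\<close> kills \<open>w\<close>.\<close>
  have "sc (of_nat (Suc j) * (- n - of_nat j)) ((A ^^ j) w) = 0"
    using op.B_pow_A[of w "- n" j] w j(2) op.B_pow_0[of "Suc j"] B_0
    by (simp del: of_nat_Suc)
  then have "- n = of_nat j"
    using j(1) by (auto simp del: of_nat_Suc)
  then have "n = - of_nat j"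
    by (metis minus_minus)
  then have "m = of_int (2 * int k - int j)"
    by (simp add: n_def algebra_simps)
  then show ?thesis
    by simp
qed

end

section \<open>Root strings and the reflection of multiplicities\<close>

locale sl2_weight_basis = weight_basis K M I e b
  for K :: "('g::ab_group_add, 'n::finite) km_data"
    and M :: "('g, 'v::ab_group_add) rep"
    and I :: "'i set" and e :: "'i \<Rightarrow> 'v" and b :: "'i \<Rightarrow> 'g \<Rightarrow> complex" +
  fixes \<alpha> :: "'g \<Rightarrow> complex" and h X Y :: 'g
  assumes \<alpha>_dual: "\<alpha> \<in> dual_space (lscale K) (cartan K)"
    and h_cartan: "h \<in> cartan K"
    and \<alpha>_h: "\<alpha> h = 2"
    and bracket_X: "x \<in> cartan K \<Longrightarrow> lbracket K x X = lscale K (\<alpha> x) X"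
    and bracket_Y: "x \<in> cartan K \<Longrightarrow> lbracket K x Y = lscale K (- \<alpha> x) Y"
    and bracket_XY: "lbracket K X Y = h"
    and nil_X: "v \<in> rcarrier M \<Longrightarrow> \<exists>N. (act M X ^^ N) v = 0"
    and nil_Y: "v \<in> rcarrier M \<Longrightarrow> \<exists>N. (act M Y ^^ N) v = 0"
    and finite_level: "finite {i \<in> I. b i = \<mu>}"
begin

definition shift :: "('g \<Rightarrow> complex) \<Rightarrow> int \<Rightarrow> 'g \<Rightarrow> complex" where
  "shift \<mu> k = (\<lambda>x. \<mu> x + of_int k * \<alpha> x)"

definition refl :: "('g \<Rightarrow> complex) \<Rightarrow> 'g \<Rightarrow> complex" where
  "refl \<mu> = (\<lambda>x. \<mu> x - \<mu> h * \<alpha> x)"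

lemma shift_0 [simp]: "shift \<mu> 0 = \<mu>"
  by (simp add: shift_def)

lemma shift_shift [simp]: "shift (shift \<mu> k) l = shift \<mu> (k + l)"
  by (simp add: shift_def fun_eq_iff algebra_simps)

lemma shift_dual: "\<mu> \<in> dual_space (lscale K) (cartan K) \<Longrightarrow> shift \<mu> k \<in> dual_space (lscale K) (cartan K)"
  using dual_space_add[OF _ dual_space_scale[OF \<alpha>_dual, of "of_int k"], of \<mu>]
  by (simp add: shift_def plus_fun_def)

lemma shift_h: "shift \<mu> k h = \<mu> h + 2 * of_int k"
  by (simp add: shift_def \<alpha>_h)

lemma refl_eq_shift: "\<mu> h = of_int n \<Longrightarrow> refl \<mu> = shift \<mu> (- n)"
  by (simp add: refl_def shift_def)

lemma refl_h: "refl \<mu> h = - \<mu> h"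
  by (simp add: refl_def \<alpha>_h)

lemma refl_refl: "refl (refl \<mu>) = \<mu>"
  using refl_h[of \<mu>] by (simp add: refl_def[of "refl \<mu>"]) (simp add: refl_def)

lemma refl_dual: "\<mu> \<in> dual_space (lscale K) (cartan K) \<Longrightarrow> refl \<mu> \<in> dual_space (lscale K) (cartan K)"
  using dual_space_diff[OF _ dual_space_scale[OF \<alpha>_dual, of "\<mu> h"], of \<mu>]
  by (simp add: refl_def fun_diff_def)

lemma X_weight: "v \<in> weight_space K M \<mu> \<Longrightarrow> act M X v \<in> weight_space K M (shift \<mu> 1)"
  and Y_weight: "v \<in> weight_space K M \<mu> \<Longrightarrow> act M Y v \<in> weight_space K M (shift \<mu> (-1))"
proof -
  assume v: "v \<in> weight_space K M \<mu>"
  then have vc: "v \<in> rcarrier M"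
    by (simp add: weight_space_def)
  have "act M x (act M X v) = sc (\<mu> x + \<alpha> x) (act M X v)"
    and "act M x (act M Y v) = sc (\<mu> x - \<alpha> x) (act M Y v)" if x: "x \<in> cartan K" for x
  proof -
    have "act M x v = sc (\<mu> x) v"
      using v x by (simp add: weight_space_def)
    then show "act M x (act M X v) = sc (\<mu> x + \<alpha> x) (act M X v)"
      and "act M x (act M Y v) = sc (\<mu> x - \<alpha> x) (act M Y v)"
      using act_bracket[OF vc, of x X] act_bracket[OF vc, of x Y] vc
      by (simp_all add: bracket_X[OF x] bracket_Y[OF x] act_scale_left act_scale
          scale_left_distrib scale_left_diff_distrib eq_diff_eq diff_eq_eq add.commute)
  qed
  then show "act M X v \<in> weight_space K M (shift \<mu> 1)" "act M Y v \<in> weight_space K M (shift \<mu> (-1))"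
    using vc by (auto simp: weight_space_def act_closed shift_def)
qed

sublocale sl2: sl2_graded "rscale M" "\<lambda>m. {v \<in> rcarrier M. act M h v = sc m v}" "act M X" "act M Y"
proof unfold_locales
  fix m
  show "subspace {v \<in> rcarrier M. act M h v = sc m v}"
    using subspace_carrier
    by (auto simp: subspace_def act_0 act_add act_scale scale_right_distrib mult.commute)
  fix v assume v: "v \<in> {v \<in> rcarrier M. act M h v = sc m v}"
  then show "act M X v \<in> {v \<in> rcarrier M. act M h v = sc (m + 2) v}"
    and "act M Y v \<in> {v \<in> rcarrier M. act M h v = sc (m - 2) v}"
    and "act M X (act M Y v) - act M Y (act M X v) = sc m v"
    using act_bracket[of v h X] act_bracket[of v h Y] act_bracket[of v X Y]
    by (auto simp: bracket_X[OF h_cartan] bracket_Y[OF h_cartan] bracket_XY \<alpha>_h act_scale_left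
        act_closed act_scale scale_left_distrib scale_left_diff_distrib eq_diff_eq diff_eq_eq add.commute)
qed (auto simp: act_add act_scale nil_X nil_Y)

lemma weight_space_graded:
  "v \<in> weight_space K M \<mu> \<Longrightarrow> v \<in> {v \<in> rcarrier M. act M h v = sc (\<mu> h) v}"
  using h_cartan by (simp add: weight_space_def)

lemma Y_pow_weight:
  "v \<in> weight_space K M \<mu> \<Longrightarrow> (act M Y ^^ k) v \<in> weight_space K M (shift \<mu> (- int k))"
proof (induction k)
  case (Suc k)
  then show ?case
    using Y_weight[OF Suc.IH[OF Suc.prems]] by (simp add: algebra_simps)
qed simp

lemma b_h_integer: "i \<in> I \<Longrightarrow> b i h \<in> \<int>"
  using sl2.weight_integer[OF weight_space_graded[OF wt]] e_nonzero by blast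

lemma Y_pow_injective:
  assumes "v \<in> weight_space K M \<mu>" "\<mu> h = of_nat n" "k \<le> n" "(act M Y ^^ k) v = 0"
  shows "v = 0"
  using sl2.B_pow_injective[of v n k] weight_space_graded[OF assms(1)] assms by simp

text \<open>The image of \<open>e i\<close> under \<open>act M Y ^^ k\<close> is nonzero by
  injectivity, so its weight occurs. This later supplies a weight of small degree in the string of a
  crossing weight.\<close>

lemma no_gap:
  assumes "i \<in> I" "b i h = of_nat n" "k \<le> n"
  shows "\<exists>j\<in>I. b j = shift (b i) (- int k)"
proof -
  have "(act M Y ^^ k) (e i) \<noteq> 0"
    using Y_pow_injective[OF wt] e_nonzero assms by blast
  then have "shift (b i) (- int k) \<in> weights K M"
    using Y_pow_weight[OF wt[OF assms(1)], of k] shift_dual[OF dual[OF assms(1)]]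
    by (auto simp: weights_def)
  then show ?thesis
    by (auto simp: weights_eq)
qed

lemma sl2_opposite: "sl2_graded sc (\<lambda>m. {v \<in> rcarrier M. act M h v = sc (- m) v}) (act M Y) (act M X)"
  by (rule sl2.opposite)

lemma weight_space_graded':
  "v \<in> weight_space K M \<mu> \<Longrightarrow> v \<in> {v \<in> rcarrier M. act M h v = sc (- (- \<mu> h)) v}"
  using h_cartan by (simp add: weight_space_def)

lemma X_pow_weight:
  "v \<in> weight_space K M \<mu> \<Longrightarrow> (act M X ^^ k) v \<in> weight_space K M (shift \<mu> (int k))"
proof (induction k)
  case (Suc k)
  then show ?case
    using X_weight[OF Suc.IH[OF Suc.prems]] by (simp add: algebra_simps)
qed simp

lemma X_pow_injective:
  assumes "v \<in> weight_space K M \<mu>" "\<mu> h = - of_nat n" "k \<le> n" "(act M X ^^ k) v = 0"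
  shows "v = 0"
  using sl2_graded.B_pow_injective[OF sl2_opposite, of v n k] weight_space_graded[OF assms(1)] assms
  by simp

lemma Y_pow_add:
  "u \<in> weight_space K M \<mu> \<Longrightarrow> v \<in> weight_space K M \<mu> \<Longrightarrow>
    (act M Y ^^ k) (u + v) = (act M Y ^^ k) u + (act M Y ^^ k) v"
  by (rule sl2.B_pow_add[of _ "\<mu> h"]; rule weight_space_graded)

lemma Y_pow_scale:
  "v \<in> weight_space K M \<mu> \<Longrightarrow> (act M Y ^^ k) (sc c v) = sc c ((act M Y ^^ k) v)"
  by (rule sl2.B_pow_scale[of _ "\<mu> h"]; rule weight_space_graded)

lemma X_pow_add:
  "u \<in> weight_space K M \<mu> \<Longrightarrow> v \<in> weight_space K M \<mu> \<Longrightarrow>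
    (act M X ^^ k) (u + v) = (act M X ^^ k) u + (act M X ^^ k) v"
  by (rule sl2_graded.B_pow_add[OF sl2_opposite, of _ "- \<mu> h"]; rule weight_space_graded')

lemma X_pow_scale:
  "v \<in> weight_space K M \<mu> \<Longrightarrow> (act M X ^^ k) (sc c v) = sc c ((act M X ^^ k) v)"
  by (rule sl2_graded.B_pow_scale[OF sl2_opposite, of _ "- \<mu> h"]; rule weight_space_graded')

lemma weight_mult_le:
  assumes \<mu>: "\<mu> \<in> dual_space (lscale K) (cartan K)" "\<nu> \<in> dual_space (lscale K) (cartan K)"
    and f: "\<And>v. v \<in> weight_space K M \<mu> \<Longrightarrow> f v \<in> weight_space K M \<nu>"
      "\<And>u v. u \<in> weight_space K M \<mu> \<Longrightarrow> v \<in> weight_space K M \<mu> \<Longrightarrow> f (u + v) = f u + f v"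
      "\<And>c v. v \<in> weight_space K M \<mu> \<Longrightarrow> f (sc c v) = sc c (f v)"
      "\<And>v. v \<in> weight_space K M \<mu> \<Longrightarrow> f v = 0 \<Longrightarrow> v = 0"
  shows "weight_mult K M \<mu> \<le> weight_mult K M \<nu>"
proof -
  interpret vector_space_pair sc sc ..
  show ?thesis
    unfolding weight_mult_def
    by (rule dim_le_of_injective(1)[where f = f and F = "e ` {i \<in> I. b i = \<nu>}"])
      (use f subspace_weight_space finite_level weight_space_eq_span[OF \<mu>(2)] in auto)
qed

text \<open>If \<open>\<mu> h = n\<close>, then \<open>n\<close> applications of \<open>Y\<close>,
  or \<open>- n\<close> applications of \<open>X\<close> for negative \<open>n\<close>, embed the
  weight space of \<open>\<mu>\<close> into that of \<open>refl \<mu>\<close>.\<close>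

lemma weight_mult_le_refl:
  assumes \<mu>: "\<mu> \<in> dual_space (lscale K) (cartan K)" "\<mu> h \<in> \<int>"
  shows "weight_mult K M \<mu> \<le> weight_mult K M (refl \<mu>)"
proof -
  obtain n where n: "\<mu> h = of_int n"
    using \<mu>(2) by (auto elim: Ints_cases)
  show ?thesis
  proof (cases "0 \<le> n")
    case True
    then have r: "refl \<mu> = shift \<mu> (- int (nat n))" "\<mu> h = of_nat (nat n)"
      using refl_eq_shift[of \<mu> n] n by simp_all
    show ?thesis
      using Y_pow_weight[of _ \<mu> "nat n"] Y_pow_injective[of _ \<mu> "nat n" "nat n"] r
      by (intro weight_mult_le[OF \<mu>(1) refl_dual[OF \<mu>(1)], of "act M Y ^^ nat n"])
        (auto simp only: Y_pow_add Y_pow_scale)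
  next
    case False
    then have r: "refl \<mu> = shift \<mu> (int (nat (- n)))" "\<mu> h = - of_nat (nat (- n))"
      using refl_eq_shift[of \<mu> n] n by simp_all
    show ?thesis
      using X_pow_weight[of _ \<mu> "nat (- n)"] X_pow_injective[of _ \<mu> "nat (- n)" "nat (- n)"] r
      by (intro weight_mult_le[OF \<mu>(1) refl_dual[OF \<mu>(1)], of "act M X ^^ nat (- n)"])
        (auto simp only: X_pow_add X_pow_scale)
  qed
qed

lemma weight_mult_refl:
  assumes \<mu>: "\<mu> \<in> dual_space (lscale K) (cartan K)"
  shows "weight_mult K M (refl \<mu>) = weight_mult K M \<mu>"
proof (cases "\<mu> h \<in> \<int>")
  case True
  then show ?thesis
    using weight_mult_le_refl[OF \<mu>] weight_mult_le_refl[OF refl_dual[OF \<mu>]]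
    by (simp add: refl_refl refl_h)
next
  case False
  \<comment> \<open>Weights take integral values at \<open>h\<close>, so neither
    \<open>\<mu>\<close> nor its reflection, whose value is the negative, is a weight.\<close>
  then have "{i \<in> I. b i = \<mu>} = {}" "{i \<in> I. b i = refl \<mu>} = {}"
    using b_h_integer refl_h[of \<mu>] by force+
  then show ?thesis
    by (simp only: weight_mult_eq[OF \<mu>] weight_mult_eq[OF refl_dual[OF \<mu>]])
qed

text \<open>Local nilpotency becomes uniform because the weight space is spanned by finitely many
  \<open>e i\<close>: the maximum of their exponents works.\<close>

lemma X_nilpotent_on_weight_space:
  assumes "\<mu> \<in> dual_space (lscale K) (cartan K)"
  shows "\<exists>N. \<forall>k\<ge>N. \<forall>v\<in>weight_space K M \<mu>. (act M X ^^ k) v = 0"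
proof -
  let ?L = "{i \<in> I. b i = \<mu>}"
  have "\<forall>i\<in>?L. \<exists>N. (act M X ^^ N) (e i) = 0"
    using nil_X e_carrier by blast
  then obtain N where N: "\<And>i. i \<in> ?L \<Longrightarrow> (act M X ^^ N i) (e i) = 0"
    by metis
  have 0: "(act M X ^^ k) 0 = 0" for k
    by (rule sl2_graded.B_pow_0[OF sl2_opposite])
  have "(act M X ^^ k) v = 0" if k: "Max (N ` ?L) \<le> k" and v: "v \<in> weight_space K M \<mu>" for k v
  proof -
    have ei: "(act M X ^^ k) (e i) = 0" if "i \<in> ?L" for i
    proof -
      have "N i \<le> k"
        using that k finite_level by (meson Max_ge finite_imageI image_eqI le_trans)
      then have "(act M X ^^ k) (e i) = (act M X ^^ (k - N i)) ((act M X ^^ N i) (e i))"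
        using funpow_add[of "k - N i" "N i" "act M X"] by simp
      then show ?thesis
        using N[OF that] 0 by simp
    qed
    have "v \<in> span (e ` ?L)"
      using v weight_space_eq_span[OF assms] by simp
    then have "v \<in> weight_space K M \<mu> \<and> (act M X ^^ k) v = 0"
    proof (induction rule: span_induct_alt)
      case base
      then show ?case
        using 0 subspace_0[OF subspace_weight_space] by simp
    next
      case (step c x y)
      then have x: "x \<in> weight_space K M \<mu>" "(act M X ^^ k) x = 0"
        using wt ei by auto
      then show ?case
        using step.IH X_pow_add[OF subspace_scale[OF subspace_weight_space x(1)], of y]
          X_pow_scale[OF x(1)] subspace_add[OF subspace_weight_space subspace_scale[OF subspace_weight_space x(1)]]
        by simp
    qed
    then show ?thesis ..
  qed
  then show ?thesis by (intro exI[of _ "Max (N ` ?L)"]) simp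
qed

text \<open>
  A vector of \<open>h\<close>-weight \<open>m\<close> is moved by \<open>Y ^^ m\<close> and then by \<open>X ^^ m\<close> without being killed, and on the
  way back it passes through the weight space of \<open>h\<close>-weight 0 or 1, where \<open>X\<close> is nilpotent.
\<close>

lemma string_bounded_above:
  assumes \<mu>: "\<mu> \<in> dual_space (lscale K) (cartan K)"
  shows "\<exists>N. \<forall>k. shift \<mu> k \<in> b ` I \<longrightarrow> k \<le> N"
proof (cases "\<exists>k. shift \<mu> k \<in> b ` I")
  case True
  then obtain k0 i0 where "i0 \<in> I" "shift \<mu> k0 = b i0"
    by blast
  then have "\<mu> h + 2 * of_int k0 \<in> \<int>"
    using b_h_integer[of i0] shift_h[of \<mu> k0] by metis
  then have "\<mu> h + 2 * of_int k0 - of_int (2 * k0) \<in> \<int>"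
    by (intro Ints_diff) simp_all
  then obtain n where n: "\<mu> h = of_int n"
    by (auto elim: Ints_cases)
  \<comment> \<open>The member of the string whose \<open>h\<close>-value is the remainder 0 or 1 of
    \<open>n\<close> modulo 2.\<close>
  define \<gamma> where "\<gamma> = shift \<mu> (- (n div 2))"
  define r where "r = nat (n mod 2)"
  have \<gamma>: "\<gamma> \<in> dual_space (lscale K) (cartan K)"
    using shift_dual[OF \<mu>] by (simp add: \<gamma>_def)
  have "n + 2 * - (n div 2) = int r"
    using minus_mult_div_eq_mod[of n 2] by (simp add: r_def)
  then have \<gamma>_h: "\<gamma> h = of_nat r"
    using shift_h[of \<mu> "- (n div 2)"] n unfolding \<gamma>_def
    by (metis of_int_add of_int_mult of_int_numeral of_int_of_nat_eq)
  obtain N where N: "\<And>k v. N \<le> k \<Longrightarrow> v \<in> weight_space K M \<gamma> \<Longrightarrow> (act M X ^^ k) v = 0"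
    using X_nilpotent_on_weight_space[OF \<gamma>] by metis
  have below: "k < N" if k: "shift \<gamma> (int k) \<in> b ` I" for k
  proof -
    obtain i where i: "i \<in> I" "b i = shift \<gamma> (int k)"
      using k by (metis imageE)
    \<comment> \<open>The \<open>h\<close>-value of the weight \<open>shift \<gamma> k\<close>.
      After \<open>m\<close> steps down the weight is \<open>shift \<gamma> (- k - r)\<close>; on
      the way back, \<open>k + r\<close> steps of \<open>X\<close> reach \<open>\<gamma>\<close> and
      \<open>k\<close> further steps remain, so \<open>k \<ge> N\<close> would kill the
      vector.\<close>
    define m where "m = 2 * k + r"
    define w where "w = (act M Y ^^ m) (e i)"
    have m: "b i h = of_nat m"
      by (simp add: i shift_h \<gamma>_h m_def)
    have w: "w \<in> weight_space K M (shift \<gamma> (int k - int m))"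
      using Y_pow_weight[OF wt[OF i(1)], of m] i(2) by (simp add: w_def)
    have "w \<noteq> 0"
      using Y_pow_injective[OF wt[OF i(1)] m] e_nonzero[OF i(1)] by (auto simp: w_def)
    moreover have "shift \<gamma> (int k - int m) h = - of_nat m"
      by (simp add: shift_h \<gamma>_h m_def algebra_simps)
    ultimately have "(act M X ^^ m) w \<noteq> 0"
      using X_pow_injective[OF w] by blast
    moreover have "(act M X ^^ m) w = (act M X ^^ k) ((act M X ^^ (k + r)) w)"
      by (simp add: m_def mult_2 funpow_add add.assoc)
    moreover have "(act M X ^^ (k + r)) w \<in> weight_space K M \<gamma>"
      using X_pow_weight[OF w, of "k + r"] by (simp add: m_def algebra_simps)
    ultimately have "\<not> N \<le> k"
      using N by metis
    then show ?thesis by simp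
  qed
  have "k \<le> int N - n div 2" if "shift \<mu> k \<in> b ` I" for k
  proof (cases "0 \<le> k + n div 2")
    case True
    then show ?thesis
      using below[of "nat (k + n div 2)"] that by (simp add: \<gamma>_def)
  qed simp
  then show ?thesis
    by (intro exI[of _ "int N - n div 2"] allI impI)
next
  case False
  then show ?thesis by simp
qed

end

section \<open>Weights crossing a reflection\<close>

text \<open>The value at \<open>d\<close> serves as a degree, and \<open>X\<close> raises it by
  \<open>\<alpha> d\<close>. Positive indices have only nonnegative degree, since a zero weight
  space is split between positive and negative indices; \<open>finite_bounded\<close> is
  \<open>d\<close>-finiteness in terms of indices.\<close>

locale orthogonal_sl2_weight_basis = sl2_weight_basis K M I e b \<alpha> h X Y
  for K :: "('g::ab_group_add, 'n::finite) km_data"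
    and M :: "('g, 'v::ab_group_add) rep"
    and I :: "int set" and e :: "int \<Rightarrow> 'v" and b :: "int \<Rightarrow> 'g \<Rightarrow> complex"
    and \<alpha> h X Y +
  fixes d :: 'g
  assumes uminus_I: "i \<in> I \<Longrightarrow> - i \<in> I"
    and b_uminus: "i \<in> I \<Longrightarrow> b (- i) = - b i"
    and b_d_nonneg: "i \<in> I \<Longrightarrow> 0 < i \<Longrightarrow> 0 \<le> Re (b i d)"
    and b_d_eq_0: "i \<in> I \<Longrightarrow> Re (b i d) = 0 \<Longrightarrow> b i = 0"
    and finite_bounded: "finite {i \<in> I. \<bar>Re (b i d)\<bar> \<le> D}"
    and \<alpha>_d: "0 < Re (\<alpha> d)"
begin

lemma b_d_nonpos: "i \<in> I \<Longrightarrow> i \<le> 0 \<Longrightarrow> Re (b i d) \<le> 0"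
  using b_d_nonneg[of "- i"] uminus_I[of i] b_uminus[of i]
  by (cases "i = 0") (auto simp: fun_eq_iff)

lemma positive_index: "i \<in> I \<Longrightarrow> 0 < Re (b i d) \<Longrightarrow> 0 < i"
  using b_d_nonpos[of i] by (cases "0 < i") auto

lemma Re_shift: "Re (shift \<mu> k d) = Re (\<mu> d) + of_int k * Re (\<alpha> d)"
  by (simp add: shift_def)

abbreviation mX where "mX j i \<equiv> coeff (act M X (e i)) j"
abbreviation mY where "mY j i \<equiv> coeff (act M Y (e i)) j"

lemma mX_nonzero: "i \<in> I \<Longrightarrow> j \<in> I \<Longrightarrow> mX j i \<noteq> 0 \<Longrightarrow> b j = shift (b i) 1"
  using X_weight[OF wt] weight_space_iff[OF shift_dual[OF dual]] by blast

lemma mY_nonzero: "i \<in> I \<Longrightarrow> j \<in> I \<Longrightarrow> mY j i \<noteq> 0 \<Longrightarrow> b j = shift (b i) (-1)"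
  using Y_weight[OF wt] weight_space_iff[OF shift_dual[OF dual]] by blast

lemma coeff_act_act:
  assumes i: "i \<in> I" and S: "finite S" "S \<subseteq> I"
    and supp: "\<And>j. j \<in> I \<Longrightarrow> coeff (act M x (e j)) i * coeff (act M y (e i)) j \<noteq> 0 \<Longrightarrow> j \<in> S"
  shows "coeff (act M x (act M y (e i))) i =
    (\<Sum>j\<in>S. coeff (act M x (e j)) i * coeff (act M y (e i)) j)"
proof -
  let ?F = "{j \<in> I. coeff (act M y (e i)) j \<noteq> 0}"
  have "act M y (e i) = (\<Sum>j\<in>?F. sc (coeff (act M y (e i)) j) (e j))"
    using i finite_coeff by (intro expand) (auto intro: act_closed e_carrier)
  then have "coeff (act M x (act M y (e i))) i =
      coeff (act M x (\<Sum>j\<in>?F. sc (coeff (act M y (e i)) j) (e j))) i"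
    by simp
  also have "\<dots> = (\<Sum>j\<in>?F. coeff (act M x (e j)) i * coeff (act M y (e i)) j)"
    by (subst act_sum, (auto intro: subspace_scale[OF subspace_carrier] e_carrier)[],
        subst coeff_sum, (auto intro: act_closed subspace_scale[OF subspace_carrier] e_carrier)[])
      (auto simp: act_scale coeff_scale e_carrier act_closed intro!: sum.cong)
  also have "\<dots> = (\<Sum>j\<in>S. coeff (act M x (e j)) i * coeff (act M y (e i)) j)"
    using S supp finite_coeff[of "act M y (e i)"] by (intro sum.mono_neutral_cong) auto
  finally show ?thesis .
qed

text \<open>The bound is one step of \<open>\<alpha>\<close> in degree. An entry of \<open>X\<close>
  leading from a nonpositive to a positive index starts here, and the string of every weight that
  the reflection moves to negative degree has a member here.\<close>

definition near_zero :: "int set" where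
  "near_zero = {i \<in> I. \<bar>Re (b i d)\<bar> \<le> Re (\<alpha> d)}"

definition strings :: "('g \<Rightarrow> complex) set" where
  "strings = {shift (b f) k | f k. f \<in> near_zero}"

definition window :: "int set" where
  "window = {j \<in> I. 0 < j \<and> b j \<in> strings}"

lemma shift_strings: "\<mu> \<in> strings \<Longrightarrow> shift \<mu> k \<in> strings"
  unfolding strings_def using shift_shift by blast

text \<open>There are finitely many strings through \<open>near_zero\<close>. Each is bounded above
  by nilpotency of \<open>X\<close>, and positive indices have nonnegative degree, so the degrees in
  the window are bounded.\<close>

lemma finite_window: "finite window"
proof -
  obtain N where N: "\<And>f k. f \<in> near_zero \<Longrightarrow> shift (b f) k \<in> b ` I \<Longrightarrow> k \<le> N f"
    using string_bounded_above[OF dual] unfolding near_zero_def by (metis (no_types, lifting) mem_Collect_eq)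
  have "window \<subseteq> (\<Union>f\<in>near_zero. {i \<in> I. \<bar>Re (b i d)\<bar> \<le> Re (\<alpha> d) + of_int \<bar>N f\<bar> * Re (\<alpha> d)})"
  proof
    fix j assume "j \<in> window"
    then obtain f k where j: "j \<in> I" "0 < j" "f \<in> near_zero" "b j = shift (b f) k"
      by (auto simp: window_def strings_def)
    have "k \<le> N f"
      using N[of f k] j by (metis imageI)
    then have "of_int k * Re (\<alpha> d) \<le> of_int \<bar>N f\<bar> * Re (\<alpha> d)"
      using \<alpha>_d by (intro mult_right_mono) auto
    then show "j \<in> (\<Union>f\<in>near_zero. {i \<in> I. \<bar>Re (b i d)\<bar> \<le> Re (\<alpha> d) + of_int \<bar>N f\<bar> * Re (\<alpha> d)})"
      using j b_d_nonneg[of j] Re_shift[of "b f" k] by (auto simp: near_zero_def intro!: bexI[of _ f])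
  qed
  moreover have "finite near_zero"
    using finite_bounded by (simp add: near_zero_def)
  ultimately show ?thesis
    using finite_bounded by (meson finite_UN_I finite_subset)
qed

definition crossing_pairs :: "(int \<times> int) set" where
  "crossing_pairs = {(i, j). i \<in> I \<and> j \<in> I \<and> i \<le> 0 \<and> 0 < j \<and> mX j i * mY i j \<noteq> 0}"

lemma crossing_pairs_near_zero:
  assumes "(i, j) \<in> crossing_pairs"
  shows "i \<in> near_zero" "j \<in> window"
proof -
  have ij: "i \<in> I" "j \<in> I" "i \<le> 0" "0 < j" "b j = shift (b i) 1"
    using assms mX_nonzero[of i j] by (auto simp: crossing_pairs_def)
  then show "i \<in> near_zero"
    using b_d_nonpos[of i] b_d_nonneg[of j] Re_shift[of "b i" 1] by (auto simp: near_zero_def)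
  then show "j \<in> window"
    using ij by (auto simp: window_def strings_def)
qed

lemma finite_crossing_pairs: "finite crossing_pairs"
proof (rule finite_subset)
  show "crossing_pairs \<subseteq> near_zero \<times> window"
    using crossing_pairs_near_zero by auto
  show "finite (near_zero \<times> window)"
    using finite_window finite_bounded by (simp add: near_zero_def)
qed

text \<open>
  Both sides are the trace of the commutator of \<open>X\<close> and \<open>Y\<close> on the finite window: the products that
  stay inside the window cancel, and only those that cross to non-positive indices remain.
\<close>

lemma trace_window:
  "(\<Sum>j\<in>window. b j h) = (\<Sum>(i, j)\<in>crossing_pairs. mX j i * mY i j)"
proof -
  let ?N = "fst ` crossing_pairs"
  let ?S = "window \<union> ?N"
  have fin: "finite ?N" "finite window"
    using finite_crossing_pairs finite_window by auto
  have disj: "window \<inter> ?N = {}"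
    by (auto simp: window_def crossing_pairs_def)
  have S: "?S \<subseteq> I"
    by (auto simp: window_def crossing_pairs_def)
  \<comment> \<open>\<open>Y\<close> lowers the degree and may leave the positive indices; the
    indices reached in this way are exactly collected in \<open>?N\<close>.\<close>
  have supp1: "i \<in> ?S" if "j \<in> window" "i \<in> I" "mX j i * mY i j \<noteq> 0" for i j
  proof (cases "0 < i")
    case True
    have "b i = shift (b j) (-1)"
      using that mY_nonzero[of j i] by (auto simp: window_def)
    then show ?thesis
      using True that shift_strings by (auto simp: window_def)
  next
    case False
    then have "(i, j) \<in> crossing_pairs"
      using that by (auto simp: crossing_pairs_def window_def)
    then show ?thesis by force
  qed
  \<comment> \<open>\<open>X\<close> raises a nonnegative degree to a positive one, so it never
    leaves the window. This asymmetry is the source of the uncancelled terms.\<close>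
  have supp2: "i \<in> window" if "j \<in> window" "i \<in> I" "mY j i * mX i j \<noteq> 0" for i j
  proof -
    have i: "b i = shift (b j) 1"
      using that mX_nonzero[of j i] by (auto simp: window_def)
    then have "0 < Re (b i d)"
      using that b_d_nonneg[of j] \<alpha>_d Re_shift[of "b j" 1] by (auto simp: window_def)
    then show ?thesis
      using i that shift_strings positive_index[of i] by (auto simp: window_def)
  qed
  have "b j h = (\<Sum>i\<in>?S. mX j i * mY i j) - (\<Sum>i\<in>window. mY j i * mX i j)" if j: "j \<in> window" for j
  proof -
    have jI: "j \<in> I"
      using j by (simp add: window_def)
    have "act M X (act M Y (e j)) - act M Y (act M X (e j)) = sc (b j h) (e j)"
      using act_bracket[OF e_carrier[OF jI], of X Y] wt[OF jI] h_cartan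
      by (simp add: bracket_XY weight_space_def)
    then have "b j h = coeff (act M X (act M Y (e j))) j - coeff (act M Y (act M X (e j))) j"
      using coeff_diff[of "act M X (act M Y (e j))" "act M Y (act M X (e j))" j]
        coeff_scale[OF e_carrier[OF jI], of "b j h" j] coeff_e[OF jI jI] e_carrier[OF jI]
      by (simp add: act_closed)
    then show ?thesis
      using coeff_act_act[OF jI _ S, of X Y] supp1[OF j] fin
        coeff_act_act[OF jI fin(2), of Y X] supp2[OF j] S by simp
  qed
  then have "(\<Sum>j\<in>window. b j h) =
      (\<Sum>j\<in>window. (\<Sum>i\<in>?S. mX j i * mY i j) - (\<Sum>i\<in>window. mY j i * mX i j))"
    by (rule sum.cong[OF HOL.refl])
  also have "\<dots> = (\<Sum>j\<in>window. \<Sum>i\<in>window. mX j i * mY i j) + (\<Sum>j\<in>window. \<Sum>i\<in>?N. mX j i * mY i j)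
      - (\<Sum>j\<in>window. \<Sum>i\<in>window. mY j i * mX i j)"
    using fin disj by (simp add: sum.union_disjoint sum.distrib sum_subtractf)
  also have "(\<Sum>j\<in>window. \<Sum>i\<in>window. mY j i * mX i j) = (\<Sum>j\<in>window. \<Sum>i\<in>window. mX j i * mY i j)"
    by (subst sum.swap) (simp add: mult.commute)
  also have "(\<Sum>j\<in>window. \<Sum>i\<in>?N. mX j i * mY i j) = (\<Sum>i\<in>?N. \<Sum>j\<in>window. mX j i * mY i j)"
    by (rule sum.swap)
  also have "\<dots> = (\<Sum>(i, j)\<in>?N \<times> window. mX j i * mY i j)"
    by (simp add: sum.cartesian_product)
  also have "\<dots> = (\<Sum>(i, j)\<in>crossing_pairs. mX j i * mY i j)"
  proof (rule sum.mono_neutral_right)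
    show "\<forall>p\<in>?N \<times> window - crossing_pairs. (case p of (i, j) \<Rightarrow> mX j i * mY i j) = 0"
      by (auto simp: crossing_pairs_def window_def)
    show "crossing_pairs \<subseteq> ?N \<times> window"
      using crossing_pairs_near_zero by force
  qed (use fin in simp)
  finally show ?thesis
    by simp
qed

definition crossing :: "('g \<Rightarrow> complex) set" where
  "crossing = {\<beta> \<in> weights K M. 0 < Re (\<beta> d) \<and> Re (refl \<beta> d) < 0}"

lemma refl_weights: "\<beta> \<in> weights K M \<Longrightarrow> refl \<beta> \<in> weights K M"
proof -
  assume "\<beta> \<in> weights K M"
  then obtain i where i: "i \<in> I" "b i = \<beta>"
    by (auto simp: weights_eq)
  then have "weight_mult K M \<beta> \<noteq> 0"
    using finite_level[of \<beta>] weight_mult_eq[of \<beta>] dual[of i] by (auto simp: card_eq_0_iff)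
  then have "weight_mult K M (refl \<beta>) \<noteq> 0"
    using weight_mult_refl[of \<beta>] dual[of i] i by simp
  then have "{j \<in> I. b j = refl \<beta>} \<noteq> {}"
    using weight_mult_eq[OF refl_dual[of \<beta>]] dual[of i] i by (metis card.empty)
  then show ?thesis
    unfolding weights_eq by (metis (mono_tags, lifting) empty_Collect_eq imageI)
qed

lemma refl_strings:
  assumes "i \<in> I" "b i \<in> strings"
  shows "refl (b i) \<in> strings"
proof -
  obtain n where "b i h = of_int n"
    using b_h_integer[OF assms(1)] by (auto elim: Ints_cases)
  then show ?thesis
    using refl_eq_shift shift_strings[OF assms(2)] by metis
qed

text \<open>Subtracting \<open>\<alpha>\<close> as often as the degree stays nonnegative, that is
  \<open>k\<close> times with \<open>k\<close> the floor of \<open>\<beta> d / \<alpha> d\<close>,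
  lands in degree between 0 and \<open>\<alpha> d\<close>. The reflection subtracts
  \<open>\<alpha>\<close> a total of \<open>n\<close> times and reaches negative degree, so
  \<open>k \<le> n\<close> and \<open>no_gap\<close> shows that the resulting functional is a
  weight.\<close>

lemma crossing_window: "crossing \<subseteq> b ` window"
proof
  fix \<beta> assume \<beta>: "\<beta> \<in> crossing"
  then obtain j where j: "j \<in> I" "\<beta> = b j" and pos: "0 < Re (\<beta> d)" and neg: "Re (refl \<beta> d) < 0"
    by (auto simp: crossing_def weights_eq)
  obtain n where n: "b j h = of_int n"
    using b_h_integer[OF j(1)] by (auto elim: Ints_cases)
  define a where "a = Re (\<alpha> d)"
  have a: "0 < a"
    using \<alpha>_d by (simp add: a_def)
  have lt: "Re (\<beta> d) < of_int n * a"
    using neg j n refl_eq_shift[of \<beta> n] Re_shift[of \<beta> "- n"] by (simp add: a_def)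
  then have n0: "0 < n"
    using pos a by (smt (verit) mult_nonpos_nonneg of_int_le_0_iff)
  define k where "k = nat \<lfloor>Re (\<beta> d) / a\<rfloor>"
  have k: "of_nat k \<le> Re (\<beta> d) / a" "Re (\<beta> d) / a < of_nat k + 1"
    using pos a by (simp_all add: k_def)
  then have "of_nat k < real_of_int n"
    using lt a by (meson le_less_trans pos_divide_less_eq)
  then have "k \<le> nat n"
    by linarith
  then obtain f where f: "f \<in> I" "b f = shift \<beta> (- int k)"
    using no_gap[OF j(1), of "nat n" k] n n0 j by auto
  have "0 \<le> Re (\<beta> d) - of_nat k * a" "Re (\<beta> d) - of_nat k * a \<le> a"
    using k a by (simp_all add: field_simps)
  then have "f \<in> near_zero"
    using f Re_shift[of \<beta> "- int k"] by (simp add: near_zero_def a_def)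
  moreover have "\<beta> = shift (b f) (int k)"
    by (simp add: f)
  ultimately have "\<beta> \<in> strings"
    unfolding strings_def by blast
  then show "\<beta> \<in> b ` window"
    using j pos positive_index[of j] by (auto simp: window_def)
qed

lemma refl_0: "refl 0 = 0"
  by (simp add: refl_def fun_eq_iff)

lemma finite_crossing: "finite crossing"
  using crossing_window finite_window finite_surj by blast

text \<open>The weights of the window that do not cross are permuted by the reflection, which negates their \<open>h\<close>-value.\<close>

lemma sum_crossing:
  "(\<Sum>\<beta>\<in>crossing. of_nat (weight_mult K M \<beta>) * \<beta> h) = (\<Sum>j\<in>window. b j h)"
proof -
  define P where "P = {\<beta> \<in> b ` window. 0 < Re (\<beta> d)}"
  let ?t = "\<lambda>\<beta>. of_nat (weight_mult K M \<beta>) * \<beta> h"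
  have "(\<Sum>j\<in>window. b j h) = (\<Sum>\<beta>\<in>b ` window. \<Sum>j\<in>{j \<in> window. b j = \<beta>}. b j h)"
    by (rule sum.image_gen[OF finite_window])
  also have "\<dots> = (\<Sum>\<beta>\<in>b ` window. if 0 < Re (\<beta> d) then ?t \<beta> else 0)"
  proof (rule sum.cong[OF HOL.refl])
    fix \<beta> assume "\<beta> \<in> b ` window"
    then obtain i where i: "i \<in> I" "0 < i" "b i = \<beta>" "\<beta> \<in> strings"
      by (auto simp: window_def)
    show "(\<Sum>j\<in>{j \<in> window. b j = \<beta>}. b j h) = (if 0 < Re (\<beta> d) then ?t \<beta> else 0)"
    proof (cases "0 < Re (\<beta> d)")
      case True
      \<comment> \<open>All indices of a weight of positive degree are positive, so the window
        contains the whole level and the count is the full multiplicity.\<close>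
      then have "{j \<in> window. b j = \<beta>} = {j \<in> I. b j = \<beta>}"
        using i positive_index by (auto simp: window_def)
      then show ?thesis
        using True weight_mult_eq[of \<beta>] dual[OF i(1)] i(3) by simp
    next
      case False
      \<comment> \<open>Degree 0 at a positive index means weight 0, which contributes nothing at
        \<open>h\<close>.\<close>
      then have "\<beta> = 0"
        using b_d_nonneg[OF i(1,2)] b_d_eq_0[OF i(1)] i(3) by force
      then show ?thesis by simp
    qed
  qed
  also have "\<dots> = (\<Sum>\<beta>\<in>P. ?t \<beta>)"
    using finite_window by (simp add: P_def sum.If_cases Int_def)
  also have "\<dots> = (\<Sum>\<beta>\<in>crossing. ?t \<beta>) + (\<Sum>\<beta>\<in>P - crossing. ?t \<beta>)"
    using finite_window crossing_window
    by (subst sum.subset_diff[of crossing]) (auto simp: P_def crossing_def)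
  also have "(\<Sum>\<beta>\<in>P - crossing. ?t \<beta>) = 0"
  proof -
    have maps: "refl \<beta> \<in> P - crossing" if \<beta>: "\<beta> \<in> P - crossing" for \<beta>
    proof -
      obtain j where j: "j \<in> window" "\<beta> = b j" and pos: "0 < Re (\<beta> d)"
        using \<beta> by (auto simp: P_def)
      have jI: "j \<in> I" "b j \<in> strings"
        using j by (auto simp: window_def)
      have w: "\<beta> \<in> weights K M"
        using jI j by (simp add: weights_eq)
      obtain i where i: "i \<in> I" "refl \<beta> = b i"
        using refl_weights[OF w] by (auto simp: weights_eq)
      have "Re (refl \<beta> d) \<noteq> 0"
      proof
        assume "Re (refl \<beta> d) = 0"
        then have "refl \<beta> = 0"
          using b_d_eq_0[OF i(1)] i(2) by simp
        then have "\<beta> = 0"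
          using refl_refl[of \<beta>] by (metis refl_0)
        then show False
          using pos by simp
      qed
      moreover have "\<not> Re (refl \<beta> d) < 0"
        using \<beta> w pos by (auto simp: crossing_def)
      ultimately have "0 < Re (refl \<beta> d)"
        by simp
      then show ?thesis
        using i positive_index[OF i(1)] refl_strings[OF jI] j(2) pos refl_refl[of "b j"]
        by (auto simp: P_def crossing_def window_def)
    qed
    have "(\<Sum>\<beta>\<in>P - crossing. ?t \<beta>) = (\<Sum>\<beta>\<in>P - crossing. ?t (refl \<beta>))"
      by (rule sum.reindex_bij_witness[of _ refl refl]) (use maps refl_refl in auto)
    also have "\<dots> = (\<Sum>\<beta>\<in>P - crossing. - ?t \<beta>)"
    proof (rule sum.cong[OF HOL.refl])
      fix \<beta> assume "\<beta> \<in> P - crossing"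
      then have "\<beta> \<in> dual_space (lscale K) (cartan K)"
        using dual by (auto simp: P_def window_def)
      then show "?t (refl \<beta>) = - ?t \<beta>"
        by (simp add: weight_mult_refl refl_h)
    qed
    finally show ?thesis
      by (simp add: sum_negf)
  qed
  finally show ?thesis
    by simp
qed

end

section \<open>Chevalley generators\<close>

lemma kac_moody_on_relation:
  assumes "kac_moody_on K S H" "km_rel K H s t"
    and "set_lie_term s \<subseteq> range XPos \<union> range XNeg \<union> Cart ` H"
    and "set_lie_term t \<subseteq> range XPos \<union> range XNeg \<union> Cart ` H"
  shows "lie_eval K (km_gen_val K) s = lie_eval K (km_gen_val K) t"
  using assms lie_cong.rel[of "km_rel K H" s t] by (auto simp: kac_moody_on_def presented_by_def)

lemma kac_moody_on_relations:
  assumes "lie_algebra K" and K: "kac_moody_on K S H"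
  shows "x \<in> H \<Longrightarrow> lbracket K x (xpos K i) = lscale K (sroot K i x) (xpos K i)"
    and "x \<in> H \<Longrightarrow> lbracket K x (xneg K i) = lscale K (- sroot K i x) (xneg K i)"
    and "lbracket K (xpos K i) (xneg K i) = coroot K i"
    and "coroot K i \<in> H"
    and "xpos K i \<in> S" and "xneg K i \<in> S"
    and "sroot K i (coroot K i) = 2"
    and "0 \<in> H"
proof -
  show coroot: "coroot K i \<in> H" for i
    using K by (auto simp: kac_moody_on_def realization_def)
  show "lbracket K x (xpos K i) = lscale K (sroot K i x) (xpos K i)" if "x \<in> H"
    using kac_moody_on_relation[OF K km_rel.cart_pos[OF that]] that by simp
  show "lbracket K x (xneg K i) = lscale K (- sroot K i x) (xneg K i)" if "x \<in> H"
    using kac_moody_on_relation[OF K km_rel.cart_neg[OF that]] that by simp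
  show "lbracket K (xpos K i) (xneg K i) = coroot K i"
    using kac_moody_on_relation[OF K km_rel.pos_neg[of K H i i]] coroot by simp
  have S: "S = lie_eval K (km_gen_val K) ` {t. set_lie_term t \<subseteq> range XPos \<union> range XNeg \<union> Cart ` H}"
    using K by (simp add: kac_moody_on_def presented_by_def)
  show "xpos K i \<in> S"
    unfolding S by (rule image_eqI[where x = "Gen (XPos i)"]) auto
  show "xneg K i \<in> S"
    unfolding S by (rule image_eqI[where x = "Gen (XNeg i)"]) auto
  show "sroot K i (coroot K i) = 2"
    using K by (simp add: kac_moody_on_def realization_def generalized_cartan_matrix_def)
  interpret vector_space "lscale K"
    using assms(1) by (simp add: lie_algebra_def)
  show "0 \<in> H"
    using K subspace_0 by (simp add: kac_moody_on_def realization_def)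
qed

locale augmented =
  fixes K :: "('g::ab_group_add, 'n::finite) km_data" and d :: 'g
  assumes augmented_km: "augmented_km K d"
begin

lemma lie: "lie_algebra K"
  and sroot_dual: "sroot K i \<in> dual_space (lscale K) (cartan K)"
  using augmented_km by (auto simp: augmented_km_def)

sublocale lie: vector_space "lscale K"
  using lie by (simp add: lie_algebra_def)

lemma bracket_add: "lbracket K (x + y) z = lbracket K x z + lbracket K y z"
  and bracket_scale: "lbracket K (lscale K c x) z = lscale K c (lbracket K x z)"
  and bracket_scale_right: "lbracket K x (lscale K c z) = lscale K c (lbracket K x z)"
  using lie by (auto simp: lie_algebra_def)

lemma bracket_0: "lbracket K 0 x = 0" "lbracket K x 0 = 0"
  using bracket_scale[of 0 0 x] bracket_scale_right[of x 0 0] by simp_all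

lemma sroot_linear:
  "x \<in> cartan K \<Longrightarrow> y \<in> cartan K \<Longrightarrow> sroot K i (x + y) = sroot K i x + sroot K i y"
  "x \<in> cartan K \<Longrightarrow> sroot K i (lscale K c x) = c * sroot K i x"
  using sroot_dual[of i] by (auto simp: dual_space_def linear_functional_on_def)

lemma root_comb_indicator: "root_comb K (\<lambda>j. if j = i then 1 else 0) = sroot K i"
  by (simp add: root_comb_def fun_eq_iff if_distrib[of of_nat] if_distrib[of "\<lambda>c. c * _"] cong: if_cong)

text \<open>Both alternatives of \<open>augmented_km\<close> yield the same relations for the full
  Cartan subalgebra. In the second one \<open>d\<close> lies outside the Kac-Moody ideal and its
  action is prescribed on root vectors only, so the generators must first be recognized as root
  vectors for simple roots.\<close>

lemma chevalley:
  shows d_cartan: "d \<in> cartan K"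
    and coroot_cartan: "coroot K i \<in> cartan K"
    and bracket_xpos: "x \<in> cartan K \<Longrightarrow> lbracket K x (xpos K i) = lscale K (sroot K i x) (xpos K i)"
    and bracket_xneg: "x \<in> cartan K \<Longrightarrow> lbracket K x (xneg K i) = lscale K (- sroot K i x) (xneg K i)"
    and bracket_xpos_xneg: "lbracket K (xpos K i) (xneg K i) = coroot K i"
    and sroot_coroot: "sroot K i (coroot K i) = 2"
    and sroot_d: "positive_integer (sroot K i d)"
proof -
  let ?P = "d \<in> cartan K \<and> coroot K i \<in> cartan K \<and>
    (\<forall>x\<in>cartan K. lbracket K x (xpos K i) = lscale K (sroot K i x) (xpos K i) \<and>
       lbracket K x (xneg K i) = lscale K (- sroot K i x) (xneg K i)) \<and>
    lbracket K (xpos K i) (xneg K i) = coroot K i \<and> sroot K i (coroot K i) = 2 \<and>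
    positive_integer (sroot K i d)"
  consider "kac_moody_on K UNIV (cartan K)" "d \<in> cartan K" "\<forall>i. positive_integer (sroot K i d)"
    | S H where "kac_moody_on K S H" "cartan K = {x + lscale K c d |x c. x \<in> H}"
       "\<forall>k. (\<exists>i. k i \<noteq> 0) \<longrightarrow>
            (\<forall>x\<in>root_space K S H (root_comb K k). x \<noteq> 0 \<longrightarrow>
               positive_integer (root_comb K k d) \<and>
               lbracket K d x = lscale K (root_comb K k d) x) \<and>
            (\<forall>x\<in>root_space K S H (- root_comb K k). x \<noteq> 0 \<longrightarrow>
               positive_integer (root_comb K k d) \<and>
               lbracket K d x = lscale K (- root_comb K k d) x)"
    using augmented_km by (auto simp: augmented_km_def)
  then have ?P
  proof cases
    case 1
    then show ?thesis
      using kac_moody_on_relations[OF lie 1(1)] by auto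
  next
    case 2
    note rel = kac_moody_on_relations[OF lie 2(1)]
    have "x + lscale K 0 d \<in> cartan K" if "x \<in> H" for x
      using that unfolding 2(2) by blast
    then have H: "x \<in> cartan K" if "x \<in> H" for x
      using that by simp
    have "0 + lscale K 1 d \<in> cartan K"
      using rel(8) unfolding 2(2) by blast
    then have d: "d \<in> cartan K"
      by simp
    let ?k = "\<lambda>j. if j = i then 1 else (0::nat)"
    have k: "\<exists>j. ?k j \<noteq> 0" by auto
    have mem: "xpos K i \<in> root_space K S H (sroot K i)" "xneg K i \<in> root_space K S H (- sroot K i)"
      using rel by (auto simp: root_space_def)
    have nz: "sroot K i 0 = 0"
      using sroot_linear(2)[OF d, of i 0] by simp
    \<comment> \<open>If it were 0, so would be the coroot, which contradicts the value 2 of the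
      simple root there. Only for nonzero root vectors does the hypothesis speak about
      \<open>d\<close>.\<close>
    have pos: "xpos K i \<noteq> 0"
      using rel(3)[of i] rel(7)[of i] bracket_0 nz by auto
    have pn: "positive_integer (sroot K i d)" "lbracket K d (xpos K i) = lscale K (sroot K i d) (xpos K i)"
      using spec[OF 2(3), of ?k] k mem(1) pos unfolding root_comb_indicator by blast+
    have neg: "lbracket K d (xneg K i) = lscale K (- sroot K i d) (xneg K i)"
      using spec[OF 2(3), of ?k] k mem(2) bracket_0 unfolding root_comb_indicator
      by (cases "xneg K i = 0") auto
    have "lbracket K x (xpos K i) = lscale K (sroot K i x) (xpos K i) \<and>
       lbracket K x (xneg K i) = lscale K (- sroot K i x) (xneg K i)" if x: "x \<in> cartan K" for x
    proof -
      obtain y c where y: "y \<in> H" "x = y + lscale K c d"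
        using x unfolding 2(2) by blast
      have cd: "lscale K c d \<in> cartan K"
        using rel(8) unfolding 2(2) by force
      show ?thesis
        using y H[OF y(1)] d cd rel(1,2)[OF y(1), of i] pn(2) neg
        by (simp add: bracket_add bracket_scale sroot_linear lie.scale_left_distrib lie.scale_left_diff_distrib)
    qed
    then show ?thesis
      using d H rel pn(1) by blast
  qed
  then show "d \<in> cartan K" "coroot K i \<in> cartan K"
    "x \<in> cartan K \<Longrightarrow> lbracket K x (xpos K i) = lscale K (sroot K i x) (xpos K i)"
    "x \<in> cartan K \<Longrightarrow> lbracket K x (xneg K i) = lscale K (- sroot K i x) (xneg K i)"
    "lbracket K (xpos K i) (xneg K i) = coroot K i" "sroot K i (coroot K i) = 2"
    "positive_integer (sroot K i d)"
    by auto
qed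

lemma sroot_nonzero: "sroot K i \<noteq> 0"
  using sroot_coroot[of i] by force

text \<open>On \<open>root_part K\<close> the functional \<open>\<psi>\<close> vanishes, so the
  lifts of the Chevalley generators carry no central scalar.\<close>

lemma chevalley_root_part: "xpos K i \<in> root_part K" "xneg K i \<in> root_part K"
proof -
  have "xpos K i \<in> root_space K UNIV (cartan K) (sroot K i)"
    "xneg K i \<in> root_space K UNIV (cartan K) (- sroot K i)"
    using bracket_xpos bracket_xneg by (auto simp: root_space_def)
  then show "xpos K i \<in> root_part K" "xneg K i \<in> root_part K"
    using sroot_dual[of i] dual_space_uminus[OF sroot_dual[of i]] sroot_nonzero[of i]
    unfolding root_part_def by (auto intro!: lie.span_base)
qed

end

section \<open>Clifford operators on spinors\<close>

lemma lookup_spin_scale [simp]: "Poly_Mapping.lookup (spin_scale c v) J = c * Poly_Mapping.lookup v J"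
  by (simp add: spin_scale_def Poly_Mapping.map.rep_eq when_def)

lemma spin_scale_single [simp]: "spin_scale c (Poly_Mapping.single J x) = Poly_Mapping.single J (c * x)"
  by (rule poly_mapping_eqI) (simp add: lookup_single when_def)

interpretation spin: vector_space spin_scale
  by unfold_locales (auto intro!: poly_mapping_eqI simp: lookup_add algebra_simps)

definition spin_sets :: "int set \<Rightarrow> int set set" where
  "spin_sets I = {J. finite J \<and> J \<subseteq> {i \<in> I. 0 < i}}"

abbreviation basis_spinor :: "int set \<Rightarrow> spinor" where
  "basis_spinor J \<equiv> Poly_Mapping.single J 1"

lemma basis_spinor_mem: "J \<in> spin_sets I \<Longrightarrow> Poly_Mapping.single J c \<in> spin_space I"
  by (auto simp: spin_space_def spin_sets_def)

lemma inj_basis_spinor: "inj_on basis_spinor A"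
  by (auto simp: inj_on_def dest: arg_cong[where f = Poly_Mapping.keys])

lemma independent_basis_spinor: "spin.independent (basis_spinor ` A)"
  unfolding spin.independent_explicit_module
proof (intro allI impI)
  fix t u v
  assume t: "finite t" "t \<subseteq> basis_spinor ` A" and 0: "(\<Sum>w\<in>t. spin_scale (u w) w) = 0" and v: "v \<in> t"
  obtain J where J: "v = basis_spinor J"
    using t v by blast
  have "0 = Poly_Mapping.lookup (\<Sum>w\<in>t. spin_scale (u w) w) J"
    using 0 by simp
  also have "\<dots> = (\<Sum>w\<in>t. u w * Poly_Mapping.lookup w J)"
    by (simp add: lookup_sum)
  also have "\<dots> = (\<Sum>w\<in>t. if w = v then u v else 0)"
    using t(2) J by (intro sum.cong HOL.refl) (auto simp: lookup_single when_def split: if_splits)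
  also have "\<dots> = u v"
    using t v by simp
  finally show "u v = 0" by simp
qed

lemma subspace_spin_space: "spin.subspace (spin_space I)"
proof (rule spin.subspaceI)
  show "x + y \<in> spin_space I" if "x \<in> spin_space I" "y \<in> spin_space I" for x y
    using that Poly_Mapping.keys_add[of x y] unfolding spin_space_def by blast
  show "spin_scale c x \<in> spin_space I" if "x \<in> spin_space I" for c x
    using that by (simp add: spin_space_def in_keys_iff)
qed (simp add: spin_space_def)

lemma span_basis_spinor: "spin.span (basis_spinor ` spin_sets I) = spin_space I"
proof
  show "spin.span (basis_spinor ` spin_sets I) \<subseteq> spin_space I"
    by (intro spin.span_minimal subspace_spin_space) (auto intro: basis_spinor_mem)
  show "spin_space I \<subseteq> spin.span (basis_spinor ` spin_sets I)"
  proof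
    fix v assume v: "v \<in> spin_space I"
    have "v = (\<Sum>J\<in>Poly_Mapping.keys v. spin_scale (Poly_Mapping.lookup v J) (basis_spinor J))"
      by (rule poly_mapping_eqI) (auto simp: lookup_sum lookup_single when_def in_keys_iff)
    also have "\<dots> \<in> spin.span (basis_spinor ` spin_sets I)"
      using v by (intro spin.span_sum spin.span_scale spin.span_base) (auto simp: spin_space_def spin_sets_def)
    finally show "v \<in> spin.span (basis_spinor ` spin_sets I)" .
  qed
qed

lemma clifford_single [simp]: "clifford i (Poly_Mapping.single J c) = spin_scale c (clifford_basis i J)"
  by (cases "c = 0") (auto simp: clifford_def intro!: poly_mapping_eqI)

section \<open>The operators \<open>spin_phi\<close> on basis spinors\<close>

definition phi_term :: "(int \<Rightarrow> int \<Rightarrow> complex) \<Rightarrow> int set \<Rightarrow> int \<times> int \<Rightarrow> spinor" where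
  "phi_term A J = (\<lambda>(i, j). if - j < i
     then spin_scale (- (1/2) * A i j) (clifford j (clifford (- i) (basis_spinor J))) else 0)"

lemma spin_phi_eq_Sum_any: "spin_phi A (basis_spinor J) = Sum_any (phi_term A J)"
  by (simp add: spin_phi_def phi_term_def)

lemma clifford_0 [simp]: "clifford i 0 = 0"
  by (simp add: clifford_def)

lemma spin_scale_0 [simp]: "spin_scale 0 v = 0" "spin_scale c 0 = 0"
  by (auto intro!: poly_mapping_eqI)

text \<open>Columns are finite by definition, and antisymmetry maps row \<open>i\<close> to column
  \<open>- i\<close>.\<close>

lemma so_matrices_finite_row:
  assumes "A \<in> so_matrices I"
  shows "finite {j. A i j \<noteq> 0}"
proof -
  have "{j. A i j \<noteq> 0} = uminus ` {j. A j (- i) \<noteq> 0}"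
  proof (intro set_eqI iffI)
    fix j assume "j \<in> {j. A i j \<noteq> 0}"
    moreover have "A i j = - A (- j) (- i)"
      using assms unfolding so_matrices_def by blast
    ultimately show "j \<in> uminus ` {j. A j (- i) \<noteq> 0}"
      by (intro image_eqI[of _ _ "- j"]) auto
  next
    fix j assume "j \<in> uminus ` {j. A j (- i) \<noteq> 0}"
    moreover have "A i j = - A (- j) (- i)"
      using assms unfolding so_matrices_def by blast
    ultimately show "j \<in> {j. A i j \<noteq> 0}"
      by auto
  qed
  moreover have "finite {j. A j (- i) \<noteq> 0}"
    using assms unfolding so_matrices_def by blast
  ultimately show ?thesis
    by simp
qed

text \<open>For \<open>i > 0\<close> the first factor annihilates unless \<open>i \<in> J\<close>,
  and for \<open>i = 0\<close> there is a single row, so finitely many finite rows are left. For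
  \<open>i < 0\<close> the condition \<open>- j < i\<close> makes \<open>j\<close> positive, and the
  entry lies in a block of \<open>A\<close> with finitely many nonzero entries.\<close>

lemma phi_term_finite_support:
  assumes A: "A \<in> so_matrices I" and J: "J \<in> spin_sets I"
  shows "finite {p. phi_term A J p \<noteq> 0}"
proof (rule finite_subset)
  let ?neg = "{(i, j). 0 < i \<and> 0 < j \<and> A (- i) j \<noteq> 0}"
  let ?S = "(\<Union>i\<in>insert 0 J. Pair i ` {j. A i j \<noteq> 0}) \<union> (\<lambda>(i, j). (- i, j)) ` ?neg"
  have "finite ?neg"
    using A unfolding so_matrices_def by blast
  then show "finite ?S"
    using J so_matrices_finite_row[OF A] by (auto simp: spin_sets_def)
  show "{p. phi_term A J p \<noteq> 0} \<subseteq> ?S"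
  proof safe
    fix i j assume nz: "phi_term A J (i, j) \<noteq> 0" and neg: "(i, j) \<notin> (\<lambda>(i, j). (- i, j)) ` ?neg"
    have lt: "- j < i" and A: "A i j \<noteq> 0" and "clifford (- i) (basis_spinor J) \<noteq> 0"
      using nz by (auto simp: phi_term_def split: if_splits)
    then have cb: "clifford_basis (- i) J \<noteq> 0"
      by auto
    have "i \<in> insert 0 J"
    proof (rule ccontr)
      assume i: "i \<notin> insert 0 J"
      then have "i < 0"
        using cb by (cases "0 < i") (auto simp: clifford_basis_def)
      then have "(i, j) \<in> (\<lambda>(i, j). (- i, j)) ` ?neg"
        using lt A by (intro image_eqI[of _ _ "(- i, j)"]) auto
      then show False
        using neg by blast
    qed
    then show "(i, j) \<in> (\<Union>i\<in>insert 0 J. Pair i ` {j. A i j \<noteq> 0})"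
      using A by blast
  qed
qed

lemma lookup_spin_phi:
  assumes A: "A \<in> so_matrices I" "J \<in> spin_sets I"
    and S: "finite S" "\<And>p. Poly_Mapping.lookup (phi_term A J p) L \<noteq> 0 \<Longrightarrow> p \<in> S"
  shows "Poly_Mapping.lookup (spin_phi A (basis_spinor J)) L = (\<Sum>p\<in>S. Poly_Mapping.lookup (phi_term A J p) L)"
proof -
  have fin: "finite {p. phi_term A J p \<noteq> 0}"
    using phi_term_finite_support[OF A] .
  have "Poly_Mapping.lookup (spin_phi A (basis_spinor J)) L =
      (\<Sum>p\<in>{p. phi_term A J p \<noteq> 0}. Poly_Mapping.lookup (phi_term A J p) L)"
    using fin by (simp add: spin_phi_eq_Sum_any Sum_any.expand_set lookup_sum)
  also have "\<dots> = (\<Sum>p\<in>S. Poly_Mapping.lookup (phi_term A J p) L)"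
    using fin S by (intro sum.mono_neutral_cong) auto
  finally show ?thesis .
qed

text \<open>The signs of removing and reinserting \<open>i\<close> coincide and multiply to 1; the 2
  is that of the Clifford relation. The operator is twice the occupation number of
  \<open>i\<close>.\<close>

lemma annihilate_create: "finite J \<Longrightarrow> 0 < i \<Longrightarrow> clifford i (clifford (- i) (basis_spinor J)) =
  (if i \<in> J then Poly_Mapping.single J 2 else 0)"
proof -
  have "insert i J = J" "{j \<in> J - {i}. i < j} = {j \<in> J. i < j}" if "i \<in> J"
    using that by auto
  then show ?thesis if "finite J" "0 < i"
    using that by (auto simp: clifford_basis_def insert_Diff mult.assoc)
qed

text \<open>The condition \<open>- j < i\<close> keeps only positive diagonal positions, and the
  factor -1/2 cancels the 2 of the occupation number operator, leaving \<open>- A j j\<close> for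
  each occupied \<open>j\<close>.\<close>

lemma spin_phi_diagonal:
  assumes A: "A \<in> so_matrices I" "J \<in> spin_sets I" and diag: "\<And>i j. A i j \<noteq> 0 \<Longrightarrow> i = j"
  shows "spin_phi A (basis_spinor J) = Poly_Mapping.single J (- (\<Sum>j\<in>J. A j j))"
proof (rule poly_mapping_eqI)
  fix L
  have J: "finite J" "\<And>j. j \<in> J \<Longrightarrow> 0 < j"
    using A(2) by (auto simp: spin_sets_def)
  have mem: "p \<in> (\<lambda>j. (j, j)) ` J" if "Poly_Mapping.lookup (phi_term A J p) L \<noteq> 0" for p
  proof -
    obtain i j where p: "p = (i, j)" by force
    have nz: "phi_term A J (i, j) \<noteq> 0"
      using that p by force
    then have "A i j \<noteq> 0" "- j < i"
      by (auto simp: phi_term_def split: if_splits)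
    then have ij: "j = i" "0 < i"
      using diag[of i j] by auto
    have "i \<in> J"
      using nz ij annihilate_create[OF J(1) ij(2)] by (simp add: phi_term_def split: if_splits del: clifford_single)
    then show ?thesis
      using p ij by blast
  qed
  have "Poly_Mapping.lookup (spin_phi A (basis_spinor J)) L =
      (\<Sum>p\<in>(\<lambda>j. (j, j)) ` J. Poly_Mapping.lookup (phi_term A J p) L)"
    by (rule lookup_spin_phi[OF A]) (use J mem in auto)
  also have "\<dots> = (\<Sum>j\<in>J. Poly_Mapping.lookup (phi_term A J (j, j)) L)"
    by (simp add: sum.reindex inj_on_def)
  also have "\<dots> = (\<Sum>j\<in>J. - A j j * (1 when J = L))"
    using J annihilate_create[OF J(1)]
    by (intro sum.cong) (auto simp: phi_term_def lookup_single when_def simp del: clifford_single)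
  also have "\<dots> = Poly_Mapping.lookup (Poly_Mapping.single J (- (\<Sum>j\<in>J. A j j))) L"
    by (simp add: lookup_single when_def sum_negf)
  finally show "Poly_Mapping.lookup (spin_phi A (basis_spinor J)) L =
    Poly_Mapping.lookup (Poly_Mapping.single J (- (\<Sum>j\<in>J. A j j))) L" .
qed

text \<open>The indices occupied after \<open>clifford j\<close> and \<open>clifford (- i)\<close>
  have acted on the vacuum, for \<open>i \<le> 0\<close>. The operator \<open>clifford 0\<close>
  fixes the vacuum, so \<open>i = 0\<close> leaves only \<open>j\<close>.\<close>

definition pair_set :: "int \<Rightarrow> int \<Rightarrow> int set" where
  "pair_set i j = (if i = 0 then {j} else {j, - i})"

text \<open>For \<open>i > 0\<close> the vacuum is annihilated. Otherwise \<open>j\<close> is larger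
  than the index \<open>- i\<close> created before it, so no sign arises.\<close>

lemma clifford_vacuum:
  assumes "- j < i"
  shows "clifford j (clifford (- i) (basis_spinor {})) = (if i \<le> 0 then basis_spinor (pair_set i j) else 0)"
  using assms by (auto simp: clifford_basis_def pair_set_def Collect_conv_if)

lemma single_eq_0: "Poly_Mapping.single k v = 0 \<longleftrightarrow> v = 0"
  by (metis lookup_single_eq lookup_zero single_zero)

lemma spin_phi_vacuum:
  assumes A: "A \<in> so_matrices I"
  shows "finite {(i, j). i \<le> 0 \<and> - j < i \<and> A i j \<noteq> 0}"
    and "spin_phi A (basis_spinor {}) =
      (\<Sum>(i, j)\<in>{(i, j). i \<le> 0 \<and> - j < i \<and> A i j \<noteq> 0}. Poly_Mapping.single (pair_set i j) (- (1/2) * A i j))"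
proof -
  let ?T = "{(i, j). i \<le> 0 \<and> - j < i \<and> A i j \<noteq> 0}"
  have "{} \<in> spin_sets I"
    by (simp add: spin_sets_def)
  then have fin: "finite {p. phi_term A {} p \<noteq> 0}"
    using phi_term_finite_support[OF A] by blast
  have eq: "phi_term A {} (i, j) = (if i \<le> 0 \<and> - j < i then Poly_Mapping.single (pair_set i j) (- (1/2) * A i j) else 0)"
    for i j
    using clifford_vacuum[of j i] by (simp add: phi_term_def del: clifford_single)
  have "{p. phi_term A {} p \<noteq> 0} = ?T"
    by (auto simp: eq single_eq_0 split: if_splits)
  then show "finite ?T" and "spin_phi A (basis_spinor {}) =
      (\<Sum>(i, j)\<in>?T. Poly_Mapping.single (pair_set i j) (- (1/2) * A i j))"
    using fin by (auto simp: spin_phi_eq_Sum_any Sum_any.expand_set eq intro!: sum.cong)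
qed

lemma lookup_single_eq_0: "Poly_Mapping.lookup (Poly_Mapping.single k v) l = 0 \<longleftrightarrow> k \<noteq> l \<or> v = 0"
  by (simp add: lookup_single when_def)

text \<open>To return to the vacuum, all occupied indices must be removed, so \<open>p\<close> and
  \<open>- q\<close> exhaust the pair. Of the two possible orders, \<open>- q < p\<close> and
  \<open>- i < j\<close> admit only \<open>p = j\<close> and \<open>q = i\<close>.\<close>

lemma lookup_phi_term_pair_set:
  assumes ij: "i \<le> 0" "- j < i" and nz: "Poly_Mapping.lookup (phi_term A (pair_set i j) (p, q)) {} \<noteq> 0"
  shows "p = j \<and> q = i"
proof -
  let ?K = "pair_set i j"
  have lt: "- q < p" and nz': "Poly_Mapping.lookup (clifford q (clifford_basis (- p) ?K)) {} \<noteq> 0"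
    using nz by (auto simp: phi_term_def split: if_splits)
  \<comment> \<open>A creation operator applied last would leave its own index occupied.\<close>
  have q: "q \<le> 0"
  proof (rule ccontr)
    assume "\<not> q \<le> 0"
    then have "Poly_Mapping.lookup (clifford_basis q L) {} = 0" for L
      by (simp add: clifford_basis_def lookup_single)
    then show False
      using nz' by (auto simp: clifford_basis_def[of "- p"] split: if_splits)
  qed
  then have p: "0 < p"
    using lt by simp
  have pK: "p \<in> ?K"
    using nz' p by (auto simp: clifford_basis_def[of "- p"] split: if_splits)
  have nz1: "Poly_Mapping.lookup (clifford_basis q (?K - {p})) {} \<noteq> 0"
    using nz' p pK by (auto simp: clifford_basis_def[of "- p"] split: if_splits)
  then consider "q = 0" "?K - {p} = {}" | "q < 0" "?K - {p} - {- q} = {}" "- q \<in> ?K - {p}"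
  proof (cases "q = 0")
    case True
    then show ?thesis
      using nz1 that(1) by (auto simp: clifford_basis_def lookup_single_eq_0 split: if_splits)
  next
    case False
    then show ?thesis
      using q nz1 that(2) by (simp add: clifford_basis_def lookup_single_eq_0 split: if_splits)
  qed
  then show ?thesis
  proof cases
    case 1
    then show ?thesis
      using ij pK by (simp add: pair_set_def split: if_splits)
  next
    case 2
    then have "?K \<noteq> {j}"
      using pK by auto
    then have K: "?K = {j, - i}"
      by (simp add: pair_set_def split: if_splits)
    have "p \<in> {j, - i}" "- q \<in> {j, - i}" "p \<noteq> - q"
      using 2 pK K by auto
    then show ?thesis
      using ij lt by auto
  qed
qed

text \<open>Each annihilation contributes 2 and the larger index \<open>j\<close> is removed first,
  without sign. With the factor -1/2 this gives -2 for two annihilations, and -1 for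
  \<open>i = 0\<close>, where the second factor is \<open>clifford 0\<close>.\<close>

lemma lookup_spin_phi_pair_set:
  assumes A: "A \<in> so_matrices I" and ij: "i \<le> 0" "- j < i" "i = 0 \<or> - i \<in> I" "j \<in> I"
  shows "Poly_Mapping.lookup (spin_phi A (basis_spinor (pair_set i j))) {} = - (if i = 0 then 1 else 2) * A j i"
proof -
  have "pair_set i j \<in> spin_sets I"
    using ij by (auto simp: pair_set_def spin_sets_def)
  then have "Poly_Mapping.lookup (spin_phi A (basis_spinor (pair_set i j))) {} =
      (\<Sum>p\<in>{(j, i)}. Poly_Mapping.lookup (phi_term A (pair_set i j) p) {})"
    using lookup_phi_term_pair_set[OF ij(1,2)] by (intro lookup_spin_phi[OF A]) auto
  also have "\<dots> = - (if i = 0 then 1 else 2) * A j i"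
  proof (cases "i = 0")
    case True
    then show ?thesis
      using ij by (simp add: phi_term_def pair_set_def clifford_basis_def Collect_conv_if)
  next
    case False
    have none: "(k = j \<or> k = - i) \<and> j < k \<longleftrightarrow> False" for k
      using ij by auto
    have "{j, - i} - {j} = {- i}"
      using ij by auto
    then show ?thesis
      using ij False by (simp add: none phi_term_def pair_set_def clifford_basis_def Collect_conv_if)
  qed
  finally show ?thesis .
qed

section \<open>The weight of the vacuum\<close>

locale spin_module = augmented K d + weight_basis K V I e b
  for K :: "('g::ab_group_add, 'n::finite) km_data" and d :: 'g
    and V :: "('g, 'v::ab_group_add) rep"
    and I :: "int set" and e :: "int \<Rightarrow> 'v" and b :: "int \<Rightarrow> 'g \<Rightarrow> complex" +
  fixes H'' :: "'g set" and \<psi> :: "'g \<Rightarrow> complex" and \<tau> :: "'g \<Rightarrow> spinor \<Rightarrow> spinor"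
  assumes integrable: "integrable_rep K V"
    and d_fin: "d_finite K d V"
    and index: "spin_index I"
    and b_pos: "i \<in> I \<Longrightarrow> 0 < i \<Longrightarrow> 0 \<le> Re (b i d)"
    and lift: "spin_lift K V I e H'' \<psi> \<tau>"
begin

abbreviation mat where "mat \<equiv> rep_matrix V I e"

lemma mat_so: "mat x \<in> so_matrices I"
  using lift by (auto simp: spin_lift_def spin_extension_def)

lemma mat_eq: "mat x i j = (if i \<in> I \<and> j \<in> I then coeff (act V x (e j)) i else 0)"
  by (simp add: rep_matrix_def coeff_def)

lemma mat_antisym: "mat x i j = - mat x (- j) (- i)"
  using mat_so unfolding so_matrices_def by blast

lemma uminus_index: "i \<in> I \<Longrightarrow> - i \<in> I"
  using index by (auto simp: spin_index_def)

lemma mat_cartan: "x \<in> cartan K \<Longrightarrow> i \<in> I \<Longrightarrow> j \<in> I \<Longrightarrow> mat x i j = (if i = j then b i x else 0)"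
  using coeff_act_cartan[OF e_carrier] by (simp add: mat_eq coeff_e)

text \<open>Orthogonality in coordinates: the matrix of a Cartan element is diagonal with entries
  \<open>b i x\<close>, and antisymmetry relates its entries at \<open>i\<close> and
  \<open>- i\<close>.\<close>

lemma b_uminus_index:
  assumes i: "i \<in> I"
  shows "b (- i) = - b i"
proof (rule dual_space_eqI)
  show "b (- i) \<in> dual_space (lscale K) (cartan K)" "- b i \<in> dual_space (lscale K) (cartan K)"
    using i uminus_index dual dual_space_uminus by blast+
  fix x assume x: "x \<in> cartan K"
  show "b (- i) x = (- b i) x"
    using mat_antisym[of x i i] mat_cartan[OF x i i] mat_cartan[OF x, of "- i" "- i"] uminus_index[OF i]
    by simp
qed

lemma b_d_cases:
  assumes i: "i \<in> I"
  obtains k where "b i d = of_int k" "k = 0 \<Longrightarrow> b i = 0"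
proof (cases "b i = 0")
  case True
  then show ?thesis using that[of 0] by simp
next
  case False
  then have "b i d \<in> \<int>" "b i d \<noteq> 0"
    using d_fin i weights_eq by (auto simp: d_finite_def)
  then show ?thesis
    using that by (auto elim!: Ints_cases)
qed

lemma finite_d_level: "finite {i \<in> I. b i d = of_int k}"
proof -
  let ?L = "{i \<in> I. b i d = of_int k}"
  obtain B where B: "finite B" "span (\<Union>\<mu>\<in>{\<mu>\<in>weights K V. \<mu> d = of_int k}. weight_space K V \<mu>) \<subseteq> span B"
    using d_fin by (force simp: d_finite_def fin_dim_def)
  have sub: "e ` ?L \<subseteq> span (\<Union>\<mu>\<in>{\<mu>\<in>weights K V. \<mu> d = of_int k}. weight_space K V \<mu>)"
  proof -
    have "b i \<in> {\<mu>\<in>weights K V. \<mu> d = of_int k}" "e i \<in> weight_space K V (b i)" if "i \<in> ?L" for i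
      using that wt by (simp_all add: weights_eq)
    then have "e ` ?L \<subseteq> (\<Union>\<mu>\<in>{\<mu>\<in>weights K V. \<mu> d = of_int k}. weight_space K V \<mu>)"
      by blast
    then show ?thesis
      using span_superset by (rule subset_trans)
  qed
  then have "finite (e ` ?L)"
    using independent_span_bound[OF B(1) independent_level subset_trans[OF sub B(2)]] by simp
  then show ?thesis
    using inj_on_level by (rule finite_imageD)
qed

text \<open>Degrees are integers, so a bounded range meets finitely many levels, each finite by
  \<open>d\<close>-finiteness.\<close>

lemma finite_d_bounded: "finite {i \<in> I. \<bar>Re (b i d)\<bar> \<le> D}"
proof (rule finite_subset)
  show "{i \<in> I. \<bar>Re (b i d)\<bar> \<le> D} \<subseteq> (\<Union>k\<in>{- \<lceil>D\<rceil>..\<lceil>D\<rceil>}. {i \<in> I. b i d = of_int k})"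
  proof
    fix i assume i: "i \<in> {i \<in> I. \<bar>Re (b i d)\<bar> \<le> D}"
    then obtain k where "b i d = of_int k"
      using b_d_cases[of i] by blast
    moreover from this have "k \<in> {- \<lceil>D\<rceil>..\<lceil>D\<rceil>}"
      using i by auto linarith+
    ultimately show "i \<in> (\<Union>k\<in>{- \<lceil>D\<rceil>..\<lceil>D\<rceil>}. {i \<in> I. b i d = of_int k})"
      using i by blast
  qed
qed (use finite_d_level in auto)

lemma finite_weight_level: "finite {i \<in> I. b i = \<mu>}"
  by (rule finite_subset[OF _ finite_d_bounded[of "\<bar>Re (\<mu> d)\<bar>"]]) auto

lemma sl2: "orthogonal_sl2_weight_basis K V I e b (sroot K i) (coroot K i) (xpos K i) (xneg K i) d"
proof unfold_locales
  show "0 < Re (sroot K i d)"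
    using sroot_d[of i] by (auto simp: positive_integer_def)
  show "b j = 0" if "j \<in> I" "Re (b j d) = 0" for j
    by (rule b_d_cases[OF that(1)]) (use that(2) in auto)
  show "\<exists>N. (act V (xpos K i) ^^ N) v = 0" "\<exists>N. (act V (xneg K i) ^^ N) v = 0" if "v \<in> rcarrier V" for v
    using integrable that by (simp_all add: integrable_rep_def)
qed (fact sroot_dual coroot_cartan sroot_coroot bracket_xpos bracket_xneg bracket_xpos_xneg
    finite_weight_level uminus_index b_uminus_index b_pos finite_d_bounded)+

lemma crossing_weights_eq:
  "crossing_weights K d V i = orthogonal_sl2_weight_basis.crossing K V (sroot K i) (coroot K i) d"
proof -
  interpret S: orthogonal_sl2_weight_basis K V I e b "sroot K i" "coroot K i" "xpos K i" "xneg K i" d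
    by (rule sl2)
  show ?thesis
    by (auto simp: crossing_weights_def positive_weights_def S.crossing_def S.refl_def simple_reflection_def)
qed

lemma finite_crossing_weights: "finite (crossing_weights K d V i)"
  using orthogonal_sl2_weight_basis.finite_crossing[OF sl2] by (simp add: crossing_weights_eq)

lemma spin_rep: "representation_of K (spin_rep I \<tau>)"
  using lift by (simp add: spin_lift_def)

lemma \<tau>_add: "u \<in> spin_space I \<Longrightarrow> v \<in> spin_space I \<Longrightarrow> \<tau> x (u + v) = \<tau> x u + \<tau> x v"
  and \<tau>_scale: "u \<in> spin_space I \<Longrightarrow> \<tau> x (spin_scale c u) = spin_scale c (\<tau> x u)"
  and \<tau>_add_left: "u \<in> spin_space I \<Longrightarrow> \<tau> (x + y) u = \<tau> x u + \<tau> y u"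
  and \<tau>_scale_left: "u \<in> spin_space I \<Longrightarrow> \<tau> (lscale K c x) u = spin_scale c (\<tau> x u)"
  and \<tau>_bracket: "u \<in> spin_space I \<Longrightarrow> \<tau> (lbracket K x y) u = \<tau> x (\<tau> y u) - \<tau> y (\<tau> x u)"
  using spin_rep by (auto simp: representation_of_def spin_rep_def)

lemma \<tau>_0: "\<tau> x 0 = 0"
  using \<tau>_scale[of 0 x 0] spin.subspace_0[OF subspace_spin_space] by simp

lemma \<tau>_sum:
  "(\<And>a. a \<in> A \<Longrightarrow> f a \<in> spin_space I) \<Longrightarrow> \<tau> x (sum f A) = (\<Sum>a\<in>A. \<tau> x (f a))"
  by (induction A rule: infinite_finite_induct)
    (auto simp: \<tau>_0 \<tau>_add spin.subspace_sum[OF subspace_spin_space])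

text \<open>The scalar \<open>c\<close> is common to all \<open>J\<close>, so it can be determined
  at the vacuum alone.\<close>

lemma \<tau>_cartan:
  assumes x: "x \<in> cartan K"
  obtains c where "\<And>J. J \<in> spin_sets I \<Longrightarrow>
    \<tau> x (basis_spinor J) = Poly_Mapping.single J (c - (\<Sum>j\<in>J. b j x))"
proof -
  obtain c where c: "\<And>v. v \<in> spin_space I \<Longrightarrow> \<tau> x v = spin_phi (mat x) v + spin_scale c v"
  proof -
    have "spin_extension I (\<tau> x) (mat x)"
      using lift by (simp add: spin_lift_def)
    then show ?thesis
      using that unfolding spin_extension_def by blast
  qed
  have "\<tau> x (basis_spinor J) = Poly_Mapping.single J (c - (\<Sum>j\<in>J. b j x))" if J: "J \<in> spin_sets I" for J
  proof -
    have "spin_phi (mat x) (basis_spinor J) = Poly_Mapping.single J (- (\<Sum>j\<in>J. mat x j j))"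
      using mat_cartan[OF x] by (intro spin_phi_diagonal[OF mat_so J]) (auto simp: mat_eq split: if_splits)
    moreover have "(\<Sum>j\<in>J. mat x j j) = (\<Sum>j\<in>J. b j x)"
      using J mat_cartan[OF x] by (intro sum.cong) (auto simp: spin_sets_def)
    ultimately show ?thesis
      using c[OF basis_spinor_mem[OF J]] by (simp add: single_add[symmetric] algebra_simps)
  qed
  then show ?thesis
    using that by blast
qed

lemma \<tau>_root_part:
  "x \<in> root_part K \<Longrightarrow> v \<in> spin_space I \<Longrightarrow> \<tau> x v = spin_phi (mat x) v"
  using lift lie.span_base[of x "H'' \<union> root_part K"] by (auto simp: spin_lift_def)

text \<open>
  The central term at a coroot is the vacuum expectation of \<open>[\<tau> X, \<tau> Y]\<close>.  Since \<open>X\<close> raises degrees,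
  \<open>\<tau> X\<close> kills the vacuum and only \<open>\<tau> X (\<tau> Y 1)\<close> contributes.
\<close>

lemma vacuum_expectation:
  "Poly_Mapping.lookup (\<tau> (coroot K i) (basis_spinor {})) {} = spin_coeff K d V i"
proof -
  interpret S: orthogonal_sl2_weight_basis K V I e b "sroot K i" "coroot K i" "xpos K i" "xneg K i" d
    by (rule sl2)
  let ?X = "mat (xpos K i)" and ?Y = "mat (xneg K i)"
  let ?T = "{(p, q). p \<le> 0 \<and> - q < p \<and> ?Y p q \<noteq> 0}"
  have vac: "{} \<in> spin_sets I"
    by (simp add: spin_sets_def)
  have T: "finite ?T"
    by (rule spin_phi_vacuum(1)[OF mat_so])
  have pair: "pair_set p q \<in> spin_sets I" if "(p, q) \<in> ?T" for p q
    using that uminus_index[of p] by (auto simp: mat_eq pair_set_def spin_sets_def split: if_splits)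
  \<comment> \<open>Here \<open>q > - p \<ge> 0\<close>, so \<open>q\<close> has nonnegative degree;
    a nonzero entry would give \<open>p \<le> 0\<close> a positive degree.\<close>
  have X0: "?X p q = 0" if "p \<le> 0" "- q < p" for p q
  proof (rule ccontr)
    assume nz: "?X p q \<noteq> 0"
    then have pq: "p \<in> I" "q \<in> I" "b p = S.shift (b q) 1"
      using S.mX_nonzero[of q p] by (auto simp: mat_eq split: if_splits)
    then show False
      using S.b_d_nonpos[of p] b_pos[of q] that S.Re_shift[of "b q" 1] S.\<alpha>_d by auto
  qed
  \<comment> \<open>The product is unchanged under sending (p, q) to (-q, -p). This involution
    exchanges \<open>L\<close>, the part summed by \<open>spin_phi\<close>, with \<open>G\<close>;
    pairs with \<open>q = - p\<close> vanish by antisymmetry. A pair with \<open>p = 0\<close> has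
    its partner outside \<open>crossing_pairs\<close>, which explains its weight 1/2.\<close>
  have half: "(\<Sum>(p, q)\<in>?T. (if p = 0 then 1/2 else 1) * (?X q p * ?Y p q)) =
      1/2 * (\<Sum>(p, q)\<in>S.crossing_pairs. ?X q p * ?Y p q)"
  proof -
    define f where "f = (\<lambda>(p, q). ?X q p * ?Y p q)"
    define Z where "Z = {(p, q). (p, q) \<in> S.crossing_pairs \<and> p = 0}"
    define L where "L = {(p, q). (p, q) \<in> S.crossing_pairs \<and> p < 0 \<and> - q < p}"
    define G where "G = {(p, q). (p, q) \<in> S.crossing_pairs \<and> p < 0 \<and> p < - q}"
    have C: "(p, q) \<in> S.crossing_pairs \<longleftrightarrow> p \<le> 0 \<and> 0 < q \<and> f (p, q) \<noteq> 0" for p q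
      by (auto simp: S.crossing_pairs_def f_def mat_eq)
    have anti: "?Y p (- p) = 0" for p
      using mat_antisym[of "xneg K i" p "- p"] by simp
    have sym: "f (p, q) = f (- q, - p)" for p q
      using mat_antisym[of "xpos K i" q p] mat_antisym[of "xneg K i" p q] by (simp add: f_def)
    have fin: "finite Z" "finite L" "finite G"
      by (auto intro: finite_subset[OF _ S.finite_crossing_pairs] simp: Z_def L_def G_def)
    have "p = 0 \<or> p < 0 \<and> - q < p \<or> p < 0 \<and> p < - q" if "(p, q) \<in> S.crossing_pairs" for p q
    proof -
      have "q \<noteq> - p"
        using that anti[of p] by (auto simp: C f_def)
      then show ?thesis
        using that unfolding C by linarith
    qed
    then have split: "S.crossing_pairs = Z \<union> (L \<union> G)"
      unfolding Z_def L_def G_def by blast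
    have "sum f G = sum f L"
    proof (rule sum.reindex_bij_witness[of _ "\<lambda>(p, q). (- q, - p)" "\<lambda>(p, q). (- q, - p)"])
      fix z assume "z \<in> G"
      then show "(case z of (p, q) \<Rightarrow> (- q, - p)) \<in> L"
        using sym by (auto simp: G_def L_def C)
    next
      fix z assume "z \<in> L"
      then show "(case z of (p, q) \<Rightarrow> (- q, - p)) \<in> G"
        using sym by (auto simp: G_def L_def C)
    qed (use sym in auto)
    then have "sum f S.crossing_pairs = sum f Z + 2 * sum f L"
      unfolding split using fin
      by (subst sum.union_disjoint, simp, simp, force simp: Z_def L_def G_def,
          subst sum.union_disjoint) (auto simp: L_def G_def)
    moreover have "(\<Sum>(p, q)\<in>?T. (if p = 0 then 1/2 else 1) * f (p, q)) = 1/2 * sum f Z + sum f L"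
    proof -
      have "(\<Sum>(p, q)\<in>?T. (if p = 0 then 1/2 else 1) * f (p, q)) =
          (\<Sum>(p, q)\<in>Z \<union> L. (if p = 0 then 1/2 else 1) * f (p, q))"
        by (rule sum.mono_neutral_right[OF T]) (auto simp: Z_def L_def C f_def)
      also have "\<dots> = (\<Sum>(p, q)\<in>Z. (if p = 0 then 1/2 else 1) * f (p, q)) +
          (\<Sum>(p, q)\<in>L. (if p = 0 then 1/2 else 1) * f (p, q))"
        using fin by (intro sum.union_disjoint) (auto simp: Z_def L_def)
      also have "\<dots> = (\<Sum>z\<in>Z. 1/2 * f z) + sum f L"
        by (intro arg_cong2[where f = "(+)"] sum.cong) (auto simp: Z_def L_def)
      finally show ?thesis
        by (simp only: sum_distrib_left)
    qed
    ultimately show ?thesis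
      by (simp add: f_def algebra_simps)
  qed
  have "\<tau> (xpos K i) (basis_spinor {}) = spin_phi ?X (basis_spinor {})"
    by (rule \<tau>_root_part[OF chevalley_root_part(1) basis_spinor_mem[OF vac]])
  also have "\<dots> = 0"
    unfolding spin_phi_vacuum(2)[OF mat_so] by (rule sum.neutral) (use X0 in auto)
  finally have "\<tau> (coroot K i) (basis_spinor {}) = \<tau> (xpos K i) (\<tau> (xneg K i) (basis_spinor {}))"
    using \<tau>_bracket[OF basis_spinor_mem[OF vac], of "xpos K i" "xneg K i"]
    by (simp add: bracket_xpos_xneg \<tau>_0)
  also have "\<tau> (xneg K i) (basis_spinor {}) = spin_phi ?Y (basis_spinor {})"
    by (rule \<tau>_root_part[OF chevalley_root_part(2) basis_spinor_mem[OF vac]])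
  also have "\<dots> = (\<Sum>(p, q)\<in>?T. Poly_Mapping.single (pair_set p q) (- (1/2) * ?Y p q))"
    by (rule spin_phi_vacuum(2)[OF mat_so])
  also have "\<tau> (xpos K i) \<dots> = (\<Sum>(p, q)\<in>?T. spin_scale (- (1/2) * ?Y p q) (spin_phi ?X (basis_spinor (pair_set p q))))"
  proof -
    have "\<tau> (xpos K i) (Poly_Mapping.single (pair_set p q) (- (1/2) * ?Y p q)) =
        spin_scale (- (1/2) * ?Y p q) (spin_phi ?X (basis_spinor (pair_set p q)))" if "(p, q) \<in> ?T" for p q
      using \<tau>_scale[OF basis_spinor_mem[OF pair[OF that]], of "xpos K i" "- (1/2) * ?Y p q" 1]
        \<tau>_root_part[OF chevalley_root_part(1) basis_spinor_mem[OF pair[OF that]], of i]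
      by simp
    then have *: "\<tau> (xpos K i) (case z of (p, q) \<Rightarrow> Poly_Mapping.single (pair_set p q) (- (1/2) * ?Y p q)) =
        (case z of (p, q) \<Rightarrow> spin_scale (- (1/2) * ?Y p q) (spin_phi ?X (basis_spinor (pair_set p q))))"
      if "z \<in> ?T" for z
      using that by (cases z) (simp only: prod.case)
    have "(case z of (p, q) \<Rightarrow> Poly_Mapping.single (pair_set p q) (- (1/2) * ?Y p q)) \<in> spin_space I"
      if "z \<in> ?T" for z
      using that pair by (cases z) (simp only: prod.case basis_spinor_mem)
    then show ?thesis
      using * by (simp only: \<tau>_sum cong: sum.cong)
  qed
  finally have "Poly_Mapping.lookup (\<tau> (coroot K i) (basis_spinor {})) {} =
      (\<Sum>(p, q)\<in>?T. - (1/2) * ?Y p q * Poly_Mapping.lookup (spin_phi ?X (basis_spinor (pair_set p q))) {})"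
    by (simp add: lookup_sum case_prod_unfold)
  \<comment> \<open>The factor -1/2 from the lift of \<open>Y\<close> meets -1 for
    \<open>p = 0\<close> and -2 otherwise from the lift of \<open>X\<close>.\<close>
  also have "\<dots> = (\<Sum>(p, q)\<in>?T. (if p = 0 then 1/2 else 1) * (?X q p * ?Y p q))"
  proof (intro sum.cong HOL.refl)
    fix z assume "z \<in> ?T"
    then obtain p q where z: "z = (p, q)" "p \<le> 0" "- q < p" "?Y p q \<noteq> 0"
      by auto
    then have "p \<in> I" "q \<in> I"
      by (auto simp: mat_eq split: if_splits)
    then show "(case z of (p, q) \<Rightarrow> - (1/2) * ?Y p q * Poly_Mapping.lookup (spin_phi ?X (basis_spinor (pair_set p q))) {})
        = (case z of (p, q) \<Rightarrow> (if p = 0 then 1/2 else 1) * (?X q p * ?Y p q))"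
      using lookup_spin_phi_pair_set[OF mat_so z(2,3), of "xpos K i"] uminus_index[of p] z by simp
  qed
  also have "\<dots> = 1/2 * (\<Sum>(p, q)\<in>S.crossing_pairs. ?X q p * ?Y p q)"
    by (rule half)
  also have "(\<Sum>(p, q)\<in>S.crossing_pairs. ?X q p * ?Y p q) = (\<Sum>(p, q)\<in>S.crossing_pairs. S.mX q p * S.mY p q)"
    by (intro sum.cong) (auto simp: S.crossing_pairs_def mat_eq)
  also have "\<dots> = (\<Sum>\<beta>\<in>S.crossing. of_nat (weight_mult K V \<beta>) * \<beta> (coroot K i))"
    by (simp add: S.sum_crossing S.trace_window)
  also have "1/2 * \<dots> = spin_coeff K d V i"
    by (simp add: spin_coeff_def crossing_weights_eq sum_distrib_left algebra_simps)
  finally show ?thesis .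
qed

end

section \<open>Characters\<close>

lemma dim_direct_power:
  assumes vs: "vector_space sc" and S: "module.subspace sc S" and F: "finite F" "S \<subseteq> module.span sc F"
  shows "vector_space (\<lambda>c (f :: nat \<Rightarrow> 'w::ab_group_add) k. sc c (f k))"
    and "vector_space.dim (\<lambda>c f k. sc c (f k)) {f. (\<forall>k<N. f k \<in> S) \<and> (\<forall>k\<ge>N. f k = 0)} =
      N * vector_space.dim sc S"
proof -
  interpret vector_space sc by fact
  show "vector_space (\<lambda>c (f :: nat \<Rightarrow> 'w) k. sc c (f k))"
    by unfold_locales (auto simp: fun_eq_iff scale_right_distrib scale_left_distrib)
  then interpret D: vector_space "\<lambda>c (f :: nat \<Rightarrow> 'w) k. sc c (f k)" .
  let ?D = "{f. (\<forall>k<N. f k \<in> S) \<and> (\<forall>k\<ge>N. f k = 0)}"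
  obtain B where B: "B \<subseteq> S" "independent B" "S \<subseteq> span B" "card B = dim S"
    using basis_exists by blast
  have "finite B"
    using independent_span_bound[OF F(1) B(2)] B(1) F(2) by blast
  \<comment> \<open>The vector \<open>w\<close> placed in slot \<open>k\<close>; these vectors, for
    \<open>w\<close> in a basis of \<open>S\<close> and \<open>k < N\<close>, form a basis of the
    power.\<close>
  define \<delta> where "\<delta> = (\<lambda>(k :: nat, w) l. if l = k then w else (0 :: 'w))"
  have inj: "inj_on \<delta> ({..<N} \<times> B)"
  proof (rule inj_onI, clarify)
    fix k w l u assume wu: "w \<in> B" "u \<in> B" and eq: "\<delta> (k, w) = \<delta> (l, u)"
    have "w \<noteq> 0" using wu B(2) dependent_zero by blast
    then show "k = l \<and> w = u"
      using fun_cong[OF eq, of k] by (simp add: \<delta>_def split: if_splits)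
  qed
  have "D.independent (\<delta> ` ({..<N} \<times> B))"
  proof (rule D.independent_if_scalars_zero)
    show "finite (\<delta> ` ({..<N} \<times> B))"
      using \<open>finite B\<close> by simp
    fix c x assume 0: "(\<Sum>x\<in>\<delta> ` ({..<N} \<times> B). (\<lambda>l. sc (c x) (x l))) = 0" and "x \<in> \<delta> ` ({..<N} \<times> B)"
    then obtain k w where x: "x = \<delta> (k, w)" "k < N" "w \<in> B"
      by auto
    have "0 = (\<Sum>x\<in>\<delta> ` ({..<N} \<times> B). (\<lambda>l. sc (c x) (x l))) k"
      using 0 by simp
    also have "\<dots> = (\<Sum>(l, u)\<in>{..<N} \<times> B. sc (c (\<delta> (l, u))) (\<delta> (l, u) k))"
      by (simp add: sum_fun_apply sum.reindex[OF inj] case_prod_unfold)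
    also have "\<dots> = (\<Sum>u\<in>B. \<Sum>l<N. sc (c (\<delta> (l, u))) (\<delta> (l, u) k))"
      by (subst sum.swap) (simp add: sum.cartesian_product)
    also have "\<dots> = (\<Sum>u\<in>B. sc (c (\<delta> (k, u))) u)"
    proof (rule sum.cong[OF HOL.refl])
      fix u assume "u \<in> B"
      have "(\<Sum>l<N. sc (c (\<delta> (l, u))) (\<delta> (l, u) k)) = (\<Sum>l<N. if l = k then sc (c (\<delta> (k, u))) u else 0)"
        by (intro sum.cong) (auto simp: \<delta>_def)
      then show "(\<Sum>l<N. sc (c (\<delta> (l, u))) (\<delta> (l, u) k)) = sc (c (\<delta> (k, u))) u"
        using x(2) by simp
    qed
    finally show "c x = 0"
      using independentD[OF B(2) \<open>finite B\<close> subset_refl, of "\<lambda>u. c (\<delta> (k, u))" w] x by simp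
  qed
  moreover have "\<delta> ` ({..<N} \<times> B) \<subseteq> ?D"
    using B(1) subspace_0[OF S] by (auto simp: \<delta>_def)
  moreover have "?D \<subseteq> D.span (\<delta> ` ({..<N} \<times> B))"
  proof
    fix f assume f: "f \<in> ?D"
    have "f = (\<Sum>k<N. \<delta> (k, f k))"
    proof
      fix l show "f l = (\<Sum>k<N. \<delta> (k, f k)) l"
        using f by (cases "l < N") (auto simp: sum_fun_apply \<delta>_def)
    qed
    moreover have "\<delta> (k, w) \<in> D.span (\<delta> ` ({..<N} \<times> B))" if k: "k < N" and w: "w \<in> span B" for k w
      using w
    proof (induction rule: span_induct_alt)
      case base
      have 0: "\<delta> (k, 0) = 0"
        by (simp add: \<delta>_def fun_eq_iff)
      show ?case
        unfolding 0 by (rule D.span_zero)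
    next
      case (step c u w)
      have split: "\<delta> (k, sc c u + w) = (\<lambda>l. sc c (\<delta> (k, u) l)) + \<delta> (k, w)"
        by (simp add: \<delta>_def fun_eq_iff)
      have "(\<lambda>l. sc c (\<delta> (k, u) l)) \<in> D.span (\<delta> ` ({..<N} \<times> B))"
        using step(1) k by (intro D.span_scale D.span_base) auto
      then show ?case
        unfolding split using step.IH by (rule D.span_add)
    qed
    ultimately show "f \<in> D.span (\<delta> ` ({..<N} \<times> B))"
      using f B(3) D.span_sum[of "{..<N}" "\<lambda>k. \<delta> (k, f k)"] by (metis (mono_tags, lifting) lessThan_iff mem_Collect_eq subsetD)
  qed
  ultimately have "D.dim ?D = card (\<delta> ` ({..<N} \<times> B))"
    by (intro D.basis_card_eq_dim[symmetric])
  then show "D.dim ?D = N * dim S"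
    using card_image[OF inj] by (simp add: card_cartesian_product B(4))
qed

context weight_basis
begin

text \<open>The isomorphism and its inverse respect weight spaces, and the weight spaces of a direct
  power are formed slot by slot, so dimensions are multiplied by \<open>N\<close>. Slot 0, which
  exists because \<open>0 < N\<close>, transfers spanning and finite dimension to \<open>W\<close>:
  by projection for the first and by embedding for the second.\<close>

lemma direct_power_character:
  fixes W :: "('g, 'w::ab_group_add) rep"
  assumes W: "representation_of K W" and iso: "rep_isomorphic M (direct_power N W)" and N: "0 < N"
  shows "rcarrier W \<subseteq>
      module.span (rscale W) (\<Union>\<mu>\<in>dual_space (lscale K) (cartan K). weight_space K W \<mu>)"
    and "\<mu> \<in> dual_space (lscale K) (cartan K) \<Longrightarrow> finite {i \<in> I. b i = \<mu>} \<Longrightarrow>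
      fin_dim (rscale W) (weight_space K W \<mu>)"
    and "\<mu> \<in> dual_space (lscale K) (cartan K) \<Longrightarrow> finite {i \<in> I. b i = \<mu>} \<Longrightarrow>
      N * weight_mult K W \<mu> = card {i \<in> I. b i = \<mu>}"
proof -
  interpret W: vector_space "rscale W"
    using W by (simp add: representation_of_def)
  let ?D = "direct_power N W"
  have sD: "rscale ?D = (\<lambda>c f k. rscale W c (f k))"
    by (simp add: direct_power_def)
  have W_sub: "W.subspace (rcarrier W)"
    and W_act_add: "\<And>x u v. u \<in> rcarrier W \<Longrightarrow> v \<in> rcarrier W \<Longrightarrow> act W x (u + v) = act W x u + act W x v"
    and W_act_scale: "\<And>x u c. u \<in> rcarrier W \<Longrightarrow> act W x (rscale W c u) = rscale W c (act W x u)"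
    using W by (auto simp: representation_of_def)
  have W_act_0: "act W x 0 = 0" for x
    using W_act_scale[of 0 x 0] W.subspace_0[OF W_sub] by simp
  interpret D: vector_space "rscale ?D"
    unfolding sD by unfold_locales (auto simp: fun_eq_iff W.scale_right_distrib W.scale_left_distrib)
  obtain T where bij: "bij_betw T (rcarrier M) (rcarrier ?D)"
    and T_add: "\<And>u v. u \<in> rcarrier M \<Longrightarrow> v \<in> rcarrier M \<Longrightarrow> T (u + v) = T u + T v"
    and T_scale: "\<And>c u. u \<in> rcarrier M \<Longrightarrow> T (sc c u) = rscale ?D c (T u)"
    and T_act: "\<And>x u. u \<in> rcarrier M \<Longrightarrow> T (act M x u) = act ?D x (T u)"
    using iso unfolding rep_isomorphic_def by blast
  have T_mem: "T u \<in> rcarrier ?D" if "u \<in> rcarrier M" for u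
    using bij that by (auto simp: bij_betw_def)
  have T_inj: "u = v" if "T u = T v" "u \<in> rcarrier M" "v \<in> rcarrier M" for u v
    using bij that by (auto simp: bij_betw_def inj_on_eq_iff)
  define T' where "T' = inv_into (rcarrier M) T"
  have T': "T' f \<in> rcarrier M" "T (T' f) = f" if "f \<in> rcarrier ?D" for f
    using bij that by (auto simp: T'_def bij_betw_def inv_into_into f_inv_into_f)
  have D_carrier: "f \<in> rcarrier ?D \<longleftrightarrow> (\<forall>k<N. f k \<in> rcarrier W) \<and> (\<forall>k\<ge>N. f k = 0)" for f
    by (simp add: direct_power_def)
  have D_carrier_apply: "f k \<in> rcarrier W" if "f \<in> rcarrier ?D" for f k
    using that W.subspace_0[OF W_sub] by (cases "k < N") (auto simp: D_carrier)
  have D_sub: "D.subspace (rcarrier ?D)"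
    unfolding D.subspace_def using W_sub by (auto simp: D_carrier sD W.subspace_def)
  have T'_add: "T' (f + g) = T' f + T' g" if "f \<in> rcarrier ?D" "g \<in> rcarrier ?D" for f g
    using that T' D.subspace_add[OF D_sub] subspace_add[OF subspace_carrier]
    by (intro T_inj) (auto simp: T_add)
  have T'_scale: "T' (rscale ?D c f) = sc c (T' f)" if "f \<in> rcarrier ?D" for c f
    using that T' D.subspace_scale[OF D_sub] subspace_scale[OF subspace_carrier]
    by (intro T_inj) (auto simp: T_scale)
  have T_0: "T 0 = 0"
    using T_scale[of 0 0] subspace_0[OF subspace_carrier] by simp
  have D_weight: "f \<in> weight_space K ?D \<mu> \<longleftrightarrow> (\<forall>k<N. f k \<in> weight_space K W \<mu>) \<and> (\<forall>k\<ge>N. f k = 0)" for f \<mu>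
    unfolding weight_space_def by (auto simp: direct_power_def fun_eq_iff)
  have T_weight: "T u \<in> weight_space K ?D \<mu>" if "u \<in> weight_space K M \<mu>" for u \<mu>
  proof -
    have uM: "u \<in> rcarrier M" "\<And>x. x \<in> cartan K \<Longrightarrow> act M x u = sc (\<mu> x) u"
      using that by (auto simp: weight_space_def)
    then show ?thesis
      using T_mem[OF uM(1)]
      by (simp add: weight_space_def T_act[OF uM(1), symmetric] T_scale[OF uM(1), symmetric] uM(2))
  qed
  have T'_weight: "T' f \<in> weight_space K M \<mu>" if f: "f \<in> weight_space K ?D \<mu>" for f \<mu>
  proof -
    have fD: "f \<in> rcarrier ?D" "\<And>x. x \<in> cartan K \<Longrightarrow> act ?D x f = rscale ?D (\<mu> x) f"
      using f by (auto simp: weight_space_def)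
    have "act M x (T' f) = sc (\<mu> x) (T' f)" if "x \<in> cartan K" for x
      using fD that T' subspace_scale[OF subspace_carrier] act_closed
      by (intro T_inj) (auto simp: T_act T_scale)
    then show ?thesis
      using T'(1)[OF fD(1)] by (simp add: weight_space_def)
  qed
  define \<delta> where "\<delta> u = (\<lambda>k::nat. if k = 0 then u else 0)" for u :: 'w
  have \<delta>_carrier: "\<delta> u \<in> rcarrier ?D" if "u \<in> rcarrier W" for u
    using that N W.subspace_0[OF W_sub] by (auto simp: \<delta>_def D_carrier)
  have W_weight_sub: "W.subspace (weight_space K W \<mu>)" for \<mu>
    using W_sub by (auto simp: weight_space_def W.subspace_def W_act_0 W_act_add W_act_scale
        W.scale_right_distrib mult.commute)
  have \<delta>_weight: "\<delta> u \<in> weight_space K ?D \<mu>" if "u \<in> weight_space K W \<mu>" for u \<mu>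
    using that N W.subspace_0[OF W_weight_sub] by (auto simp: \<delta>_def D_weight)
  show "rcarrier W \<subseteq> W.span (\<Union>\<mu>\<in>dual_space (lscale K) (cartan K). weight_space K W \<mu>)"
  proof
    let ?U = "W.span (\<Union>\<mu>\<in>dual_space (lscale K) (cartan K). weight_space K W \<mu>)"
    fix u assume u: "u \<in> rcarrier W"
    have "v \<in> rcarrier M \<and> T v 0 \<in> ?U" if "v \<in> span (e ` I)" for v
      using that
    proof (induction rule: span_induct_alt)
      case base
      then show ?case
        using T_0 subspace_0[OF subspace_carrier] W.span_zero by simp
    next
      case (step c x y)
      then obtain i where i: "i \<in> I" "x = e i" by blast
      have "T x 0 \<in> weight_space K W (b i)"
        using T_weight[OF wt[OF i(1)]] i(2) N by (simp add: D_weight)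
      then have "T x 0 \<in> ?U"
        using dual[OF i(1)] by (intro W.span_base) blast
      then show ?case
        using step.IH e_carrier[OF i(1)] i(2) subspace_scale[OF subspace_carrier e_carrier[OF i(1)], of c]
        by (auto simp: T_add T_scale sD intro!: W.span_add W.span_scale subspace_add[OF subspace_carrier])
    qed
    from this[of "T' (\<delta> u)"] show "u \<in> ?U"
      using T'[OF \<delta>_carrier[OF u]] span_basis by (simp add: \<delta>_def)
  qed
  assume \<mu>: "\<mu> \<in> dual_space (lscale K) (cartan K)" and fin: "finite {i \<in> I. b i = \<mu>}"
  have M_fin: "weight_space K M \<mu> \<subseteq> span (e ` {i \<in> I. b i = \<mu>})" "finite (e ` {i \<in> I. b i = \<mu>})"
    using weight_space_eq_span[OF \<mu>] fin by auto
  interpret WM: vector_space_pair "rscale W" sc ..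
  interpret DM: vector_space_pair "rscale ?D" sc ..
  interpret MD: vector_space_pair sc "rscale ?D" ..
  have \<delta>_hom: "\<delta> (u + v) = \<delta> u + \<delta> v" "\<delta> (rscale W c u) = rscale ?D c (\<delta> u)" for u v c
    by (auto simp: \<delta>_def sD fun_eq_iff)
  have WC: "u \<in> rcarrier W" if "u \<in> weight_space K W \<mu>" for u
    using that by (simp add: weight_space_def)
  have "\<exists>B. finite B \<and> weight_space K W \<mu> \<subseteq> W.span B"
  proof (rule WM.dim_le_of_injective(2)[where f = "\<lambda>u. T' (\<delta> u)", OF _ _ _ _ _ M_fin])
    show "(\<lambda>u. T' (\<delta> u)) ` weight_space K W \<mu> \<subseteq> weight_space K M \<mu>"
      using T'_weight \<delta>_weight by blast
    show "u = 0" if "u \<in> weight_space K W \<mu>" "T' (\<delta> u) = 0" for u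
    proof -
      have "\<delta> u = 0"
        using T'(2)[OF \<delta>_carrier[OF WC[OF that(1)]]] that(2) T_0 by simp
      then show ?thesis
        by (simp add: \<delta>_def fun_eq_iff) metis
    qed
  qed (use W_weight_sub in \<open>auto simp: \<delta>_hom T'_add T'_scale \<delta>_carrier WC\<close>)
  then obtain B where B: "finite B" "weight_space K W \<mu> \<subseteq> W.span B"
    by blast
  then show "fin_dim (rscale W) (weight_space K W \<mu>)"
    by (auto simp: fin_dim_def)
  have DC: "f \<in> rcarrier ?D" if "f \<in> weight_space K ?D \<mu>" for f
    using that by (simp add: weight_space_def)
  have MC: "v \<in> rcarrier M" if "v \<in> weight_space K M \<mu>" for v
    using that by (simp add: weight_space_def)
  have D_weight_sub: "D.subspace (weight_space K ?D \<mu>)"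
    unfolding D.subspace_def using W_weight_sub[of \<mu>] by (auto simp: D_weight sD W.subspace_def)
  have le1: "D.dim (weight_space K ?D \<mu>) \<le> dim (weight_space K M \<mu>)"
    and D_fin: "\<exists>B. finite B \<and> weight_space K ?D \<mu> \<subseteq> D.span B"
  proof -
    have inj0: "f = 0" if "f \<in> weight_space K ?D \<mu>" "T' f = 0" for f
      using T'(2)[OF DC[OF that(1)]] that(2) T_0 by simp
    note facts = D_weight_sub T'_add[OF DC DC] T'_scale[OF DC] inj0 _ M_fin
    show "D.dim (weight_space K ?D \<mu>) \<le> dim (weight_space K M \<mu>)"
      by (rule DM.dim_le_of_injective(1)[where f = T', OF facts]) (use T'_weight in auto)
    show "\<exists>B. finite B \<and> weight_space K ?D \<mu> \<subseteq> D.span B"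
      by (rule DM.dim_le_of_injective(2)[where f = T', OF facts]) (use T'_weight in auto)
  qed
  obtain C where C: "finite C" "weight_space K ?D \<mu> \<subseteq> D.span C"
    using D_fin by blast
  have inj0: "v = 0" if "v \<in> weight_space K M \<mu>" "T v = 0" for v
    using T_inj[of v 0] that MC T_0 subspace_0[OF subspace_carrier] by simp
  have le2: "dim (weight_space K M \<mu>) \<le> D.dim (weight_space K ?D \<mu>)"
    by (rule MD.dim_le_of_injective(1)[where f = T, OF subspace_weight_space T_add[OF MC MC] T_scale[OF MC] inj0 _ C(2,1)])
      (use T_weight in auto)
  have "D.dim (weight_space K ?D \<mu>) = N * weight_mult K W \<mu>"
  proof -
    have "weight_space K ?D \<mu> = {f. (\<forall>k<N. f k \<in> weight_space K W \<mu>) \<and> (\<forall>k\<ge>N. f k = 0)}"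
      using D_weight by blast
    then show ?thesis
      unfolding sD weight_mult_def using dim_direct_power(2)[OF W.vector_space_axioms W_weight_sub B, of N]
      by simp
  qed
  then show "N * weight_mult K W \<mu> = card {i \<in> I. b i = \<mu>}"
    using le1 le2 weight_mult_eq[OF \<mu>] by (simp add: weight_mult_def)
qed

end

section \<open>Formal exponentials and the expansion of finite products\<close>

lemma fexp_0: "fexp 0 = 1"
  by (simp only: fexp_def single_one)

lemma fexp_add: "fexp (\<mu> + \<nu>) = fexp \<mu> * fexp \<nu>"
  by (simp only: fexp_def mult_single mult_1)

lemma prod_fexp: "finite A \<Longrightarrow> (\<Prod>a\<in>A. fexp (f a)) = fexp (sum f A)"
  by (induction A rule: finite_induct) (simp_all only: fexp_0 fexp_add prod.empty prod.insert sum.empty sum.insert not_False_eq_True)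

lemma lookup_of_nat_times:
  "Poly_Mapping.lookup (of_nat m * p) \<mu> = of_nat m * Poly_Mapping.lookup (p :: _ \<Rightarrow>\<^sub>0 int) \<mu>"
  by (induction m) (simp_all add: distrib_right lookup_add)

lemma lookup_fexp: "Poly_Mapping.lookup (fexp \<beta>) \<mu> = (if \<beta> = \<mu> then 1 else 0)"
  by (simp add: fexp_def lookup_single when_def)

text \<open>Each power is spread over the indices of its weight, giving one factor per index;
  expanding then amounts to choosing the set \<open>J\<close> of indices at which the exponential is
  taken.\<close>

lemma lookup_prod_one_plus_fexp:
  fixes b :: "'i \<Rightarrow> 'g \<Rightarrow> complex"
  assumes F: "finite F" and lev: "\<And>\<beta>. finite {i \<in> I. b i = \<beta>}"
  shows "Poly_Mapping.lookup (\<Prod>\<beta>\<in>F. (1 + fexp (- \<beta>)) ^ card {i \<in> I. b i = \<beta>}) \<nu> =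
    int (card {J. J \<subseteq> {i \<in> I. b i \<in> F} \<and> - sum b J = \<nu>})"
proof -
  let ?S = "{i \<in> I. b i \<in> F}"
  have "?S = (\<Union>\<beta>\<in>F. {i \<in> I. b i = \<beta>})"
    by auto
  then have S: "finite ?S"
    using F lev by simp
  have "(\<Prod>\<beta>\<in>F. (1 + fexp (- \<beta>)) ^ card {i \<in> I. b i = \<beta>}) =
      (\<Prod>\<beta>\<in>F. \<Prod>i\<in>{i \<in> ?S. b i = \<beta>}. 1 + fexp (- b i))"
  proof (rule prod.cong[OF HOL.refl])
    fix \<beta> assume "\<beta> \<in> F"
    then have "{i \<in> ?S. b i = \<beta>} = {i \<in> I. b i = \<beta>}"
      by auto
    then show "(1 + fexp (- \<beta>)) ^ card {i \<in> I. b i = \<beta>} = (\<Prod>i\<in>{i \<in> ?S. b i = \<beta>}. 1 + fexp (- b i))"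
      by simp
  qed
  also have "\<dots> = (\<Prod>i\<in>?S. fexp (- b i) + 1)"
    using prod.group[OF S F, of b "\<lambda>i. 1 + fexp (- b i)"] by (simp add: image_subset_iff add.commute)
  also have "\<dots> = (\<Sum>J\<in>Pow ?S. (\<Prod>i\<in>J. fexp (- b i)) * (\<Prod>i\<in>?S - J. 1))"
    by (rule prod_add[OF S])
  also have "\<dots> = (\<Sum>J\<in>Pow ?S. fexp (- sum b J))"
    using finite_subset[OF _ S] by (intro sum.cong) (auto simp only: Pow_iff prod_fexp sum_negf prod.neutral_const mult_1_right)
  finally have "Poly_Mapping.lookup (\<Prod>\<beta>\<in>F. (1 + fexp (- \<beta>)) ^ card {i \<in> I. b i = \<beta>}) \<nu> =
      (\<Sum>J\<in>Pow ?S. if - sum b J = \<nu> then 1 else 0)"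
    by (simp add: lookup_sum lookup_fexp)
  also have "\<dots> = int (card {J \<in> Pow ?S. - sum b J = \<nu>})"
    using S by (simp add: sum.If_cases Int_def)
  also have "{J \<in> Pow ?S. - sum b J = \<nu>} = {J. J \<subseteq> ?S \<and> - sum b J = \<nu>}"
    by auto
  finally show ?thesis .
qed

section \<open>Counting index sets by weight\<close>

context spin_module
begin

text \<open>In contrast to \<open>spin_sets I\<close>, positive indices of weight 0 are excluded;
  these sets account for a single copy of \<open>Spin0\<close>.\<close>

definition positive_sets :: "int set set" where
  "positive_sets = {J. finite J \<and> J \<subseteq> {j \<in> I. 0 < Re (b j d)}}"

definition spin_count :: "('g \<Rightarrow> complex) \<Rightarrow> nat" where
  "spin_count \<nu> = card {J \<in> positive_sets. - sum b J = \<nu>}"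

lemma positive_index: "j \<in> I \<Longrightarrow> 0 < Re (b j d) \<Longrightarrow> 0 < j"
  using orthogonal_sl2_weight_basis.positive_index[OF sl2] .

lemma b_eq_0_iff: "j \<in> I \<Longrightarrow> b j = 0 \<longleftrightarrow> Re (b j d) = 0"
  using orthogonal_sl2_weight_basis.b_d_eq_0[OF sl2] by auto

text \<open>The degrees of the members are positive and add up to \<open>- Re (\<nu> d)\<close>, so
  none exceeds it. This makes each coefficient of the infinite product finite and determined by
  finitely many factors.\<close>

lemma positive_set_bounded:
  assumes "J \<in> positive_sets" "- sum b J = \<nu>" "j \<in> J"
  shows "Re (b j d) \<le> \<bar>Re (\<nu> d)\<bar>"
proof -
  have J: "finite J" "\<And>i. i \<in> J \<Longrightarrow> 0 \<le> Re (b i d)"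
    using assms(1) by (auto simp: positive_sets_def)
  have "Re (b j d) \<le> (\<Sum>i\<in>J. Re (b i d))"
    using J assms(3) by (intro member_le_sum) auto
  also have "\<dots> = - Re (\<nu> d)"
    by (simp add: assms(2)[symmetric] sum_fun_apply)
  finally show ?thesis by simp
qed

lemma finite_positive_sets: "finite {J \<in> positive_sets. - sum b J = \<nu>}"
proof (rule finite_subset)
  show "{J \<in> positive_sets. - sum b J = \<nu>} \<subseteq> Pow {i \<in> I. \<bar>Re (b i d)\<bar> \<le> \<bar>Re (\<nu> d)\<bar>}"
  proof clarify
    fix J j assume J: "J \<in> positive_sets" "\<nu> = - sum b J" "j \<in> J"
    then have "j \<in> I" "0 < Re (b j d)"
      by (auto simp: positive_sets_def)
    then show "j \<in> I \<and> \<bar>Re (b j d)\<bar> \<le> \<bar>Re ((- sum b J) d)\<bar>"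
      using positive_set_bounded[OF J(1) _ J(3), of "- sum b J"] by simp
  qed
qed (use finite_d_bounded in simp)

definition zero_indices :: "int set" where
  "zero_indices = {j \<in> I. 0 < j \<and> b j = 0}"

lemma finite_zero_indices: "finite zero_indices"
  by (rule finite_subset[OF _ finite_weight_level[of 0]]) (auto simp: zero_indices_def)

text \<open>Negation pairs the nonzero indices of weight 0, and index 0, if present, also has weight
  0. The division discards this possible odd index.\<close>

lemma card_zero_indices: "card zero_indices = weight_mult K V 0 div 2"
proof -
  let ?Z = "zero_indices" and ?O = "I \<inter> {0}"
  have "{j \<in> I. b j = 0} = (?Z \<union> uminus ` ?Z) \<union> ?O"
  proof (intro set_eqI iffI)
    fix j assume j: "j \<in> {j \<in> I. b j = 0}"
    consider "0 < j" | "j = 0" | "0 < - j" by linarith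
    then show "j \<in> (?Z \<union> uminus ` ?Z) \<union> ?O"
    proof cases
      case 3
      then have "- j \<in> ?Z"
        using j uminus_index[of j] b_uminus_index[of j] by (auto simp: zero_indices_def)
      then show ?thesis
        by force
    qed (use j in \<open>auto simp: zero_indices_def\<close>)
  next
    fix j assume "j \<in> (?Z \<union> uminus ` ?Z) \<union> ?O"
    moreover have "b 0 = 0" if "0 \<in> I"
      using b_uminus_index[OF that] by (auto simp: fun_eq_iff)
    ultimately show "j \<in> {j \<in> I. b j = 0}"
      using uminus_index b_uminus_index by (auto simp: zero_indices_def)
  qed
  moreover have "card ((?Z \<union> uminus ` ?Z) \<union> ?O) = card ?Z + card ?Z + card ?O"
  proof -
    have "card (?Z \<union> uminus ` ?Z) = card ?Z + card (uminus ` ?Z)"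
      using finite_zero_indices by (intro card_Un_disjoint) (auto simp: zero_indices_def)
    moreover have "card (uminus ` ?Z) = card ?Z"
      by (rule card_image) simp
    moreover have "card ((?Z \<union> uminus ` ?Z) \<union> ?O) = card (?Z \<union> uminus ` ?Z) + card ?O"
      using finite_zero_indices by (intro card_Un_disjoint) (auto simp: zero_indices_def)
    ultimately show ?thesis by simp
  qed
  moreover have "card ?O \<le> 1"
    using card_mono[of "{0::int}" ?O] by auto
  ultimately show ?thesis
    using weight_mult_eq[OF dual_space_0] by simp
qed

text \<open>Indices of weight 0 do not change \<open>sum b J\<close>, so they can be chosen freely;
  every other positive index has strictly positive degree.\<close>

lemma spin_sets_decompose:
  "bij_betw (\<lambda>(Z, J). Z \<union> J) (Pow zero_indices \<times> {J \<in> positive_sets. - sum b J = \<nu>})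
    {J \<in> spin_sets I. - sum b J = \<nu>}"
proof (rule bij_betw_byWitness[where f' = "\<lambda>J. (J \<inter> zero_indices, J - zero_indices)"])
  have disj: "J \<inter> zero_indices = {}" if "J \<in> positive_sets" for J
    using that by (auto simp: positive_sets_def zero_indices_def)
  have sum_zero: "sum b Z = 0" if "Z \<subseteq> zero_indices" for Z
    using that by (intro sum.neutral) (auto simp: zero_indices_def)
  show "\<forall>a\<in>Pow zero_indices \<times> {J \<in> positive_sets. - sum b J = \<nu>}.
      (case (case a of (Z, J) \<Rightarrow> Z \<union> J) of J \<Rightarrow> (J \<inter> zero_indices, J - zero_indices)) = a"
    using disj by blast
  show "\<forall>J\<in>{J \<in> spin_sets I. - sum b J = \<nu>}. (case (J \<inter> zero_indices, J - zero_indices) of (Z, J) \<Rightarrow> Z \<union> J) = J"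
    by auto
  show "(\<lambda>(Z, J). Z \<union> J) ` (Pow zero_indices \<times> {J \<in> positive_sets. - sum b J = \<nu>}) \<subseteq>
      {J \<in> spin_sets I. - sum b J = \<nu>}"
  proof (rule image_subsetI)
    fix p assume "p \<in> Pow zero_indices \<times> {J \<in> positive_sets. - sum b J = \<nu>}"
    then obtain Z J where p: "p = (Z, J)" and Z: "Z \<subseteq> zero_indices"
      and J: "J \<in> positive_sets" "- sum b J = \<nu>"
      by blast
    have fin: "finite Z" "finite J"
      using finite_subset[OF Z finite_zero_indices] J by (auto simp: positive_sets_def)
    have "Z \<inter> J = {}"
      using disj[OF J(1)] Z by blast
    then have "sum b (Z \<union> J) = sum b J"
      using fin sum_zero[OF Z] by (simp add: sum.union_disjoint)
    moreover have "Z \<union> J \<in> spin_sets I"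
      using Z J fin positive_index by (auto simp: spin_sets_def zero_indices_def positive_sets_def)
    ultimately show "(case p of (Z, J) \<Rightarrow> Z \<union> J) \<in> {J \<in> spin_sets I. - sum b J = \<nu>}"
      using J(2) p by simp
  qed
  show "(\<lambda>J. (J \<inter> zero_indices, J - zero_indices)) ` {J \<in> spin_sets I. - sum b J = \<nu>} \<subseteq>
      Pow zero_indices \<times> {J \<in> positive_sets. - sum b J = \<nu>}"
  proof (rule image_subsetI)
    fix J assume "J \<in> {J \<in> spin_sets I. - sum b J = \<nu>}"
    then have J: "J \<in> spin_sets I" "- sum b J = \<nu>"
      by auto
    have fin: "finite J" "J \<subseteq> {i \<in> I. 0 < i}"
      using J(1) by (auto simp: spin_sets_def)
    have "sum b J = sum b (J \<inter> zero_indices) + sum b (J - zero_indices)"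
      by (rule sum.Int_Diff[OF fin(1)])
    then have "sum b (J - zero_indices) = sum b J"
      using sum_zero[of "J \<inter> zero_indices"] by simp
    moreover have "J - zero_indices \<in> positive_sets"
    proof -
      have "0 < Re (b j d)" if "j \<in> J - zero_indices" for j
        using that fin(2) b_pos[of j] b_eq_0_iff[of j] by (force simp: zero_indices_def)
      then show ?thesis
        using fin by (auto simp: positive_sets_def)
    qed
    ultimately show "(J \<inter> zero_indices, J - zero_indices) \<in>
        Pow zero_indices \<times> {J \<in> positive_sets. - sum b J = \<nu>}"
      using J(2) by simp
  qed
qed

lemma finite_spin_sets: "finite {J \<in> spin_sets I. - sum b J = \<nu>}"
  using bij_betw_finite[OF spin_sets_decompose[of \<nu>]] finite_zero_indices finite_positive_sets by simp

lemma card_spin_sets: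
  "card {J \<in> spin_sets I. - sum b J = \<nu>} = 2 ^ (weight_mult K V 0 div 2) * spin_count \<nu>"
  using bij_betw_same_card[OF spin_sets_decompose[of \<nu>]]
  by (simp add: card_cartesian_product card_Pow finite_zero_indices card_zero_indices spin_count_def)

lemma positive_weights_eq: "positive_weights K d V = b ` {j \<in> I. 0 < Re (b j d)}"
  by (auto simp: positive_weights_def weights_eq)

lemma finite_bounded_weights: "finite {\<beta> \<in> positive_weights K d V. Re (\<beta> d) \<le> D}"
proof (rule finite_subset)
  show "{\<beta> \<in> positive_weights K d V. Re (\<beta> d) \<le> D} \<subseteq> b ` {i \<in> I. \<bar>Re (b i d)\<bar> \<le> D}"
    by (auto simp: positive_weights_eq)
qed (use finite_d_bounded in simp)

text \<open>The coefficient at \<open>\<nu>\<close> is constant once all positive weights of degree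
  at most \<open>\<bar>Re (\<nu> d)\<bar>\<close> are present: by
  \<open>positive_set_bounded\<close> no further weight can take part in a set counted
  there.\<close>

lemma spin_product:
  "formal_has_prod (\<lambda>\<beta>. (1 + fexp (- \<beta>)) ^ weight_mult K V \<beta>) (positive_weights K d V)
    (\<lambda>\<nu>. int (spin_count \<nu>))"
  unfolding formal_has_prod_def eventually_finite_subsets_at_top
proof
  fix \<nu> :: "'g \<Rightarrow> complex"
  let ?X = "{\<beta> \<in> positive_weights K d V. Re (\<beta> d) \<le> \<bar>Re (\<nu> d)\<bar>}"
  have "Poly_Mapping.lookup (\<Prod>\<beta>\<in>F. (1 + fexp (- \<beta>)) ^ weight_mult K V \<beta>) \<nu> = int (spin_count \<nu>)"
    if F: "finite F" "?X \<subseteq> F" "F \<subseteq> positive_weights K d V" for F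
  proof -
    have lev: "weight_mult K V \<beta> = card {i \<in> I. b i = \<beta>}" if "\<beta> \<in> F" for \<beta>
      using that F(3) dual by (intro weight_mult_eq) (auto simp: positive_weights_eq)
    have "{i \<in> I. b i \<in> F} = (\<Union>\<beta>\<in>F. {i \<in> I. b i = \<beta>})"
      by auto
    then have fin: "finite {i \<in> I. b i \<in> F}"
      using F(1) finite_weight_level by simp
    have "{J. J \<subseteq> {i \<in> I. b i \<in> F} \<and> - sum b J = \<nu>} = {J \<in> positive_sets. - sum b J = \<nu>}"
    proof (intro set_eqI iffI)
      fix J assume J: "J \<in> {J. J \<subseteq> {i \<in> I. b i \<in> F} \<and> - sum b J = \<nu>}"
      then have "J \<subseteq> {j \<in> I. 0 < Re (b j d)}"
        using F(3) by (auto simp: positive_weights_def)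
      then show "J \<in> {J \<in> positive_sets. - sum b J = \<nu>}"
        using J finite_subset[OF _ fin, of J] by (simp add: positive_sets_def)
    next
      fix J assume J: "J \<in> {J \<in> positive_sets. - sum b J = \<nu>}"
      have "j \<in> I \<and> b j \<in> F" if j: "j \<in> J" for j
      proof -
        have "j \<in> I" "0 < Re (b j d)"
          using J j by (auto simp: positive_sets_def)
        moreover have "Re (b j d) \<le> \<bar>Re (\<nu> d)\<bar>"
          using J j by (intro positive_set_bounded[of J]) auto
        ultimately show ?thesis
          using F(2) by (auto simp: positive_weights_def weights_eq)
      qed
      then show "J \<in> {J. J \<subseteq> {i \<in> I. b i \<in> F} \<and> - sum b J = \<nu>}"
        using J by auto
    qed
    then show ?thesis
      using lookup_prod_one_plus_fexp[OF F(1) finite_weight_level, of \<nu>] lev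
      by (simp add: spin_count_def cong: prod.cong)
  qed
  then show "\<exists>X. finite X \<and> X \<subseteq> positive_weights K d V \<and>
      (\<forall>Y. finite Y \<and> X \<subseteq> Y \<and> Y \<subseteq> positive_weights K d V \<longrightarrow>
        Poly_Mapping.lookup (\<Prod>\<beta>\<in>Y. (1 + fexp (- \<beta>)) ^ weight_mult K V \<beta>) \<nu> = int (spin_count \<nu>))"
    using finite_bounded_weights by (intro exI[of _ ?X]) auto
qed

lemma weight_mult_uminus:
  assumes "\<mu> \<in> dual_space (lscale K) (cartan K)"
  shows "weight_mult K V (- \<mu>) = weight_mult K V \<mu>"
proof -
  have "bij_betw uminus {i \<in> I. b i = \<mu>} {i \<in> I. b i = - \<mu>}"
    by (rule bij_betw_byWitness[where f' = uminus]) (auto simp: uminus_index b_uminus_index)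
  from bij_betw_same_card[OF this] show ?thesis
    by (simp only: weight_mult_eq[OF assms] weight_mult_eq[OF dual_space_uminus[OF assms]])
qed

section \<open>The character of \<open>V\<close>\<close>

definition positive_mult :: "('g \<Rightarrow> complex) \<Rightarrow> int" where
  "positive_mult \<mu> = (if \<mu> \<in> positive_weights K d V then int (weight_mult K V \<mu>) else 0)"

text \<open>Only the summands for \<open>\<mu>\<close> and \<open>- \<mu>\<close> affect the
  coefficient at \<open>\<mu>\<close>, so the partial sums are constant once these are
  included.\<close>

lemma character_sum:
  "formal_has_sum (\<lambda>\<beta>. of_nat (weight_mult K V \<beta>) * (fexp \<beta> + fexp (- \<beta>))) (positive_weights K d V)
    (\<lambda>\<mu>. positive_mult \<mu> + positive_mult (- \<mu>))"
  unfolding formal_has_sum_def eventually_finite_subsets_at_top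
proof
  fix \<mu> :: "'g \<Rightarrow> complex"
  have "Poly_Mapping.lookup (\<Sum>\<beta>\<in>F. of_nat (weight_mult K V \<beta>) * (fexp \<beta> + fexp (- \<beta>))) \<mu> =
      positive_mult \<mu> + positive_mult (- \<mu>)"
    if F: "finite F" "{\<mu>, - \<mu>} \<inter> positive_weights K d V \<subseteq> F" "F \<subseteq> positive_weights K d V" for F
  proof -
    have "Poly_Mapping.lookup (\<Sum>\<beta>\<in>F. of_nat (weight_mult K V \<beta>) * (fexp \<beta> + fexp (- \<beta>))) \<mu> =
        (\<Sum>\<beta>\<in>F. (if \<beta> = \<mu> then int (weight_mult K V \<beta>) else 0) + (if \<beta> = - \<mu> then int (weight_mult K V \<beta>) else 0))"
      unfolding lookup_sum
    proof (rule sum.cong[OF HOL.refl])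
      fix \<beta>
      have "- \<beta> = \<mu> \<longleftrightarrow> \<beta> = - \<mu>"
        by auto
      then have "Poly_Mapping.lookup (of_nat m * (fexp \<beta> + fexp (- \<beta>))) \<mu> =
          (if \<beta> = \<mu> then int m else 0) + (if \<beta> = - \<mu> then int m else 0)" for m
        by (simp only: lookup_of_nat_times lookup_add lookup_fexp) simp
      then show "Poly_Mapping.lookup (of_nat (weight_mult K V \<beta>) * (fexp \<beta> + fexp (- \<beta>))) \<mu> =
          (if \<beta> = \<mu> then int (weight_mult K V \<beta>) else 0) + (if \<beta> = - \<mu> then int (weight_mult K V \<beta>) else 0)" .
    qed
    also have "\<dots> = positive_mult \<mu> + positive_mult (- \<mu>)"
      using F by (auto simp: sum.distrib positive_mult_def)
    finally show ?thesis .
  qed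
  then show "\<exists>X. finite X \<and> X \<subseteq> positive_weights K d V \<and>
      (\<forall>Y. finite Y \<and> X \<subseteq> Y \<and> Y \<subseteq> positive_weights K d V \<longrightarrow>
        Poly_Mapping.lookup (\<Sum>\<beta>\<in>Y. of_nat (weight_mult K V \<beta>) * (fexp \<beta> + fexp (- \<beta>))) \<mu> =
        positive_mult \<mu> + positive_mult (- \<mu>))"
    by (intro exI[of _ "{\<mu>, - \<mu>} \<inter> positive_weights K d V"]) auto
qed

text \<open>A nonzero weight has nonzero degree, so exactly one of \<open>\<mu>\<close> and
  \<open>- \<mu>\<close> is positive, and both have the same multiplicity. The weight 0 is covered
  by the separate last term.\<close>

lemma character_V:
  "has_character K V (\<lambda>\<mu>. (positive_mult \<mu> + positive_mult (- \<mu>)) +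
    Poly_Mapping.lookup (of_nat (weight_mult K V 0) * fexp 0) \<mu>)"
  unfolding has_character_def
proof (intro conjI ballI allI impI)
  show "rcarrier V \<subseteq> span (\<Union>\<mu>\<in>dual_space (lscale K) (cartan K). weight_space K V \<mu>)"
    by (rule carrier_subset_span_weight_spaces)
  fix \<mu>
  show "fin_dim sc (weight_space K V \<mu>)" if "\<mu> \<in> dual_space (lscale K) (cartan K)"
    using that finite_weight_level by (rule fin_dim_weight_space)
  show "(positive_mult \<mu> + positive_mult (- \<mu>)) +
      Poly_Mapping.lookup (of_nat (weight_mult K V 0) * fexp 0) \<mu> = int (weight_mult K V \<mu>)"
    if \<mu>: "\<mu> \<in> dual_space (lscale K) (cartan K)"
  proof (cases "\<mu> \<in> b ` I")
    case True
    then obtain i where i: "i \<in> I" "\<mu> = b i" by blast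
    have ui: "- i \<in> I" "b (- i) = - \<mu>"
      using uminus_index[OF i(1)] b_uminus_index[OF i(1)] i(2) by auto
    have pos: "\<mu> \<in> positive_weights K d V \<longleftrightarrow> 0 < Re (\<mu> d)" "- \<mu> \<in> positive_weights K d V \<longleftrightarrow> Re (\<mu> d) < 0"
      using i ui image_eqI[of "- \<mu>" b "- i" I] by (auto simp: positive_weights_def weights_eq)
    show ?thesis
    proof (cases "Re (\<mu> d) = 0")
      case True
      then have "\<mu> = 0"
        using b_eq_0_iff[OF i(1)] i(2) by simp
      then show ?thesis
        using pos by (simp add: positive_mult_def lookup_of_nat_times lookup_fexp)
    next
      case False
      then have "0 \<noteq> \<mu>"
        by auto
      then have "Poly_Mapping.lookup (of_nat (weight_mult K V 0) * fexp 0) \<mu> = 0"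
        by (simp only: lookup_of_nat_times lookup_fexp if_False mult_zero_right)
      then show ?thesis
        using False weight_mult_uminus[OF \<mu>] unfolding positive_mult_def pos by simp
    qed
  next
    case False
    then have no: "{i \<in> I. b i = \<mu>} = {}"
      by blast
    then have m: "weight_mult K V \<mu> = 0"
      using weight_mult_eq[OF \<mu>] by (simp only: card.empty)
    moreover have "\<mu> \<notin> positive_weights K d V" "- \<mu> \<in> positive_weights K d V \<Longrightarrow> weight_mult K V (- \<mu>) = 0"
      using False weight_mult_uminus[OF \<mu>] m by (auto simp: positive_weights_def weights_eq)
    ultimately show ?thesis
      by (auto simp: positive_mult_def lookup_of_nat_times lookup_fexp)
  qed
  show "(positive_mult \<mu> + positive_mult (- \<mu>)) +
      Poly_Mapping.lookup (of_nat (weight_mult K V 0) * fexp 0) \<mu> = 0"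
    if \<mu>: "\<mu> \<notin> dual_space (lscale K) (cartan K)"
  proof -
    have "- \<mu> \<notin> dual_space (lscale K) (cartan K)"
      using \<mu> dual_space_uminus[of "- \<mu>"] by auto
    then show ?thesis
      using \<mu> dual_space_0[of "lscale K" "cartan K"]
      by (auto simp: positive_mult_def positive_weights_def weights_def lookup_of_nat_times lookup_fexp)
  qed
qed

end

text \<open>Fundamental weights are constrained at coroots only. The assumption
  \<open>compatible\<close> normalizes their combination on the complement \<open>H''\<close>, where
  the lift is governed by \<open>\<psi>\<close>.\<close>

locale spin_module_fundamental = spin_module K d V I e b H'' \<psi> \<tau>
  for K :: "('g::ab_group_add, 'n::finite) km_data" and d :: 'g
    and V :: "('g, 'v::ab_group_add) rep"
    and I :: "int set" and e :: "int \<Rightarrow> 'v" and b :: "int \<Rightarrow> 'g \<Rightarrow> complex"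
    and H'' \<psi> \<tau> +
  fixes \<Lambda> :: "'n \<Rightarrow> 'g \<Rightarrow> complex"
  assumes fundamental: "fundamental_weights K \<Lambda>"
    and compatible: "x \<in> H'' \<Longrightarrow> spin_weight K d V \<Lambda> x = \<psi> x"
begin

abbreviation \<rho> where "\<rho> \<equiv> spin_weight K d V \<Lambda>"

lemma \<rho>_dual: "\<rho> \<in> dual_space (lscale K) (cartan K)"
proof -
  have "\<rho> = (\<Sum>i\<in>UNIV. (\<lambda>x. spin_coeff K d V i * \<Lambda> i x))"
    by (simp add: spin_weight_def fun_eq_iff sum_fun_apply)
  also have "\<dots> \<in> dual_space (lscale K) (cartan K)"
    using fundamental by (intro dual_space_sum dual_space_scale) (auto simp: fundamental_weights_def)
  finally show ?thesis .
qed

lemma \<rho>_coroot: "\<rho> (coroot K i) = spin_coeff K d V i"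
  using fundamental by (simp add: spin_weight_def fundamental_weights_def if_distrib[of "\<lambda>c. _ * c"] cong: if_cong)

lemma vacuum_mem: "basis_spinor {} \<in> spin_space I"
  by (rule basis_spinor_mem) (simp add: spin_sets_def)

text \<open>Both sides are additive on the decomposition of the Cartan subalgebra. On coroots this
  is \<open>vacuum_expectation\<close>; on \<open>H''\<close> the diagonal \<open>spin_phi\<close>
  kills the vacuum, as its sum over occupied indices is empty, and only \<open>\<psi>\<close> is
  left.\<close>

lemma vacuum_weight:
  assumes x: "x \<in> cartan K"
  shows "Poly_Mapping.lookup (\<tau> x (basis_spinor {})) {} = \<rho> x"
proof -
  have compl: "complement_in (lscale K) (cartan K) (coroot_span K) H''"
    using lift by (simp add: spin_lift_def)
  then have cartan: "cartan K = {y + z |y z. y \<in> coroot_span K \<and> z \<in> H''}" and H'': "lie.subspace H''"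
    by (simp_all add: complement_in_def)
  have "coroot_span K \<subseteq> cartan K" "H'' \<subseteq> cartan K"
    unfolding cartan using lie.subspace_0[OF H''] lie.span_zero[of "range (coroot K)"]
    by (auto simp: coroot_span_def) (metis add_0_right, metis add_0)
  note sub = this
  have \<rho>_add: "\<rho> (y + z) = \<rho> y + \<rho> z" and \<rho>_scale: "\<rho> (lscale K c y) = c * \<rho> y"
    if "y \<in> cartan K" "z \<in> cartan K" for y z c
    using that \<rho>_dual unfolding dual_space_def linear_functional_on_def by blast+
  have cartan_sub: "lie.subspace (cartan K)"
    unfolding cartan coroot_span_def using lie.subspace_sums[OF lie.subspace_span H''] .
  have cr: "Poly_Mapping.lookup (\<tau> y (basis_spinor {})) {} = \<rho> y" if "y \<in> coroot_span K" for y
  proof -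
    have "y \<in> cartan K \<and> Poly_Mapping.lookup (\<tau> y (basis_spinor {})) {} = \<rho> y"
      using that unfolding coroot_span_def
    proof (induction rule: lie.span_induct_alt)
      case base
      show ?case
        using \<tau>_scale_left[OF vacuum_mem, of 0 0] \<rho>_scale[OF d_cartan d_cartan, of 0]
          lie.subspace_0[OF cartan_sub] by simp
    next
      case (step c y z)
      then obtain i where i: "y = coroot K i" by blast
      have mem: "y \<in> cartan K" "lscale K c y \<in> cartan K" "z \<in> cartan K"
        using step.IH lie.subspace_scale[OF cartan_sub] coroot_cartan by (auto simp: i)
      have "Poly_Mapping.lookup (\<tau> y (basis_spinor {})) {} = \<rho> y"
        unfolding i vacuum_expectation \<rho>_coroot ..
      then show ?case
        using step.IH mem lie.subspace_add[OF cartan_sub mem(2,3)]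
        by (simp add: \<tau>_add_left[OF vacuum_mem] \<tau>_scale_left[OF vacuum_mem] lookup_add
            \<rho>_add[OF mem(2,3)] \<rho>_scale[OF mem(1) mem(1)])
    qed
    then show ?thesis ..
  qed
  have hh: "Poly_Mapping.lookup (\<tau> z (basis_spinor {})) {} = \<rho> z" if z: "z \<in> H''" for z
  proof -
    have "z \<in> lie.span (H'' \<union> root_part K)"
      using z by (intro lie.span_base) simp
    then have "\<tau> z (basis_spinor {}) = spin_phi (mat z) (basis_spinor {}) + spin_scale (\<psi> z) (basis_spinor {})"
      using lift vacuum_mem unfolding spin_lift_def by blast
    moreover have "spin_phi (mat z) (basis_spinor {}) = 0"
    proof -
      have "i = j" if "mat z i j \<noteq> 0" for i j
        using that mat_cartan[of z i j] sub(2) z by (auto simp: mat_eq[of z i j] split: if_splits)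
      then show ?thesis
        using spin_phi_diagonal[OF mat_so, of "{}" z] by (simp add: spin_sets_def)
    qed
    ultimately show ?thesis
      using compatible[OF z] by simp
  qed
  obtain y z where "x = y + z" "y \<in> coroot_span K" "z \<in> H''"
    using x unfolding cartan by blast
  then show ?thesis
    using cr hh sub by (simp add: \<tau>_add_left[OF vacuum_mem] lookup_add \<rho>_add subsetD)
qed

lemma \<tau>_basis_spinor:
  assumes x: "x \<in> cartan K" and J: "J \<in> spin_sets I"
  shows "\<tau> x (basis_spinor J) = spin_scale ((\<rho> - sum b J) x) (basis_spinor J)"
proof -
  obtain c where c: "\<And>J. J \<in> spin_sets I \<Longrightarrow>
      \<tau> x (basis_spinor J) = Poly_Mapping.single J (c - (\<Sum>j\<in>J. b j x))"
    using \<tau>_cartan[OF x] by blast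
  have "c = \<rho> x"
    using c[of "{}"] vacuum_weight[OF x] by (simp add: spin_sets_def)
  then show ?thesis
    using c[OF J] by (simp add: sum_fun_apply)
qed

lemma spin_weight_basis:
  "weight_basis K (spin_rep I \<tau>) (spin_sets I) basis_spinor (\<lambda>J. \<rho> - sum b J)"
proof
  show "representation_of K (spin_rep I \<tau>)"
    by (rule spin_rep)
  show "\<rho> - sum b J \<in> dual_space (lscale K) (cartan K)" if "J \<in> spin_sets I" for J
    using that dual by (intro dual_space_diff \<rho>_dual dual_space_sum) (auto simp: spin_sets_def)
  show "basis_spinor J \<in> weight_space K (spin_rep I \<tau>) (\<rho> - sum b J)" if "J \<in> spin_sets I" for J
    using basis_spinor_mem[OF that] \<tau>_basis_spinor[OF _ that] by (simp add: weight_space_def spin_rep_def)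
qed (use inj_basis_spinor independent_basis_spinor span_basis_spinor in \<open>auto simp: spin_rep_def\<close>)

text \<open>A weight of the spin representation is \<open>\<rho> - sum b J\<close>, so its
  multiplicity counts the sets with \<open>- sum b J = \<mu> - \<rho>\<close>. That count carries
  the factor \<open>2 ^ (weight_mult K V 0 div 2)\<close>, which cancels against the number of
  copies.\<close>

lemma character_Spin0:
  fixes W :: "('g, 'w::ab_group_add) rep"
  assumes W: "is_spin0 K V I \<tau> W"
  shows "has_character K W (fexp_times \<rho> (\<lambda>\<nu>. int (spin_count \<nu>)))"
proof -
  interpret S: weight_basis K "spin_rep I \<tau>" "spin_sets I" basis_spinor "\<lambda>J. \<rho> - sum b J"
    by (rule spin_weight_basis)
  have eq: "{J \<in> spin_sets I. \<rho> - sum b J = \<mu>} = {J \<in> spin_sets I. - sum b J = \<mu> - \<rho>}" for \<mu>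
    by (auto simp: algebra_simps)
  have rep: "representation_of K W"
    and iso: "rep_isomorphic (spin_rep I \<tau>) (direct_power (2 ^ (weight_mult K V 0 div 2)) W)"
    using W by (auto simp: is_spin0_def)
  note char = S.direct_power_character[OF rep iso]
  show ?thesis
    unfolding has_character_def
  proof (intro conjI ballI allI impI)
    show "rcarrier W \<subseteq>
      module.span (rscale W) (\<Union>\<mu>\<in>dual_space (lscale K) (cartan K). weight_space K W \<mu>)"
      by (rule char(1)) simp
    fix \<mu>
    show "fin_dim (rscale W) (weight_space K W \<mu>)" if "\<mu> \<in> dual_space (lscale K) (cartan K)"
      by (rule char(2)[OF _ that]) (simp_all add: eq finite_spin_sets)
    show "fexp_times \<rho> (\<lambda>\<nu>. int (spin_count \<nu>)) \<mu> = int (weight_mult K W \<mu>)"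
      if "\<mu> \<in> dual_space (lscale K) (cartan K)"
      using char(3)[OF _ that] by (simp add: eq finite_spin_sets card_spin_sets fexp_times_def)
    show "fexp_times \<rho> (\<lambda>\<nu>. int (spin_count \<nu>)) \<mu> = 0" if "\<mu> \<notin> dual_space (lscale K) (cartan K)"
    proof -
      \<comment> \<open>Outside the dual of the Cartan subalgebra the coefficient must be 0; every
        \<open>\<rho> - sum b J\<close> lies inside, so no set is counted.\<close>
      have "{J \<in> positive_sets. - sum b J = \<mu> - \<rho>} = {}"
      proof (rule ccontr)
        assume "{J \<in> positive_sets. - sum b J = \<mu> - \<rho>} \<noteq> {}"
        then obtain J where J: "J \<in> positive_sets" "- sum b J = \<mu> - \<rho>"
          by blast
        have "\<mu> = \<rho> - sum b J"
          using J(2) by (simp add: algebra_simps)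
        moreover have "\<rho> - sum b J \<in> dual_space (lscale K) (cartan K)"
          using J(1) dual by (intro dual_space_diff \<rho>_dual dual_space_sum) (auto simp: positive_sets_def)
        ultimately show False
          using that by simp
      qed
      then show ?thesis
        by (simp only: fexp_times_def spin_count_def card.empty of_nat_0)
    qed
  qed
qed

end

theorem proposition2:
  fixes K :: "('g::ab_group_add, 'n::finite) km_data"
    and d :: 'g
    and V :: "('g, 'v::ab_group_add) rep"
    and Q :: "'v \<Rightarrow> 'v \<Rightarrow> complex"
    and I :: "int set"
    and e :: "int \<Rightarrow> 'v"
    and H'' :: "'g set"
    and \<psi> :: "'g \<Rightarrow> complex"
    and \<tau> :: "'g \<Rightarrow> spinor \<Rightarrow> spinor"
    and \<Lambda> :: "'n \<Rightarrow> 'g \<Rightarrow> complex"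
    and Spin0 :: "('g, 'w::ab_group_add) rep"
  assumes "augmented_km K d"
    and "representation_of K V"
    and "integrable_rep K V"
    and "d_finite K d V"
    and "invariant_form V Q"
    and "adapted_basis K d V Q I e"
    and "spin_lift K V I e H'' \<psi> \<tau>"
    and "is_spin0 K V I \<tau> Spin0"
    and "fundamental_weights K \<Lambda>"
    and "\<forall>x\<in>H''. spin_weight K d V \<Lambda> x = \<psi> x"
  shows "(\<exists>S. formal_has_sum
              (\<lambda>\<beta>. of_nat (weight_mult K V \<beta>) * (fexp \<beta> + fexp (- \<beta>)))
              (positive_weights K d V) S \<and>
            has_character K V
              (\<lambda>\<mu>. S \<mu> + Poly_Mapping.lookup (of_nat (weight_mult K V 0) * fexp 0) \<mu>)) \<and>
         (\<forall>i. finite (crossing_weights K d V i)) \<and>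
         (\<exists>P. formal_has_prod
              (\<lambda>\<beta>. (1 + fexp (- \<beta>)) ^ weight_mult K V \<beta>)
              (positive_weights K d V) P \<and>
            has_character K Spin0 (fexp_times (spin_weight K d V \<Lambda>) P))"
proof -
  have "\<forall>i\<in>I. \<exists>\<beta>. \<beta> \<in> dual_space (lscale K) (cartan K) \<and>
      e i \<in> weight_space K V \<beta> \<and> (0 < i \<longrightarrow> 0 \<le> Re (\<beta> d))"
    using assms(6) unfolding adapted_basis_def by blast
  then obtain b where b: "\<And>i. i \<in> I \<Longrightarrow> b i \<in> dual_space (lscale K) (cartan K)"
    "\<And>i. i \<in> I \<Longrightarrow> e i \<in> weight_space K V (b i)" "\<And>i. i \<in> I \<Longrightarrow> 0 < i \<Longrightarrow> 0 \<le> Re (b i d)"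
    by metis
  interpret spin_module_fundamental K d V I e b H'' \<psi> \<tau> \<Lambda>
    by unfold_locales (use assms b in \<open>auto simp: adapted_basis_def\<close>)
  show ?thesis
    using character_sum character_V finite_crossing_weights spin_product character_Spin0[OF assms(8)]
    by blast
qed

end
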